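(* Let $T:[0,1]\to[0,1]$ be a constructive piecewise isometry (an interval exchange transformation with flips), and let $\alpha$ be a finite partition of $[0,1]$ each of whose sets is a finite union of intervals with constructive end points. Then for Lebesgue-a.e. $x\in[0,1]$ $$\limsup_{n\to\infty}\frac{AIC(x,\alpha,n)}{\log n}\le2 .$$
   Context: A real number $z$ is constructive if there is an algorithm $A_z:\mathbb{N}\to\mathbb{Q}$ such that $|A_z(n)-z|<2^{-n}$ for all $n$. A constructive piecewise isometry on the interval is a piecewise isometry $T$ of $[0,1]$ (that is, $[0,1]$ is divided into finitely many intervals on each of which $T$ is an isometry, $x\mapsto\pm x+c$) which preserves Lebesgue measure and such that both the discontinuity points $y_1,\dots,y_l$ of $T$ and the values $T(y_1),\dots,T(y_l)$ are constructive numbers. Algorithmic information content: let $M_1,M_2,\dots$ be a computable enumeration of the Turing machines and $e_n$ the $n$-th binary string in lexicographical order $0,1,00,01,\dots$. Fix a universal Turing machine $U$, i.e. one with $U(\hat e_n p)=M_n(p)$ for all $n$ and all finite binary strings $p$, where for a word $q$ of length $m$, $\hat q=q(0)q(0)q(1)q(1)\cdots q(m-1)q(m-1)01$. For a finite string $s$ over a finite alphabet, $AIC_U(s)=\min\{\ell(p):U(p)=s\}$ over finite binary strings $p$, with $\ell(p)$ the length of $p$ (and $\infty$ if there is no such $p$). $AIC(x,\alpha,n)=AIC_U(\omega_0\cdots\omega_{n-1})$, where $\omega_j$ is the index of the element of $\alpha$ containing $T^jx$. Here $\log=\log_2$. *)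

theory Defs
  imports "HOL-Analysis.Analysis"
begin

text \<open>
  One tape, infinite in both directions; states and tape symbols are natural numbers.
  A machine is a finite table of rules ((state, read), (new state, written, move)),
  of which the first applicable one is used (\<open>map_of\<close>); a machine halts when no rule applies.
  State 0 is initial and symbol 0 is the blank. The letter \<open>a\<close> of an input or output
  string is represented on the tape by the symbol \<open>Suc a\<close>.
\<close>

datatype move = MoveL | MoveR

type_synonym tm = "((nat \<times> nat) \<times> (nat \<times> nat \<times> move)) list"

type_synonym config = "nat \<times> (int \<Rightarrow> nat) \<times> int"

fun shift :: "move \<Rightarrow> int \<Rightarrow> int" where
  "shift MoveL h = h - 1"
| "shift MoveR h = h + 1"

fun tm_step :: "tm \<Rightarrow> config \<Rightarrow> config option" where
  "tm_step M (q, t, h) =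
     (case map_of M (q, t h) of
        None \<Rightarrow> None
      | Some (q', b, d) \<Rightarrow> Some (q', t(h := b), shift d h))"

definition tm_init :: "bool list \<Rightarrow> config" where
  "tm_init p =
     (0, \<lambda>i. if 0 \<le> i \<and> i < int (length p) then Suc (of_bool (p ! nat i)) else 0, 0)"

text \<open>
  The output over the alphabet \<open>{0..<k}\<close> is the longest string of such letters
  that starts at the head position. (Only finitely many cells are ever non-blank,
  so \<open>LEAST\<close> is applied to a nonempty set.) Bounding the letters by a fixed \<open>k\<close> is essential:
  a single universal machine has a finite table, so it could not reproduce the output of
  machines with arbitrarily large output alphabets.
\<close>

fun tm_output :: "nat \<Rightarrow> config \<Rightarrow> nat list" where
  "tm_output k (q, t, h) =
     map (\<lambda>i. t (h + int i) - 1) [0..<(LEAST n. t (h + int n) \<notin> {1..k})]"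

text \<open>The graph of the partial function from binary strings to strings over \<open>{0..<k}\<close>
  computed by \<open>M\<close>.\<close>

definition tm_computes :: "nat \<Rightarrow> tm \<Rightarrow> bool list \<Rightarrow> nat list \<Rightarrow> bool" where
  "tm_computes k M p s \<longleftrightarrow>
     (\<exists>c. (\<lambda>c c'. tm_step M c = Some c')\<^sup>*\<^sup>* (tm_init p) c
        \<and> tm_step M c = None \<and> tm_output k c = s)"

text \<open>
  Computability of a total sequence \<open>f\<close> of objects that are coded by strings over \<open>{0,1}\<close>.
  The codes below are unary; this is immaterial, since no complexity bounds are involved.
\<close>

definition computable_seq :: "('a \<Rightarrow> nat list) \<Rightarrow> (nat \<Rightarrow> 'a) \<Rightarrow> bool" where
  "computable_seq code f \<longleftrightarrow>
     (\<exists>M. \<forall>n. tm_computes 2 M (replicate n True) (code (f n)))"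

definition nat_code :: "nat \<Rightarrow> nat list" where
  "nat_code n = replicate n 1 @ [0]"

definition rat_code :: "rat \<Rightarrow> nat list" where
  "rat_code r = (case quotient_of r of (a, b) \<Rightarrow>
     (if a < 0 then 1 else 0) # nat_code (nat \<bar>a\<bar>) @ nat_code (nat b))"

definition tm_code :: "tm \<Rightarrow> nat list" where
  "tm_code M = concat (map (\<lambda>((q, a), (q', b, d)).
     nat_code q @ nat_code a @ nat_code q' @ nat_code b @ [case d of MoveL \<Rightarrow> 0 | MoveR \<Rightarrow> 1]) M)"

text \<open>The enumeration is \<open>M 1, M 2, \<dots>\<close>; the value \<open>M 0\<close> is not used.\<close>

definition computable_tm_enumeration :: "(nat \<Rightarrow> tm) \<Rightarrow> bool" where
  "computable_tm_enumeration M \<longleftrightarrow>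
     M ` {1..} = UNIV \<and> computable_seq tm_code (\<lambda>n. M (Suc n))"

text \<open>The strings 0, 1, 00, 01, 10, \<open>\<dots>\<close> are \<open>bin_string 1, bin_string 2, \<dots>\<close>:
  \<open>bin_string n\<close> is the binary expansion of \<open>n + 1\<close> without its leading 1.\<close>

fun bin_string :: "nat \<Rightarrow> bool list" where
  "bin_string 0 = []"
| "bin_string (Suc m) = bin_string (m div 2) @ [odd m]"

definition hat :: "bool list \<Rightarrow> bool list" where
  "hat q = concat (map (\<lambda>b. [b, b]) q) @ [False, True]"

definition universal_tm :: "nat \<Rightarrow> (nat \<Rightarrow> tm) \<Rightarrow> tm \<Rightarrow> bool" where
  "universal_tm k M U \<longleftrightarrow>
     (\<forall>n\<ge>1. \<forall>p s. tm_computes k U (hat (bin_string n) @ p) s \<longleftrightarrow> tm_computes k (M n) p s)"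

definition AIC :: "nat \<Rightarrow> tm \<Rightarrow> nat list \<Rightarrow> enat" where
  "AIC k U s = Inf {enat (length p) | p. tm_computes k U p s}"

definition itinerary :: "(real \<Rightarrow> real) \<Rightarrow> real set list \<Rightarrow> real \<Rightarrow> nat \<Rightarrow> nat list" where
  "itinerary T \<alpha> x n =
     map (\<lambda>j. THE i. i < length \<alpha> \<and> (T ^^ j) x \<in> \<alpha> ! i) [0..<n]"

definition orbit_AIC ::
  "nat \<Rightarrow> tm \<Rightarrow> (real \<Rightarrow> real) \<Rightarrow> real set list \<Rightarrow> real \<Rightarrow> nat \<Rightarrow> enat" where
  "orbit_AIC k U T \<alpha> x n = AIC k U (itinerary T \<alpha> x n)"

definition constructive :: "real \<Rightarrow> bool" where
  "constructive z \<longleftrightarrow>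
     (\<exists>A :: nat \<Rightarrow> rat. computable_seq rat_code A \<and> (\<forall>n. \<bar>of_rat (A n) - z\<bar> < 1 / 2 ^ n))"

definition piecewise_isometry :: "(real \<Rightarrow> real) \<Rightarrow> bool" where
  "piecewise_isometry T \<longleftrightarrow>
     T \<in> {0..1} \<rightarrow> {0..1} \<and>
     (\<exists>P. finite P \<and> partition_on {0..1} P \<and>
        (\<forall>I\<in>P. is_interval I \<and>
           (\<exists>c. (\<forall>x\<in>I. T x = x + c) \<or> (\<forall>x\<in>I. T x = - x + c))))"

definition preserves_lebesgue :: "(real \<Rightarrow> real) \<Rightarrow> bool" where
  "preserves_lebesgue T \<longleftrightarrow>
     T \<in> measurable (lebesgue_on {0..1}) (lebesgue_on {0..1}) \<and>
     (\<forall>B\<in>sets (lebesgue_on {0..1}).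
        emeasure (lebesgue_on {0..1}) (T -` B \<inter> {0..1}) = emeasure (lebesgue_on {0..1}) B)"

definition constructive_piecewise_isometry :: "(real \<Rightarrow> real) \<Rightarrow> bool" where
  "constructive_piecewise_isometry T \<longleftrightarrow>
     piecewise_isometry T \<and> preserves_lebesgue T \<and>
     (\<forall>y\<in>{0..1}. \<not> continuous (at y within {0..1}) T \<longrightarrow> constructive y \<and> constructive (T y))"

definition constructive_interval :: "real set \<Rightarrow> bool" where
  "constructive_interval J \<longleftrightarrow>
     (\<exists>a b. constructive a \<and> constructive b \<and>
        (J = {a..b} \<or> J = {a<..b} \<or> J = {a..<b} \<or> J = {a<..<b}))"

definition constructive_partition :: "real set list \<Rightarrow> bool" where
  "constructive_partition \<alpha> \<longleftrightarrow>
     distinct \<alpha> \<and> partition_on {0..1} (set \<alpha>) \<and>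
     (\<forall>S\<in>set \<alpha>. \<exists>F. finite F \<and> S = \<Union>F \<and> (\<forall>J\<in>F. constructive_interval J))"

end

theory Submission
  imports Defs "HOL-Real_Asymp.Real_Asymp"
begin

text \<open>
  The translation constants of \<open>T\<close> are integer combinations of the break points, because the images
  of the pieces tile \<open>[0,1]\<close>; so all data of the problem can be computed to any precision.
  By Borel--Cantelli, for almost every \<open>x\<close> and every large \<open>l\<close> the first \<open>2 ^ l\<close> points of the orbit
  stay further than \<open>1 / (2 ^ l * (l + 1)\<^sup>2)\<close> from the break points. Since \<open>T\<close> is a piecewise
  isometry, errors do not grow along the orbit: an approximation of \<open>x\<close> to half that distance has
  the same itinerary, and the itinerary can be found by integer arithmetic without deciding equality
  of constructive numbers. Thus \<open>n\<close> and about \<open>log n + 2 log (log n)\<close> bits of \<open>x\<close> suffice.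
  That this computation is performed by a Turing machine is shown by compiling a small register
  language, in which the Turing machines for the constructive numbers are simulated.
\<close>

section \<open>Total functions computed by register programs\<close>

text \<open>The bound 2 is a sum of two equal costs: about \<open>log n\<close> bits name the length
  \<open>n\<close>, which a decoder must know in order to stop, and about as many locate
  \<open>x\<close>. The factor \<open>(l + 1)\<^sup>2\<close> in the clearance makes the measures of
  the exceptional sets summable over the levels \<open>l\<close>; its logarithm is negligible
  against \<open>log n\<close>. Dyadic levels give one clearance to a whole block of times, and
  rounding \<open>n\<close> up to a power of 2 costs a bounded number of bits. Two obstacles shape
  the geometric half. The hypotheses control the discontinuities only, so the given pieces of
  \<open>T\<close> may also meet at arbitrary points where \<open>T\<close> is continuous; measure
  preservation shows that such a point is no break at all. Nor does the value of \<open>T\<close> at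
  a break point determine the adjacent branches, which is why lengths of images are used. In the
  computational half every simulated step adds a rounding error that is bounded in units of the
  working precision. The precision is therefore tied to \<open>n\<close>, so that even
  \<open>n\<close> such errors stay well below the clearance; it is computed from \<open>n\<close>
  and takes no bits.\<close>

datatype com =
    Inc nat | Dec nat | Put nat nat | IfEq nat nat com | Seq com com | While nat com

text \<open>The store consists of registers and a word. \<open>Put\<close> and \<open>IfEq\<close>
  use a register as an address into the word and mention only constant letters, so a tape over a
  finite alphabet with one movable pebble per register can carry the whole store.\<close>

inductive exec :: "com \<Rightarrow> (nat \<Rightarrow> nat) \<times> (nat \<Rightarrow> nat) \<Rightarrow> (nat \<Rightarrow> nat) \<times> (nat \<Rightarrow> nat) \<Rightarrow> bool" where
  Inc: "exec (Inc r) (s, w) (s(r := Suc (s r)), w)"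
| Dec: "exec (Dec r) (s, w) (s(r := s r - 1), w)"
| Put: "exec (Put r a) (s, w) (s, w(s r := a))"
| IfT: "w (s r) = a \<Longrightarrow> exec c (s, w) st \<Longrightarrow> exec (IfEq r a c) (s, w) st"
| IfF: "w (s r) \<noteq> a \<Longrightarrow> exec (IfEq r a c) (s, w) (s, w)"
| Seq: "exec c st st' \<Longrightarrow> exec c' st' st'' \<Longrightarrow> exec (Seq c c') st st''"
| WhileF: "s r = 0 \<Longrightarrow> exec (While r c) (s, w) (s, w)"
| WhileT: "s r \<noteq> 0 \<Longrightarrow> exec c (s, w) st \<Longrightarrow> exec (While r c) st st' \<Longrightarrow> exec (While r c) (s, w) st'"

lemma exec_Inc: "s' = s(r := Suc (s r)) \<Longrightarrow> exec (Inc r) (s, w) (s', w)"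
  by (simp add: exec.Inc)

lemma exec_Dec: "s' = s(r := s r - 1) \<Longrightarrow> exec (Dec r) (s, w) (s', w)"
  by (simp only: exec.Dec)

definition zero :: "nat \<Rightarrow> com" where
  "zero r = While r (Dec r)"

lemma exec_zero: "exec (zero r) (s, w) (s(r := 0), w)"
proof (induction "s r" arbitrary: s)
  case 0
  then have "s(r := 0) = s" by auto
  with 0 show ?case unfolding zero_def by (simp add: exec.WhileF)
next
  case (Suc n)
  let ?s = "s(r := s r - 1)"
  have "exec (zero r) (?s, w) (?s(r := 0), w)"
    using Suc.hyps(1)[of ?s] Suc.hyps(2) by simp
  then show ?case
    unfolding zero_def using Suc.hyps(2) by (auto intro: exec.WhileT exec.Dec)
qed

text \<open>A register can be read only by counting it down; \<open>t\<close> collects a second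
  copy, from which \<open>a\<close> is restored.\<close>

definition copy :: "nat \<Rightarrow> nat \<Rightarrow> nat \<Rightarrow> com" where
  "copy a b t = Seq (Seq (zero b) (zero t))
     (Seq (While a (Seq (Dec a) (Seq (Inc b) (Inc t)))) (While t (Seq (Dec t) (Inc a))))"

lemma exec_copy:
  assumes "a \<noteq> b" "a \<noteq> t" "b \<noteq> t"
  shows "exec (copy a b t) (s, w) (s(b := s a, t := 0), w)"
proof -
  have 1: "exec (While a (Seq (Dec a) (Seq (Inc b) (Inc t)))) (s, w)
      (s(a := 0, b := s b + s a, t := s t + s a), w)" for s
  proof (induction "s a" arbitrary: s)
    case 0
    then have "s(a := 0, b := s b + s a, t := s t + s a) = s" by auto
    with 0 show ?case by (metis exec.WhileF)
  next
    case (Suc n)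
    let ?s = "s(a := s a - 1, b := Suc (s b), t := Suc (s t))"
    have 1: "exec (Seq (Dec a) (Seq (Inc b) (Inc t))) (s, w) (?s, w)"
      using assms by (auto intro!: exec.Seq exec_Inc exec_Dec)
    have "?s(a := 0, b := ?s b + ?s a, t := ?s t + ?s a) = s(a := 0, b := s b + s a, t := s t + s a)"
      using assms Suc.hyps(2) by (auto simp: fun_eq_iff)
    moreover have "n = ?s a"
      using assms Suc.hyps(2) by simp
    ultimately show ?case
      using Suc.hyps(1)[of ?s] Suc.hyps(2) by (metis exec.WhileT[OF _ 1] nat.distinct(1))
  qed
  have 2: "exec (While t (Seq (Dec t) (Inc a))) (s, w) (s(t := 0, a := s a + s t), w)" for s
  proof (induction "s t" arbitrary: s)
    case 0
    then have "s(t := 0, a := s a + s t) = s" by auto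
    with 0 show ?case by (metis exec.WhileF)
  next
    case (Suc n)
    let ?s = "s(t := s t - 1, a := Suc (s a))"
    have 1: "exec (Seq (Dec t) (Inc a)) (s, w) (?s, w)"
      using assms by (auto intro!: exec.Seq exec_Inc exec_Dec)
    have "?s(t := 0, a := ?s a + ?s t) = s(t := 0, a := s a + s t)"
      using assms Suc.hyps(2) by (auto simp: fun_eq_iff)
    moreover have "n = ?s t"
      using assms Suc.hyps(2) by simp
    ultimately show ?case
      using Suc.hyps(1)[of ?s] Suc.hyps(2) by (metis exec.WhileT[OF _ 1] nat.distinct(1))
  qed
  let ?s1 = "s(b := 0, t := 0)"
  let ?s2 = "?s1(a := 0, b := ?s1 b + ?s1 a, t := ?s1 t + ?s1 a)"
  have "?s2(t := 0, a := ?s2 a + ?s2 t) = s(b := s a, t := 0)"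
    using assms by (auto simp: fun_eq_iff)
  moreover have "exec (Seq (zero b) (zero t)) (s, w) (?s1, w)"
    by (blast intro: exec.Seq exec_zero)
  ultimately show ?thesis
    unfolding copy_def using exec.Seq[OF _ exec.Seq[OF 1[of ?s1] 2[of ?s2]]] by (simp only:)
qed

text \<open>The arguments are read from the registers \<open>as\<close>; the result goes to register \<open>d\<close>,
  which lies above them, and all registers above \<open>d\<close> serve as scratch space.\<close>

definition rec :: "nat \<Rightarrow> (nat list \<Rightarrow> nat) \<Rightarrow> bool" where
  "rec l f \<longleftrightarrow> (\<forall>as d. length as = l \<longrightarrow> (\<forall>a\<in>set as. a < d) \<longrightarrow>
     (\<exists>c. \<forall>s w. \<exists>s'. exec c (s, w) (s', w) \<and> s' d = f (map s as) \<and> (\<forall>i<d. s' i = s i)))"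

lemma recD:
  assumes "rec l f" "length as = l" "\<forall>a\<in>set as. a < d"
  obtains c where "\<And>s w. \<exists>s'. exec c (s, w) (s', w) \<and> s' d = f (map s as) \<and> (\<forall>i<d. s' i = s i)"
  using assms(1)[unfolded rec_def, rule_format, of as d] assms(2,3) by blast

lemma rec_cong:
  assumes "rec l g" "\<And>e. length e = l \<Longrightarrow> f e = g e"
  shows "rec l f"
  unfolding rec_def
proof (intro allI impI)
  fix as :: "nat list" and d assume as: "length as = l" "\<forall>a\<in>set as. a < d"
  obtain c where "\<And>s w. \<exists>s'. exec c (s, w) (s', w) \<and> s' d = g (map s as) \<and> (\<forall>i<d. s' i = s i)"
    using recD[OF assms(1) as] by blast
  then show "\<exists>c. \<forall>s w. \<exists>s'. exec c (s, w) (s', w) \<and> s' d = f (map s as) \<and> (\<forall>i<d. s' i = s i)"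
    using as assms(2) by (intro exI[of _ c]) simp
qed

lemma map_agree_below:
  "\<forall>a\<in>set as. a < d \<Longrightarrow> \<forall>i<d. s' i = s i \<Longrightarrow> map s' as = map s as"
  by simp

lemma rec_var:
  assumes "i < l"
  shows "rec l (\<lambda>e. e ! i)"
  unfolding rec_def
proof (intro allI impI)
  fix as :: "nat list" and d assume as: "length as = l" "\<forall>a\<in>set as. a < d"
  have "as ! i < d" using as assms by auto
  then have "exec (copy (as ! i) d (Suc d)) (s, w) (s(d := s (as ! i), Suc d := 0), w)" for s w
    by (intro exec_copy) auto
  then show "\<exists>c. \<forall>s w. \<exists>s'. exec c (s, w) (s', w) \<and> s' d = map s as ! i \<and> (\<forall>i<d. s' i = s i)"
    using as assms by (intro exI[of _ "copy (as ! i) d (Suc d)"] allI)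
      (rule_tac x = "s(d := s (as ! i), Suc d := 0)" in exI, auto)
qed

text \<open>The values are stacked in \<open>d\<close>, \<open>d + 1\<close>, and so on: each
  program destroys only registers from its own target upwards, so earlier results survive. The
  language has no empty program, hence the separate disjunct for the empty list.\<close>

lemma rec_args:
  assumes "\<forall>g\<in>set gs. rec l g" "length as = l" "\<forall>a\<in>set as. a < d"
  shows "gs = [] \<or> (\<exists>c. \<forall>s w. \<exists>s'. exec c (s, w) (s', w) \<and>
     map s' [d..<d + length gs] = map (\<lambda>g. g (map s as)) gs \<and> (\<forall>i<d. s' i = s i))"
  using assms(1)
proof (induction gs rule: rev_induct)
  case Nil
  then show ?case by simp
next
  case (snoc g gs)
  let ?d = "d + length gs"
  have as: "\<forall>a\<in>set as. a < ?d" using assms(3) by fastforce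
  obtain c' where c': "\<And>s w. \<exists>s'. exec c' (s, w) (s', w) \<and> s' ?d = g (map s as) \<and> (\<forall>i<?d. s' i = s i)"
    using recD[OF _ assms(2) as, of g] snoc.prems by auto
  show ?case
  proof (cases "gs = []")
    case True
    then show ?thesis using c' by auto
  next
    case False
    then obtain c where c: "\<And>s w. \<exists>s'. exec c (s, w) (s', w) \<and>
       map s' [d..<d + length gs] = map (\<lambda>g. g (map s as)) gs \<and> (\<forall>i<d. s' i = s i)"
      using snoc by auto
    have "\<exists>s'. exec (Seq c c') (s, w) (s', w) \<and>
       map s' [d..<d + length (gs @ [g])] = map (\<lambda>g. g (map s as)) (gs @ [g]) \<and> (\<forall>i<d. s' i = s i)" for s w
    proof -
      obtain s1 where s1: "exec c (s, w) (s1, w)"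
        "map s1 [d..<d + length gs] = map (\<lambda>g. g (map s as)) gs" "\<forall>i<d. s1 i = s i"
        using c by blast
      obtain s2 where s2: "exec c' (s1, w) (s2, w)" "s2 ?d = g (map s1 as)" "\<forall>i<?d. s2 i = s1 i"
        using c' by blast
      have "map s2 [d..<d + length gs] = map s1 [d..<d + length gs]"
        using s2(3) by simp
      moreover have "map s1 as = map s as"
        using s1(3) assms(3) by simp
      ultimately show ?thesis
        using s1 s2 by (intro exI[of _ s2]) (auto intro: exec.Seq simp del: map_eq_conv)
    qed
    then show ?thesis by blast
  qed
qed

lemma rec_comp:
  assumes "rec m f" "\<forall>g\<in>set gs. rec l g" "length gs = m" "m > 0"
  shows "rec l (\<lambda>e. f (map (\<lambda>g. g e) gs))"
  unfolding rec_def
proof (intro allI impI)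
  fix as :: "nat list" and d assume as: "length as = l" "\<forall>a\<in>set as. a < d"
  obtain c where c: "\<And>s w. \<exists>s'. exec c (s, w) (s', w) \<and>
     map s' [d..<d + m] = map (\<lambda>g. g (map s as)) gs \<and> (\<forall>i<d. s' i = s i)"
    using rec_args[OF assms(2) as] assms(3,4) by auto
  obtain c' where c': "\<And>s w. \<exists>s'. exec c' (s, w) (s', w) \<and> s' (d + m) = f (map s [d..<d + m])
      \<and> (\<forall>i<d + m. s' i = s i)"
    using recD[OF assms(1), of "[d..<d + m]" "d + m"] by auto
  let ?c = "Seq c (Seq c' (copy (d + m) d (Suc (d + m))))"
  have "\<exists>s'. exec ?c (s, w) (s', w) \<and> s' d = f (map (\<lambda>g. g (map s as)) gs) \<and> (\<forall>i<d. s' i = s i)" for s w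
  proof -
    obtain s1 where s1: "exec c (s, w) (s1, w)"
      "map s1 [d..<d + m] = map (\<lambda>g. g (map s as)) gs" "\<forall>i<d. s1 i = s i"
      using c by blast
    obtain s2 where s2: "exec c' (s1, w) (s2, w)" "s2 (d + m) = f (map s1 [d..<d + m])" "\<forall>i<d + m. s2 i = s1 i"
      using c' by blast
    have "exec (copy (d + m) d (Suc (d + m))) (s2, w) (s2(d := s2 (d + m), Suc (d + m) := 0), w)"
      using assms(4) by (intro exec_copy) auto
    with s1 s2 show ?thesis
      by (intro exI[of _ "s2(d := s2 (d + m), Suc (d + m) := 0)"]) (auto intro: exec.Seq)
  qed
  then show "\<exists>c. \<forall>s w. \<exists>s'. exec c (s, w) (s', w) \<and> s' d = f (map (\<lambda>g. g (map s as)) gs) \<and> (\<forall>i<d. s' i = s i)"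
    by blast
qed

lemma rec_const: "rec l (\<lambda>e. n)"
  unfolding rec_def
proof (intro allI impI)
  fix as :: "nat list" and d
  show "\<exists>c. \<forall>s w. \<exists>s'. exec c (s, w) (s', w) \<and> s' d = n \<and> (\<forall>i<d. s' i = s i)"
  proof (induction n)
    case 0
    show ?case using exec_zero[of d]
      by (intro exI[of _ "zero d"] allI) fastforce
  next
    case (Suc n)
    then obtain c where c: "\<And>s w. \<exists>s'. exec c (s, w) (s', w) \<and> s' d = n \<and> (\<forall>i<d. s' i = s i)"
      by blast
    show ?case
    proof (intro exI[of _ "Seq c (Inc d)"] allI)
      fix s w
      obtain s' where "exec c (s, w) (s', w)" "s' d = n" "\<forall>i<d. s' i = s i" using c by blast
      then show "\<exists>s'. exec (Seq c (Inc d)) (s, w) (s', w) \<and> s' d = Suc n \<and> (\<forall>i<d. s' i = s i)"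
        by (intro exI[of _ "s'(d := Suc n)"]) (auto intro!: exec.Seq exec_Inc)
    qed
  qed
qed

lemma rec_step:
  assumes c: "\<And>s w. \<exists>s'. exec c (s, w) (s', w) \<and> s' d = g (map s as) \<and> (\<forall>i<d. s' i = s i)"
    and "\<And>s w. exec c' (s, w) (s(d := h (s d)), w)"
  shows "\<exists>c. \<forall>s w. \<exists>s'. exec c (s, w) (s', w) \<and> s' d = h (g (map s as)) \<and> (\<forall>i<d. s' i = s i)"
proof (intro exI[of _ "Seq c c'"] allI)
  fix s w
  obtain s' where "exec c (s, w) (s', w)" "s' d = g (map s as)" "\<forall>i<d. s' i = s i" using c by blast
  then show "\<exists>s'. exec (Seq c c') (s, w) (s', w) \<and> s' d = h (g (map s as)) \<and> (\<forall>i<d. s' i = s i)"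
    using assms(2)[of s' w] by (intro exI[of _ "s'(d := h (s' d))"]) (auto intro!: exec.Seq)
qed

lemma rec_Suc:
  assumes "rec l g"
  shows "rec l (\<lambda>e. Suc (g e))"
  unfolding rec_def
proof (intro allI impI)
  fix as :: "nat list" and d assume as: "length as = l" "\<forall>a\<in>set as. a < d"
  obtain c where "\<And>s w. \<exists>s'. exec c (s, w) (s', w) \<and> s' d = g (map s as) \<and> (\<forall>i<d. s' i = s i)"
    using recD[OF assms as] by blast
  then show "\<exists>c. \<forall>s w. \<exists>s'. exec c (s, w) (s', w) \<and> s' d = Suc (g (map s as)) \<and> (\<forall>i<d. s' i = s i)"
    by (rule rec_step[where c' = "Inc d"]) (rule exec.Inc)
qed

lemma rec_pred:
  assumes "rec l g"
  shows "rec l (\<lambda>e. g e - 1)"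
  unfolding rec_def
proof (intro allI impI)
  fix as :: "nat list" and d assume as: "length as = l" "\<forall>a\<in>set as. a < d"
  obtain c where "\<And>s w. \<exists>s'. exec c (s, w) (s', w) \<and> s' d = g (map s as) \<and> (\<forall>i<d. s' i = s i)"
    using recD[OF assms as] by blast
  then show "\<exists>c. \<forall>s w. \<exists>s'. exec c (s, w) (s', w) \<and> s' d = g (map s as) - 1 \<and> (\<forall>i<d. s' i = s i)"
    by (rule rec_step[where c' = "Dec d" and h = "\<lambda>x. x - 1"]) (rule exec.Dec)
qed

text \<open>A counted loop: \<open>d\<close> holds the running value, \<open>d + 1\<close> the
  number of remaining rounds, and \<open>d + 2\<close> receives the next value before it is copied
  down.\<close>

lemma rec_iter_list:
  assumes "rec (Suc l) F" "rec l n" "rec l y"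
  shows "rec l (\<lambda>e. ((\<lambda>x. F (x # e)) ^^ n e) (y e))"
  unfolding rec_def
proof (intro allI impI)
  fix as :: "nat list" and d assume as: "length as = l" "\<forall>a\<in>set as. a < d"
  obtain c where c: "\<And>s w. \<exists>s'. exec c (s, w) (s', w) \<and>
     map s' [d..<d + 2] = map (\<lambda>g. g (map s as)) [y, n] \<and> (\<forall>i<d. s' i = s i)"
    using rec_args[OF _ as, of "[y, n]"] assms(2,3) by auto
  have "\<forall>a\<in>set (d # as). a < d + 2" using as by fastforce
  then obtain cF where cF: "\<And>s w. \<exists>s'. exec cF (s, w) (s', w) \<and> s' (d + 2) = F (map s (d # as))
      \<and> (\<forall>i<d + 2. s' i = s i)"
    using recD[OF assms(1), of "d # as" "d + 2"] as(1) by auto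
  let ?body = "Seq cF (Seq (copy (d + 2) d (d + 3)) (Dec (d + 1)))"
  have body: "\<exists>s'. exec ?body (s, w) (s', w) \<and> s' d = F (s d # map s as) \<and> s' (d + 1) = s (d + 1) - 1
     \<and> (\<forall>i<d. s' i = s i)" for s w
  proof -
    obtain s1 where s1: "exec cF (s, w) (s1, w)" "s1 (d + 2) = F (map s (d # as))" "\<forall>i<d + 2. s1 i = s i"
      using cF by blast
    have "exec (copy (d + 2) d (d + 3)) (s1, w) (s1(d := s1 (d + 2), d + 3 := 0), w)"
      by (intro exec_copy) auto
    with s1 show ?thesis
      by (intro exI[of _ "s1(d := s1 (d + 2), d + 3 := 0, d + 1 := s1 (d + 1) - 1)"])
        (auto intro!: exec.Seq exec_Dec)
  qed
  have loop: "\<exists>s'. exec (While (d + 1) ?body) (s, w) (s', w) \<and>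
     s' d = ((\<lambda>x. F (x # map s as)) ^^ s (d + 1)) (s d) \<and> (\<forall>i<d. s' i = s i)" for s w
  proof (induction "s (d + 1)" arbitrary: s)
    case 0
    then show ?case by (intro exI[of _ s]) (auto intro: exec.WhileF)
  next
    case (Suc m)
    obtain s1 where s1: "exec ?body (s, w) (s1, w)" "s1 d = F (s d # map s as)" "s1 (d + 1) = s (d + 1) - 1"
      "\<forall>i<d. s1 i = s i"
      using body by blast
    have "m = s1 (d + 1)" using Suc.hyps(2) s1(3) by simp
    from Suc.hyps(1)[of s1, OF this] obtain s' where s': "exec (While (d + 1) ?body) (s1, w) (s', w)"
      "s' d = ((\<lambda>x. F (x # map s1 as)) ^^ m) (s1 d)" "\<forall>i<d. s' i = s1 i"
      using \<open>m = s1 (d + 1)\<close> by blast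
    have "map s1 as = map s as" using map_agree_below[OF as(2) s1(4)] .
    with s' s1 have "s' d = ((\<lambda>x. F (x # map s as)) ^^ Suc m) (s d)"
      unfolding funpow_Suc_right by simp
    moreover have "exec (While (d + 1) ?body) (s, w) (s', w)"
      using Suc.hyps(2) s1(1) s'(1) by (intro exec.WhileT) auto
    ultimately show ?case
      using Suc.hyps(2) s'(3) s1(4) by (intro exI[of _ s']) auto
  qed
  have "\<exists>s'. exec (Seq c (While (d + 1) ?body)) (s, w) (s', w) \<and>
     s' d = ((\<lambda>x. F (x # map s as)) ^^ n (map s as)) (y (map s as)) \<and> (\<forall>i<d. s' i = s i)" for s w
  proof -
    obtain s1 where s1: "exec c (s, w) (s1, w)"
      "map s1 [d..<d + 2] = map (\<lambda>g. g (map s as)) [y, n]" "\<forall>i<d. s1 i = s i"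
      using c by blast
    obtain s' where s': "exec (While (d + 1) ?body) (s1, w) (s', w)"
     "s' d = ((\<lambda>x. F (x # map s1 as)) ^^ s1 (d + 1)) (s1 d)" "\<forall>i<d. s' i = s1 i"
      using loop by blast
    have "s1 d = y (map s as)" "s1 (d + 1) = n (map s as)"
      using s1(2) by (simp_all add: numeral_2_eq_2 upt_rec)
    with s1 s' map_agree_below[OF as(2) s1(3)] show ?thesis
      by (intro exI[of _ s']) (auto intro: exec.Seq)
  qed
  then show "\<exists>c. \<forall>s w. \<exists>s'. exec c (s, w) (s', w) \<and>
     s' d = ((\<lambda>x. F (x # map s as)) ^^ n (map s as)) (y (map s as)) \<and> (\<forall>i<d. s' i = s i)"
    by blast
qed

text \<open>Unbounded search, which terminates because a zero is assumed to exist. The invariant is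
  that \<open>d + 1\<close> holds the value of \<open>Q\<close> at the candidate in \<open>d\<close>
  and that the candidate has not passed the least zero.\<close>

lemma rec_least_list:
  assumes "rec (Suc l) Q" "\<And>e. length e = l \<Longrightarrow> \<exists>v. Q (v # e) = 0"
  shows "rec l (\<lambda>e. LEAST v. Q (v # e) = 0)"
  unfolding rec_def
proof (intro allI impI)
  fix as :: "nat list" and d assume as: "length as = l" "\<forall>a\<in>set as. a < d"
  have "\<forall>a\<in>set (d # as). a < d + 1" using as by fastforce
  then obtain c where c: "\<And>s w. \<exists>s'. exec c (s, w) (s', w) \<and> s' (d + 1) = Q (map s (d # as))
      \<and> (\<forall>i<d + 1. s' i = s i)"
    using recD[OF assms(1), of "d # as" "d + 1"] as(1) by auto
  let ?L = "\<lambda>e. LEAST v. Q (v # e) = 0"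
  have loop: "\<exists>s'. exec (While (d + 1) (Seq (Inc d) c)) (s, w) (s', w) \<and> s' d = ?L (map s as) \<and> (\<forall>i<d. s' i = s i)"
    if "s (d + 1) = Q (s d # map s as)" "s d \<le> ?L (map s as)" for s w
    using that
  proof (induction "?L (map s as) - s d" arbitrary: s rule: less_induct)
    case less
    have Q0: "Q (?L (map s as) # map s as) = 0"
      using assms(2)[of "map s as"] as(1) by (auto intro: LeastI_ex)
    show ?case
    proof (cases "s (d + 1) = 0")
      case True
      then have "s d = ?L (map s as)"
        using less.prems Least_le[of "\<lambda>v. Q (v # map s as) = 0" "s d"] by simp
      with True show ?thesis by (intro exI[of _ s]) (auto intro: exec.WhileF)
    next
      case False
      then have lt: "s d < ?L (map s as)"
        using less.prems Q0 by (metis le_neq_implies_less)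
      obtain s1 where s1: "exec c (s(d := Suc (s d)), w) (s1, w)"
        "s1 (d + 1) = Q (map (s(d := Suc (s d))) (d # as))" "\<forall>i<d + 1. s1 i = (s(d := Suc (s d))) i"
        using c by blast
      have below: "\<forall>i<d. s1 i = s i" using s1(3) by simp
      note m = map_agree_below[OF as(2) below]
      have m': "map (s(d := Suc (s d))) as = map s as"
        using as(2) by (auto simp: map_eq_conv)
      have "s1 d = Suc (s d)" using s1(3) by simp
      with lt m have "?L (map s1 as) - s1 d < ?L (map s as) - s d"
        by (simp del: map_eq_conv)
      moreover have "s1 (d + 1) = Q (s1 d # map s1 as)"
        using s1 m m' \<open>s1 d = Suc (s d)\<close> by (simp del: map_eq_conv)
      moreover have "s1 d \<le> ?L (map s1 as)"
        using lt \<open>s1 d = Suc (s d)\<close> m by (simp del: map_eq_conv)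
      ultimately obtain s' where s': "exec (While (d + 1) (Seq (Inc d) c)) (s1, w) (s', w)"
        "s' d = ?L (map s1 as)" "\<forall>i<d. s' i = s1 i"
        using less.hyps[of s1] by blast
      have "exec (While (d + 1) (Seq (Inc d) c)) (s, w) (s', w)"
        using False s1(1) s'(1) by (intro exec.WhileT[OF _ exec.Seq[OF exec_Inc[OF refl]]]) auto
      with s' m below show ?thesis by (intro exI[of _ s']) auto
    qed
  qed
  have "\<exists>s'. exec (Seq (zero d) (Seq c (While (d + 1) (Seq (Inc d) c)))) (s, w) (s', w)
     \<and> s' d = ?L (map s as) \<and> (\<forall>i<d. s' i = s i)" for s w
  proof -
    obtain s1 where s1: "exec c (s(d := 0), w) (s1, w)"
      "s1 (d + 1) = Q (map (s(d := 0)) (d # as))" "\<forall>i<d + 1. s1 i = (s(d := 0)) i"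
      using c by blast
    have below: "\<forall>i<d. s1 i = s i" using s1(3) by simp
    note m = map_agree_below[OF as(2) below]
    have m': "map (s(d := 0)) as = map s as"
      using as(2) by (auto simp: map_eq_conv)
    have "s1 d = 0" using s1(3) by simp
    have "s1 (d + 1) = Q (s1 d # map s1 as)" "s1 d \<le> ?L (map s1 as)"
      using s1 m m' \<open>s1 d = 0\<close> by (simp_all del: map_eq_conv)
    then obtain s' where s': "exec (While (d + 1) (Seq (Inc d) c)) (s1, w) (s', w)"
      "s' d = ?L (map s1 as)" "\<forall>i<d. s' i = s1 i"
      using loop by blast
    with s1 m below show ?thesis
      by (intro exI[of _ s']) (auto intro: exec.Seq exec_zero simp del: map_eq_conv)
  qed
  then show "\<exists>c. \<forall>s w. \<exists>s'. exec c (s, w) (s', w) \<and> s' d = ?L (map s as) \<and> (\<forall>i<d. s' i = s i)"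
    by blast
qed

text \<open>Loops and searches put their own variable in front of the parameters; this lets a
  function of the parameters be used inside them. Composition needs at least one argument, so
  \<open>l = 0\<close> is treated as a constant.\<close>

lemma rec_tl:
  assumes "rec l g"
  shows "rec (Suc l) (\<lambda>e. g (tl e))"
proof (cases "l = 0")
  case True
  have "rec (Suc l) (\<lambda>e. g [])" by (rule rec_const)
  then show ?thesis by (rule rec_cong) (use True in \<open>auto simp: length_Suc_conv\<close>)
next
  case False
  have "rec (Suc l) (\<lambda>e. g (map (\<lambda>g. g e) (map (\<lambda>i e. e ! i) [1..<Suc l])))"
    using False by (intro rec_comp[OF assms]) (auto intro: rec_var)
  then show ?thesis
  proof (rule rec_cong)
    fix e :: "nat list" assume e: "length e = Suc l"
    have "tl e = map (\<lambda>g. g e) (map (\<lambda>i e. e ! i) [1..<Suc l])"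
      using e by (intro nth_equalityI) (auto simp: nth_tl simp del: upt_Suc)
    then show "g (tl e) = g (map (\<lambda>g. g e) (map (\<lambda>i e. e ! i) [1..<Suc l]))" by simp
  qed
qed

section \<open>Arithmetic, comparisons and search\<close>

lemma rec_hd: "rec (Suc l) hd"
  by (rule rec_cong[OF rec_var[of 0]]) (auto simp: length_Suc_conv)

lemma rec_iter:
  assumes "rec (Suc l) (\<lambda>e. F (tl e) (hd e))" "rec l n" "rec l y"
  shows "rec l (\<lambda>e. (F e ^^ n e) (y e))"
  using rec_iter_list[OF assms] by simp

lemma rec_comp1:
  assumes "rec 1 (\<lambda>e. f (e ! 0))" "rec l g"
  shows "rec l (\<lambda>e. f (g e))"
  using rec_comp[OF assms(1), of "[g]" l] assms(2) by simp

lemma rec_add: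
  assumes "rec l f" "rec l g"
  shows "rec l (\<lambda>e. f e + g e)"
proof (rule rec_cong)
  show "rec l (\<lambda>e. (Suc ^^ g e) (f e))"
    using assms by (intro rec_iter rec_Suc rec_hd) auto
qed (simp add: add.commute)

lemma rec_diff:
  assumes "rec l f" "rec l g"
  shows "rec l (\<lambda>e. f e - g e)"
proof (rule rec_cong)
  show "rec l (\<lambda>e. ((\<lambda>x. x - 1) ^^ g e) (f e))"
    using assms by (intro rec_iter rec_pred rec_hd) auto
  have "((\<lambda>x. x - 1) ^^ n) m = m - n" for m n :: nat
    by (induction n) auto
  then show "f e - g e = ((\<lambda>x. x - 1) ^^ g e) (f e)" for e by simp
qed

lemma rec_mult:
  assumes "rec l f" "rec l g"
  shows "rec l (\<lambda>e. f e * g e)"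
proof (rule rec_cong)
  show "rec l (\<lambda>e. ((\<lambda>x. x + f e) ^^ g e) 0)"
    by (rule rec_iter[where F = "\<lambda>e x. x + f e" and y = "\<lambda>_. 0"])
      (intro assms rec_add rec_hd rec_const rec_tl[OF assms(1)])+
  have "((\<lambda>x. x + m) ^^ n) 0 = m * n" for m n :: nat
    by (induction n) auto
  then show "f e * g e = ((\<lambda>x. x + f e) ^^ g e) 0" for e by simp
qed

lemma rec_power:
  assumes "rec l f" "rec l g"
  shows "rec l (\<lambda>e. f e ^ g e)"
proof (rule rec_cong)
  show "rec l (\<lambda>e. ((\<lambda>x. x * f e) ^^ g e) 1)"
    by (rule rec_iter[where F = "\<lambda>e x. x * f e" and y = "\<lambda>_. 1"])
      (intro assms rec_mult rec_hd rec_const rec_tl[OF assms(1)])+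
  have "((\<lambda>x. x * m) ^^ n) 1 = m ^ n" for m n :: nat
    by (induction n) auto
  then show "f e ^ g e = ((\<lambda>x. x * f e) ^^ g e) 1" for e by simp
qed

definition recp :: "nat \<Rightarrow> (nat list \<Rightarrow> bool) \<Rightarrow> bool" where
  "recp l P \<longleftrightarrow> rec l (\<lambda>e. of_bool (P e))"

lemma recp_less:
  assumes "rec l f" "rec l g"
  shows "recp l (\<lambda>e. f e < g e)"
  unfolding recp_def
proof (rule rec_cong)
  \<comment> \<open>With truncated subtraction \<open>1 - (1 - m)\<close> is the indicator of
    \<open>m > 0\<close>.\<close>
  show "rec l (\<lambda>e. 1 - (1 - (g e - f e)))"
    by (intro rec_diff rec_const assms)
qed auto

lemma recp_not: "recp l P \<Longrightarrow> recp l (\<lambda>e. \<not> P e)"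
  unfolding recp_def by (rule rec_cong[OF rec_diff[OF rec_const[of _ 1]]]) auto

lemma recp_conj: "recp l P \<Longrightarrow> recp l Q \<Longrightarrow> recp l (\<lambda>e. P e \<and> Q e)"
  unfolding recp_def of_bool_conj by (rule rec_mult)

lemma recp_disj: "recp l P \<Longrightarrow> recp l Q \<Longrightarrow> recp l (\<lambda>e. P e \<or> Q e)"
  using recp_not[OF recp_conj[OF recp_not recp_not], of l P Q] by simp

lemma recp_le: "rec l f \<Longrightarrow> rec l g \<Longrightarrow> recp l (\<lambda>e. f e \<le> g e)"
  using recp_not[OF recp_less, of l g f] by (simp add: not_less)

lemma recp_eq: "rec l f \<Longrightarrow> rec l g \<Longrightarrow> recp l (\<lambda>e. f e = g e)"
  using recp_conj[OF recp_le recp_le, of l f g g f] by (simp add: eq_iff)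

lemma rec_of_bool: "recp l P \<Longrightarrow> rec l (\<lambda>e. of_bool (P e))"
  by (simp add: recp_def)

text \<open>Both branches are total, so both are evaluated and one of them is selected
  arithmetically.\<close>

lemma rec_if:
  assumes "recp l P" "rec l f" "rec l g"
  shows "rec l (\<lambda>e. if P e then f e else g e)"
proof (rule rec_cong)
  show "rec l (\<lambda>e. of_bool (P e) * f e + (1 - of_bool (P e)) * g e)"
    by (intro rec_add rec_mult rec_diff rec_const rec_of_bool assms)
qed auto

lemma rec_Least:
  assumes "recp (Suc l) (\<lambda>e. P (tl e) (hd e))" "\<And>e. length e = l \<Longrightarrow> \<exists>v. P e v"
  shows "rec l (\<lambda>e. LEAST v. P e v)"
proof -
  have "rec (Suc l) (\<lambda>e. of_bool (\<not> P (tl e) (hd e)))"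
    using recp_not[OF assms(1)] by (simp add: recp_def)
  from rec_least_list[OF this] assms(2) show ?thesis by simp
qed

lemma rec_div:
  assumes "rec l f" "rec l g"
  shows "rec l (\<lambda>e. f e div g e)"
proof (rule rec_cong)
  \<comment> \<open>The first disjunct keeps the search total and returns 0 for a zero divisor,
    which is the value of \<open>div\<close> there.\<close>
  show "rec l (\<lambda>e. LEAST v. g e = 0 \<or> f e < Suc v * g e)"
  proof (rule rec_Least)
    show "recp (Suc l) (\<lambda>e. g (tl e) = 0 \<or> f (tl e) < Suc (hd e) * g (tl e))"
      by (intro recp_disj recp_eq recp_less rec_mult rec_Suc rec_hd rec_const rec_tl assms)
    show "\<exists>v. g e = 0 \<or> f e < Suc v * g e" for e
      by (cases "g e") (auto intro!: exI[of _ "f e"] simp: less_Suc_eq_le)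
  qed
  show "f e div g e = (LEAST v. g e = 0 \<or> f e < Suc v * g e)" for e
  proof (cases "g e = 0")
    case False
    show ?thesis
    proof (rule Least_equality[symmetric])
      show "g e = 0 \<or> f e < Suc (f e div g e) * g e"
        using False dividend_less_div_times[of "g e" "f e"] by (simp add: add.commute)
      fix v assume "g e = 0 \<or> f e < Suc v * g e"
      with False show "f e div g e \<le> v"
        by (simp add: less_mult_imp_div_less flip: less_Suc_eq_le)
    qed
  qed (auto intro: Least_equality)
qed

lemma rec_mod:
  assumes "rec l f" "rec l g"
  shows "rec l (\<lambda>e. f e mod g e)"
proof (rule rec_cong)
  show "rec l (\<lambda>e. f e - g e * (f e div g e))"
    by (intro rec_diff rec_mult rec_div assms)
qed (simp add: minus_mult_div_eq_mod)

lemmas rec_intros = rec_if rec_add rec_diff rec_mult rec_power rec_div rec_mod rec_Suc rec_var rec_hd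
  recp_less recp_le recp_eq recp_conj recp_disj recp_not rec_of_bool

section \<open>Simulation of Turing machines\<close>

definition npair :: "nat \<Rightarrow> nat \<Rightarrow> nat" where
  "npair a b = (a + b) ^ 2 + a"

text \<open>The integer square root. Since \<open>npair a b\<close> lies between the squares of
  \<open>a + b\<close> and \<open>a + b + 1\<close>, it recovers \<open>a + b\<close>, and the
  remainder is \<open>a\<close>.\<close>

definition sq :: "nat \<Rightarrow> nat" where
  "sq z = (LEAST r. z < (r + 1) ^ 2)"

definition pfst :: "nat \<Rightarrow> nat" where "pfst z = z - sq z ^ 2"
definition psnd :: "nat \<Rightarrow> nat" where "psnd z = sq z - pfst z"

lemma sq_npair: "sq (npair a b) = a + b"
  unfolding sq_def
proof (rule Least_equality)
  show "npair a b < (a + b + 1) ^ 2"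
    by (simp add: npair_def power2_eq_square algebra_simps)
  fix y assume "npair a b < (y + 1) ^ 2"
  then have "(a + b) ^ 2 < (y + 1) ^ 2" by (simp add: npair_def)
  then show "a + b \<le> y"
    using power_less_imp_less_base[of "a + b" 2 "y + 1"] by simp
qed

lemma pfst_npair [simp]: "pfst (npair a b) = a"
  and psnd_npair [simp]: "psnd (npair a b) = b"
proof -
  show "pfst (npair a b) = a" by (simp add: pfst_def sq_npair) (simp add: npair_def)
  then show "psnd (npair a b) = b" by (simp add: psnd_def sq_npair)
qed

lemma rec_npair: "rec l f \<Longrightarrow> rec l g \<Longrightarrow> rec l (\<lambda>e. npair (f e) (g e))"
  unfolding npair_def by (intro rec_intros rec_const)

lemma rec_sq: "rec l f \<Longrightarrow> rec l (\<lambda>e. sq (f e))"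
  unfolding sq_def
proof (rule rec_Least)
  assume f: "rec l f"
  show "recp (Suc l) (\<lambda>e. f (tl e) < (hd e + 1) ^ 2)"
    by (intro rec_intros rec_const rec_tl[OF f])
  show "\<exists>v. f e < (v + 1) ^ 2" for e
    by (rule exI[of _ "f e"]) (simp add: power2_eq_square)
qed

lemma rec_pfst: "rec l f \<Longrightarrow> rec l (\<lambda>e. pfst (f e))"
  unfolding pfst_def by (intro rec_intros rec_const rec_sq)

lemma rec_psnd: "rec l f \<Longrightarrow> rec l (\<lambda>e. psnd (f e))"
  unfolding psnd_def by (intro rec_intros rec_pfst rec_sq)

text \<open>The table is fixed, so the lookup unfolds into a finite cascade of comparisons with
  constants; \<open>h\<close> is applied to the entries in advance and not by the program.\<close>

lemma rec_lookup:
  assumes "rec l f" "rec l g"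
  shows "rec l (\<lambda>e. case map_of M (f e, g e) of None \<Rightarrow> d | Some y \<Rightarrow> h y)"
proof (induction M)
  case Nil
  show ?case by (simp add: rec_const)
next
  case (Cons x M)
  obtain q a y where x: "x = ((q, a), y)" by (metis surj_pair)
  have "rec l (\<lambda>e. if f e = q \<and> g e = a then h y
      else case map_of M (f e, g e) of None \<Rightarrow> d | Some y \<Rightarrow> h y)"
    by (intro rec_intros rec_const assms Cons.IH)
  then show ?case by (rule rec_cong) (auto simp: x)
qed

definition digit :: "nat \<Rightarrow> nat \<Rightarrow> nat \<Rightarrow> nat" where
  "digit B j x = x div B ^ j mod B"

lemma digit_0: "digit B 0 x = x mod B"
  by (simp add: digit_def)

lemma digit_Suc: "digit B (Suc j) x = digit B j (x div B)"
  by (simp add: digit_def div_mult2_eq)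

lemma digit_cons:
  assumes "x < B"
  shows "digit B 0 (x + B * y) = x" and "digit B (Suc j) (x + B * y) = digit B j y"
  using assms by (simp_all only: digit_0 digit_Suc mod_mult_self2 div_mult_self2 mod_less div_less) simp_all

lemma rec_digit: "rec l f \<Longrightarrow> rec l g \<Longrightarrow> rec l (\<lambda>e. digit B (f e) (g e))"
  unfolding digit_def by (intro rec_intros rec_const)

text \<open>A configuration is coded by its state and two numbers whose base-\<open>B\<close> digits are the symbols
  to the left of the head and those from the head on to the right.\<close>

definition coded :: "nat \<Rightarrow> config \<Rightarrow> nat \<Rightarrow> bool" where
  "coded B c z = (case c of (q, t, h) \<Rightarrow> \<exists>L R. z = npair q (npair L R) \<and>
     (\<forall>j. t (h + int j) = digit B j R) \<and> (\<forall>j. t (h - 1 - int j) = digit B j L))"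

lemma codedI:
  assumes "z = npair q (npair L R)" "\<And>j. t (h + int j) = digit B j R" "\<And>j. t (h - 1 - int j) = digit B j L"
  shows "coded B (q, t, h) z"
  unfolding coded_def using assms by blast

definition halted :: "tm \<Rightarrow> nat \<Rightarrow> nat \<Rightarrow> bool" where
  "halted M B z \<longleftrightarrow> map_of M (pfst z, psnd (psnd z) mod B) = None"

text \<open>Halted codes are fixed points, so every time after halting shows the same result. In the
  other case the lookup succeeds and the defaults 0 do not occur. The rule is looked up once per
  component because a computed lookup returns a single number.\<close>

definition nstep :: "tm \<Rightarrow> nat \<Rightarrow> nat \<Rightarrow> nat" where
  "nstep M B z = (let L = pfst (psnd z); R = psnd (psnd z); k = (pfst z, R mod B);
     q' = (case map_of M k of None \<Rightarrow> 0 | Some y \<Rightarrow> fst y);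
     b = (case map_of M k of None \<Rightarrow> 0 | Some y \<Rightarrow> fst (snd y));
     r = (case map_of M k of None \<Rightarrow> 0 | Some y \<Rightarrow> of_bool (snd (snd y) = MoveR))
   in if halted M B z then z
      else if r = (1 :: nat) then npair q' (npair (b + B * L) (R div B))
      else npair q' (npair (L div B) (L mod B + B * (b + B * (R div B)))))"

lemma coded_halted:
  assumes "coded B c z"
  shows "halted M B z \<longleftrightarrow> tm_step M c = None"
proof -
  obtain q t h where c: "c = (q, t, h)" by (metis surj_pair)
  with assms obtain L R where z: "z = npair q (npair L R)" "\<forall>j. t (h + int j) = digit B j R"
    by (auto simp: coded_def)
  then have "t h = R mod B" by (metis digit_0 add.right_neutral of_nat_0)
  then show ?thesis by (simp add: halted_def c z(1) split: option.split)
qed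

text \<open>A move transfers one digit between the two numbers: to the right the written symbol is
  pushed onto \<open>L\<close>, to the left it goes back onto \<open>R\<close>, followed by the last
  digit of \<open>L\<close>. The bound on the table ensures that a written symbol is a digit in base
  \<open>B\<close>.\<close>

lemma coded_step:
  assumes "coded B c z" "tm_step M c = Some c'" and B: "\<forall>y\<in>set M. fst (snd (snd y)) < B"
  shows "coded B c' (nstep M B z)"
proof -
  obtain q t h where c: "c = (q, t, h)" by (metis surj_pair)
  with assms(1) obtain L R where z: "z = npair q (npair L R)" "\<And>j. t (h + int j) = digit B j R"
    "\<And>j. t (h - 1 - int j) = digit B j L"
    by (auto simp: coded_def)
  have th: "t h = R mod B" using z(2)[of 0] by (simp add: digit_0)
  obtain q' b d where look: "map_of M (q, t h) = Some (q', b, d)" and c': "c' = (q', t(h := b), shift d h)"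
    using assms(2) by (auto simp: c split: option.splits)
  have b: "b < B" using B map_of_SomeD[OF look] by fastforce
  have nh: "\<not> halted M B z" using coded_halted[OF assms(1)] assms(2) by simp
  note cons = digit_cons
  have L: "L mod B < B" using b by simp
  show ?thesis
  proof (cases d)
    case MoveR
    have "nstep M B z = npair q' (npair (b + B * L) (R div B))"
      using nh look by (simp add: nstep_def z(1) th MoveR Let_def)
    moreover have "(t(h := b)) (h + 1 + int j) = digit B j (R div B)" for j
      using z(2)[of "Suc j"] by (simp add: digit_Suc add.assoc)
    moreover have "(t(h := b)) (h + 1 - 1 - int j) = digit B j (b + B * L)" for j
    proof (cases j)
      case (Suc i)
      have "(t(h := b)) (h + 1 - 1 - int j) = t (h - 1 - int i)"
        using Suc by (simp add: algebra_simps)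
      then show ?thesis unfolding Suc cons(2)[OF b] z(3) .
    qed (simp add: cons(1)[OF b])
    ultimately show ?thesis unfolding c' MoveR shift.simps by (rule codedI)
  next
    case MoveL
    have "nstep M B z = npair q' (npair (L div B) (L mod B + B * (b + B * (R div B))))"
      using nh look by (simp add: nstep_def z(1) th MoveL Let_def)
    moreover have "(t(h := b)) (h - 1 - 1 - int j) = digit B j (L div B)" for j
      using z(3)[of "Suc j"] by (simp add: digit_Suc algebra_simps)
    moreover have "(t(h := b)) (h - 1 + int j) = digit B j (L mod B + B * (b + B * (R div B)))" for j
    proof (cases j)
      case 0
      then show ?thesis using z(3)[of 0] cons(1)[OF L] by (simp add: digit_0)
    next
      case (Suc i)
      show ?thesis
      proof (cases i)
        case 0
        then show ?thesis using Suc cons(1)[OF b] cons(2)[OF L] by simp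
      next
        case (Suc k)
        have "(t(h := b)) (h - 1 + int j) = t (h + int (Suc k))"
          using Suc \<open>j = Suc i\<close> by (simp add: algebra_simps)
        then show ?thesis unfolding \<open>j = Suc i\<close> Suc cons(2)[OF L] cons(2)[OF b] z(2) by (simp only: digit_Suc)
      qed
    qed
    ultimately show ?thesis unfolding c' MoveL shift.simps by (blast intro: codedI)
  qed
qed

lemma coded_steps:
  assumes "(\<lambda>c c'. tm_step M c = Some c')\<^sup>*\<^sup>* c c'" "coded B c z" "\<forall>y\<in>set M. fst (snd (snd y)) < B"
  shows "\<exists>t. coded B c' ((nstep M B ^^ t) z)"
  using assms(1)
proof (induction rule: rtranclp_induct)
  case base
  show ?case by (rule exI[of _ 0]) (simp add: assms(2))
next
  case (step c1 c2)
  then obtain t where "coded B c1 ((nstep M B ^^ t) z)" by blast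
  from coded_step[OF this step(2) assms(3)] show ?case
    by (intro exI[of _ "Suc t"]) simp
qed

text \<open>The iteration yields a number with \<open>n\<close> digits 2: the input is
  \<open>replicate n True\<close>, and \<open>True\<close> stands on the tape as the symbol
  2.\<close>

definition start :: "nat \<Rightarrow> nat \<Rightarrow> nat" where
  "start B n = npair 0 (npair 0 (((\<lambda>r. 2 + B * r) ^^ n) 0))"

lemma coded_start:
  assumes "B > 2"
  shows "coded B (tm_init (replicate n True)) (start B n)"
proof -
  have "digit B j (((\<lambda>r. 2 + B * r) ^^ n) 0) = (if j < n then 2 else 0)" for j
  proof (induction n arbitrary: j)
    case 0
    show ?case by (simp add: digit_def)
  next
    case (Suc n)
    then show ?case using digit_cons[OF assms] by (cases j) simp_all
  qed
  moreover have "digit B j 0 = 0" for j by (simp add: digit_def)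
  ultimately show ?thesis
    unfolding tm_init_def start_def by (intro codedI[OF refl]) auto
qed

definition halt_time :: "tm \<Rightarrow> nat \<Rightarrow> nat \<Rightarrow> nat" where
  "halt_time M B n = (LEAST t. halted M B ((nstep M B ^^ t) (start B n)))"

definition final :: "tm \<Rightarrow> nat \<Rightarrow> nat \<Rightarrow> nat" where
  "final M B n = psnd (psnd ((nstep M B ^^ halt_time M B n) (start B n)))"

lemma nstep_halted: "halted M B z \<Longrightarrow> (nstep M B ^^ t) z = z"
  by (induction t) (simp_all add: nstep_def Let_def)

lemma tm_computes_final:
  assumes "tm_computes 2 M (replicate n True) s" and B: "\<forall>y\<in>set M. fst (snd (snd y)) < B" "B > 2"
  shows "\<exists>t. halted M B ((nstep M B ^^ t) (start B n))"
    and "\<And>i. i < length s \<Longrightarrow> digit B i (final M B n) = Suc (s ! i)"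
proof -
  let ?z = "\<lambda>t. (nstep M B ^^ t) (start B n)"
  obtain c where c: "(\<lambda>c c'. tm_step M c = Some c')\<^sup>*\<^sup>* (tm_init (replicate n True)) c"
    "tm_step M c = None" "tm_output 2 c = s"
    using assms(1) by (auto simp: tm_computes_def)
  obtain t where t: "coded B c (?z t)"
    using coded_steps[OF c(1) coded_start[OF B(2)] B(1)] by blast
  then have h: "halted M B (?z t)" using coded_halted c(2) by blast
  then show "\<exists>t. halted M B (?z t)" by blast
  have hT: "halted M B (?z (halt_time M B n))"
    unfolding halt_time_def by (rule LeastI[of "\<lambda>t. halted M B (?z t)", OF h])
  have le: "halt_time M B n \<le> t"
    unfolding halt_time_def by (rule Least_le) (rule h)
  have "?z t = (nstep M B ^^ (t - halt_time M B n)) (?z (halt_time M B n))"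
    using le by (metis comp_apply funpow_add le_add_diff_inverse2)
  then have eq: "?z t = ?z (halt_time M B n)"
    using nstep_halted[OF hT] by simp
  obtain q tp h where cc: "c = (q, tp, h)" by (metis surj_pair)
  with t obtain L where z: "\<And>j. tp (h + int j) = digit B j (final M B n)"
    unfolding eq final_def by (auto simp: coded_def)
  let ?len = "LEAST n. tp (h + int n) \<notin> {1..2}"
  have s: "s = map (\<lambda>i. tp (h + int i) - 1) [0..<?len]"
    using c(3) by (simp add: cc)
  fix i assume i: "i < length s"
  then have "i < ?len" by (simp add: s)
  \<comment> \<open>Before the end of the output the cell is at least 1, so the truncated
    subtraction in \<open>tm_output\<close> can be undone.\<close>
  then have "tp (h + int i) \<in> {1..2}" using not_less_Least by blast
  moreover have "s ! i = tp (h + int i) - 1"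
    using i by (subst s) (simp add: s)
  ultimately show "digit B i (final M B n) = Suc (s ! i)"
    using z[of i] by simp
qed

text \<open>Halting on every unary input makes the search for the halting time total; the rest is
  iteration of \<open>nstep\<close>.\<close>

lemma rec_final:
  assumes "\<And>n. \<exists>t. halted M B ((nstep M B ^^ t) (start B n))"
  shows "rec 1 (\<lambda>e. final M B (e ! 0))"
proof -
  have look: "rec l (\<lambda>e. case map_of M (pfst (f e), psnd (psnd (f e)) mod B) of None \<Rightarrow> d | Some y \<Rightarrow> h y)"
    if "rec l f" for l f d h
    by (intro rec_lookup rec_pfst rec_psnd rec_mod rec_const that)
  have halted: "recp l (\<lambda>e. halted M B (f e))" if "rec l f" for l f
  proof -
    have "recp l (\<lambda>e. (case map_of M (pfst (f e), psnd (psnd (f e)) mod B) of None \<Rightarrow> 1 | Some y \<Rightarrow> 0) = (1 :: nat))"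
      by (intro recp_eq look that rec_const)
    then show ?thesis
      unfolding recp_def by (rule rec_cong) (auto simp: halted_def split: option.split)
  qed
  have nstep: "rec l (\<lambda>e. nstep M B (f e))" if f: "rec l f" for l f
    unfolding nstep_def Let_def
    by (intro rec_if halted rec_npair rec_add rec_mult rec_div rec_mod recp_eq rec_const rec_pfst rec_psnd look f)
  have start: "rec l (\<lambda>e. start B (f e))" if f: "rec l f" for l f
    unfolding start_def
    by (intro rec_npair rec_const rec_iter[where F = "\<lambda>e r. 2 + B * r" and y = "\<lambda>_. 0"] rec_add rec_mult rec_hd f)
  have steps: "rec l (\<lambda>e. (nstep M B ^^ g e) (start B (f e)))" if "rec l f" "rec l g" for l f g
    by (intro rec_iter[where F = "\<lambda>_. nstep M B"] nstep rec_hd start that)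
  have "rec 1 (\<lambda>e. halt_time M B (e ! 0))"
    unfolding halt_time_def
  proof (rule rec_Least)
    show "recp (Suc 1) (\<lambda>e. halted M B ((nstep M B ^^ hd e) (start B (tl e ! 0))))"
      by (intro halted steps rec_hd rec_tl[of 1 "\<lambda>e. e ! 0"] rec_var) simp
  qed (rule assms)
  then show ?thesis
    unfolding final_def by (intro rec_psnd steps rec_var) auto
qed

section \<open>Decoding the rational outputs\<close>

definition rnum :: "rat \<Rightarrow> nat" where "rnum r = nat (fst (quotient_of r))"
definition rden :: "rat \<Rightarrow> nat" where "rden r = nat (snd (quotient_of r))"

text \<open>The code is a sign, a block of ones closed by 0, and a second such block. Letters are
  raised by one on the tape, so a search for the digit 1 finds the end of each block.\<close>

theorem rec_computable_rat:
  assumes "computable_seq rat_code A"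
  shows "rec 1 (\<lambda>e. rnum (A (e ! 0)))" and "rec 1 (\<lambda>e. rden (A (e ! 0)))"
proof -
  obtain M where M: "\<And>n. tm_computes 2 M (replicate n True) (rat_code (A n))"
    using assms by (auto simp: computable_seq_def)
  obtain B where B: "\<forall>y\<in>{2} \<union> (fst \<circ> snd \<circ> snd) ` set M. y < B"
    using finite_nat_set_iff_bounded[of "{2} \<union> (fst \<circ> snd \<circ> snd) ` set M"] by auto
  then have B': "\<forall>y\<in>set M. fst (snd (snd y)) < B" "B > 2" by auto
  note fin = tm_computes_final[OF M B']
  let ?D = "\<lambda>n i. digit B i (final M B n)"
  have rec_fin: "rec 1 (\<lambda>e. final M B (e ! 0))" by (rule rec_final) (rule fin(1))
  define aa where "aa n = (LEAST i. ?D n (Suc i) = 1)" for n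
  define bb where "bb n = (LEAST j. ?D n (aa n + 2 + j) = 1)" for n
  have sign: "?D n 0 = (if fst (quotient_of (A n)) < 0 then 2 else 1)"
    and a1: "\<And>i. i < nat \<bar>fst (quotient_of (A n))\<bar> \<Longrightarrow> ?D n (Suc i) = 2"
    and a2: "?D n (Suc (nat \<bar>fst (quotient_of (A n))\<bar>)) = 1"
    and b1: "\<And>j. j < rden (A n) \<Longrightarrow> ?D n (nat \<bar>fst (quotient_of (A n))\<bar> + 2 + j) = 2"
    and b2: "?D n (nat \<bar>fst (quotient_of (A n))\<bar> + 2 + rden (A n)) = 1" for n
  proof -
    obtain a b where ab: "quotient_of (A n) = (a, b)" by (cases "quotient_of (A n)")
    have code: "rat_code (A n) = (if a < 0 then 1 else 0) # replicate (nat \<bar>a\<bar>) 1 @ [0] @ replicate (nat b) 1 @ [0]"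
      by (simp add: rat_code_def ab nat_code_def)
    show "?D n 0 = (if fst (quotient_of (A n)) < 0 then 2 else 1)"
      using fin(2)[of 0 n] by (simp add: code ab)
    show "?D n (Suc i) = 2" if "i < nat \<bar>fst (quotient_of (A n))\<bar>" for i
      using fin(2)[of "Suc i" n] that by (simp add: code ab nth_append)
    show "?D n (Suc (nat \<bar>fst (quotient_of (A n))\<bar>)) = 1"
      using fin(2)[of "Suc (nat \<bar>a\<bar>)" n] by (simp add: code ab nth_append)
    show "?D n (nat \<bar>fst (quotient_of (A n))\<bar> + 2 + j) = 2" if "j < rden (A n)" for j
      using fin(2)[of "nat \<bar>a\<bar> + 2 + j" n] that by (simp add: code ab nth_append rden_def)
    show "?D n (nat \<bar>fst (quotient_of (A n))\<bar> + 2 + rden (A n)) = 1"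
      using fin(2)[of "nat \<bar>a\<bar> + 2 + nat b" n] by (simp add: code ab nth_append rden_def)
  qed
  have aa: "aa n = nat \<bar>fst (quotient_of (A n))\<bar>" for n
    unfolding aa_def
  proof (rule Least_equality, rule a2)
    fix y assume "?D n (Suc y) = 1"
    with a1[of y n] show "nat \<bar>fst (quotient_of (A n))\<bar> \<le> y" by (intro leI notI) auto
  qed
  have bb: "bb n = rden (A n)" for n
    unfolding bb_def aa
  proof (rule Least_equality, rule b2)
    fix y assume "?D n (nat \<bar>fst (quotient_of (A n))\<bar> + 2 + y) = 1"
    with b1[of y n] show "rden (A n) \<le> y" by (intro leI notI) auto
  qed
  have rec_aa: "rec 1 (\<lambda>e. aa (e ! 0))"
    unfolding aa_def
  proof (rule rec_Least)
    show "recp (Suc 1) (\<lambda>e. ?D (tl e ! 0) (Suc (hd e)) = 1)"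
      by (intro recp_eq rec_digit rec_Suc rec_hd rec_const rec_tl[OF rec_fin])
    show "\<exists>v. ?D (e ! 0) (Suc v) = 1" for e using a2 by blast
  qed
  have "rec 1 (\<lambda>e. bb (e ! 0))"
    unfolding bb_def
  proof (rule rec_Least)
    show "recp (Suc 1) (\<lambda>e. ?D (tl e ! 0) (aa (tl e ! 0) + 2 + hd e) = 1)"
      by (intro recp_eq rec_digit rec_add rec_hd rec_const rec_tl[OF rec_fin] rec_tl[OF rec_aa])
    show "\<exists>v. ?D (e ! 0) (aa (e ! 0) + 2 + v) = 1" for e using b2 aa by metis
  qed
  then show "rec 1 (\<lambda>e. rden (A (e ! 0)))" by (simp add: bb)
  have "rec 1 (\<lambda>e. if ?D (e ! 0) 0 = 1 then aa (e ! 0) else 0)"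
    by (intro rec_if recp_eq rec_digit rec_const rec_fin rec_aa)
  then show "rec 1 (\<lambda>e. rnum (A (e ! 0)))"
    by (rule rec_cong) (auto simp: sign aa rnum_def)
qed

section \<open>Compilation of register programs to Turing machines\<close>

text \<open>Partial functions are used in place of rule lists because fragments with disjoint states
  can then be joined by \<open>++\<close>; a list is recovered at the end from the finite
  domain.\<close>

type_synonym table = "nat \<times> nat \<Rightarrow> (nat \<times> nat \<times> move) option"

fun tstep :: "table \<Rightarrow> config \<Rightarrow> config option" where
  "tstep \<delta> (q, t, h) =
     (case \<delta> (q, t h) of
        None \<Rightarrow> None
      | Some (q', b, d) \<Rightarrow> Some (q', t(h := b), shift d h))"

lemma tm_step_eq: "tm_step M c = tstep (map_of M) c"
  by (cases c) simp

abbreviation reach :: "table \<Rightarrow> config \<Rightarrow> config \<Rightarrow> bool" where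
  "reach \<delta> \<equiv> (\<lambda>c c'. tstep \<delta> c = Some c')\<^sup>*\<^sup>*"

lemma reach_mono:
  assumes "\<delta> \<subseteq>\<^sub>m \<delta>'" "reach \<delta> c c'"
  shows "reach \<delta>' c c'"
proof -
  have step: "tstep \<delta>' c = Some c'" if "tstep \<delta> c = Some c'" for c c'
  proof (cases c)
    case (fields q t h)
    with that obtain y where "\<delta> (q, t h) = Some y" by (auto split: option.splits)
    with assms(1) have "\<delta>' (q, t h) = Some y" by (metis domI map_le_def)
    with that fields \<open>\<delta> (q, t h) = Some y\<close> show ?thesis by simp
  qed
  have "(\<lambda>c c'. tstep \<delta> c = Some c') \<le> (\<lambda>c c'. tstep \<delta>' c = Some c')"
    using step by (intro predicate2I)
  from rtranclp_mono[OF this] assms(2) show ?thesis by (rule predicate2D)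
qed

lemma reach_step:
  assumes "\<delta> (q, t h) = Some (q', b, d)" "reach \<delta> (q', t(h := b), shift d h) c"
  shows "reach \<delta> (q, t, h) c"
  using assms by (auto intro: converse_rtranclp_into_rtranclp)

lemma finite_map_of_ex:
  assumes "finite (dom m)"
  shows "\<exists>xs. map_of xs = m"
proof -
  obtain ks where ks: "set ks = dom m" using finite_list[OF assms] by blast
  have "map_of (map (\<lambda>k. (k, the (m k))) ks) = m"
    unfolding map_of_map_restrict
  proof (rule ext)
    fix x
    show "((Some \<circ> (\<lambda>k. the (m k))) |` set ks) x = m x"
      by (cases "m x") (simp_all add: restrict_map_def ks domIff)
  qed
  then show ?thesis by blast
qed

text \<open>A tape cell carries a letter below \<open>W\<close> together with a set of pebbles numbered at most \<open>K\<close>.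
  Pebble 0 marks cell 0, and pebble \<open>r + 1\<close> lies on the cell whose number is the content of
  register \<open>r\<close>. The symbol \<open>mark W K\<close> on cell -1 stops every walk to the left.\<close>

definition enc :: "nat \<Rightarrow> nat \<Rightarrow> nat set \<Rightarrow> nat" where
  "enc W a S = a + W * set_encode S"

definition letter :: "nat \<Rightarrow> nat \<Rightarrow> nat" where
  "letter W x = x mod W"

definition pebbles :: "nat \<Rightarrow> nat \<Rightarrow> nat set" where
  "pebbles W x = set_decode (x div W)"

definition symbols :: "nat \<Rightarrow> nat \<Rightarrow> nat set" where
  "symbols W K = {enc W a S | a S. a < W \<and> S \<subseteq> {..K}}"

text \<open>This is the letter 0 with the single pebble \<open>K + 1\<close>, one beyond the pebbles
  in use, and hence different from all symbols.\<close>

definition mark :: "nat \<Rightarrow> nat \<Rightarrow> nat" where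
  "mark W K = W * 2 ^ Suc K"

abbreviation "all_symbols W K \<equiv> insert (mark W K) (symbols W K)"

lemma letter_enc [simp]: "a < W \<Longrightarrow> letter W (enc W a S) = a"
  by (simp add: letter_def enc_def)

lemma pebbles_enc [simp]: "a < W \<Longrightarrow> finite S \<Longrightarrow> pebbles W (enc W a S) = S"
  by (simp add: pebbles_def enc_def)

lemma finite_symbols: "finite (symbols W K)"
proof -
  have "symbols W K = (\<lambda>(a, S). enc W a S) ` ({..<W} \<times> Pow {..K})"
    by (auto simp: symbols_def)
  then show ?thesis by simp
qed

lemma mark_notin: "mark W K \<notin> symbols W K"
proof
  assume "mark W K \<in> symbols W K"
  then obtain a S where aS: "a < W" "S \<subseteq> {..K}" "mark W K = enc W a S"
    by (auto simp: symbols_def)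
  then have fin: "finite S" using finite_subset by blast
  have "mark W K div W = set_encode S" using aS by (simp add: enc_def)
  moreover have "mark W K div W = 2 ^ Suc K" using aS(1) by (simp add: mark_def)
  moreover have "2 ^ Suc K = set_encode {Suc K}" by (simp add: set_encode_def)
  ultimately have "S = {Suc K}" using fin by (metis set_encode_eq finite.emptyI finite.insertI)
  then show False using aS(2) by auto
qed

fun peb :: "(nat \<Rightarrow> nat) \<Rightarrow> nat \<Rightarrow> nat" where
  "peb s 0 = 0"
| "peb s (Suc i) = s i"

definition pebs_at :: "nat \<Rightarrow> (nat \<Rightarrow> nat) \<Rightarrow> nat \<Rightarrow> nat set" where
  "pebs_at K s v = {j. j \<le> K \<and> peb s j = v}"

definition tape :: "nat \<Rightarrow> nat \<Rightarrow> (nat \<Rightarrow> nat) \<Rightarrow> (nat \<Rightarrow> nat) \<Rightarrow> int \<Rightarrow> nat" where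
  "tape W K s w z = (if z = -1 then mark W K else if z < 0 then 0
     else enc W (w (nat z)) (pebs_at K s (nat z)))"

lemma finite_pebs_at [simp]: "finite (pebs_at K s v)"
  by (rule finite_subset[of _ "{..K}"]) (auto simp: pebs_at_def)

lemma tape_in_symbols: "w v < W \<Longrightarrow> tape W K s w (int v) \<in> symbols W K"
  by (auto simp: tape_def symbols_def pebs_at_def)

text \<open>All machine code is built from three kinds of states: \<open>gseek\<close> walks right
  from cell 0 to pebble \<open>j\<close> and acts there, \<open>gret\<close> walks left to the mark
  and steps back to cell 0, \<open>gact\<close> performs a single action. They are undefined outside
  the finitely many symbols, so the table stays finite.\<close>

definition gseek :: "nat \<Rightarrow> nat \<Rightarrow> nat \<Rightarrow> nat \<Rightarrow> (nat \<Rightarrow> nat \<times> nat \<times> move) \<Rightarrow> nat \<Rightarrow> (nat \<times> nat \<times> move) option" where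
  "gseek W K q j f x = (if x \<in> symbols W K then Some (if j \<in> pebbles W x then f x else (q, x, MoveR)) else None)"

definition gret :: "nat \<Rightarrow> nat \<Rightarrow> nat \<Rightarrow> nat \<Rightarrow> nat \<Rightarrow> (nat \<times> nat \<times> move) option" where
  "gret W K q q' x = (if x \<in> symbols W K then Some (q, x, MoveL)
     else if x = mark W K then Some (q', x, MoveR) else None)"

definition gact :: "nat \<Rightarrow> nat \<Rightarrow> (nat \<Rightarrow> nat \<times> nat \<times> move) \<Rightarrow> nat \<Rightarrow> (nat \<times> nat \<times> move) option" where
  "gact W K f x = (if x \<in> symbols W K then Some (f x) else None)"

lemma reach_seek:
  assumes \<delta>: "\<And>x. \<delta> (q, x) = gseek W K q j f x"
    and w: "\<forall>v. w v < W" and j: "j \<le> K"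
  shows "reach \<delta> (q, tape W K s w, 0) (q, tape W K s w, int (peb s j))"
proof -
  have "reach \<delta> (q, tape W K s w, 0) (q, tape W K s w, int v)" if "v \<le> peb s j" for v
    using that
  proof (induction v)
    case (Suc v)
    have "j \<notin> pebbles W (tape W K s w (int v))"
      using Suc.prems w by (simp add: tape_def pebs_at_def)
    then have "tstep \<delta> (q, tape W K s w, int v) = Some (q, tape W K s w, int (Suc v))"
      using tape_in_symbols[of w v W K s] w by (simp add: \<delta> gseek_def add.commute)
    with Suc show ?case by (auto intro: rtranclp.rtrancl_into_rtrancl)
  qed simp
  then show ?thesis by simp
qed

lemma reach_ret:
  assumes \<delta>: "\<And>x. \<delta> (q, x) = gret W K q q' x"
    and t: "t (-1) = mark W K" "\<And>v. t (int v) \<in> symbols W K"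
    and h: "h \<ge> -1"
  shows "reach \<delta> (q, t, h) (q', t, 0)"
proof -
  have 1: "reach \<delta> (q, t, -1) (q', t, 0)"
    using mark_notin[of W K] t(1) by (intro r_into_rtranclp) (simp add: \<delta> gret_def fun_upd_idem)
  have "reach \<delta> (q, t, int n - 1) (q', t, 0)" for n
  proof (induction n)
    case (Suc n)
    have "tstep \<delta> (q, t, int n) = Some (q, t, int n - 1)"
      using t by (simp add: \<delta> gret_def)
    with Suc show ?case
      by (auto intro: converse_rtranclp_into_rtranclp)
  qed (use 1 in simp)
  from this[of "nat (h + 1)"] h show ?thesis by simp
qed

section \<open>Machine code for the single commands\<close>

fun regs :: "com \<Rightarrow> nat set" where
  "regs (Inc r) = {r}"
| "regs (Dec r) = {r}"
| "regs (Put r a) = {r}"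
| "regs (IfEq r a c) = insert r (regs c)"
| "regs (Seq c c') = regs c \<union> regs c'"
| "regs (While r c) = insert r (regs c)"

fun letters :: "com \<Rightarrow> nat set" where
  "letters (Inc r) = {}"
| "letters (Dec r) = {}"
| "letters (Put r a) = {a}"
| "letters (IfEq r a c) = letters c"
| "letters (Seq c c') = letters c \<union> letters c'"
| "letters (While r c) = letters c"

lemma finite_regs: "finite (regs c)" by (induction c) auto
lemma finite_letters: "finite (letters c)" by (induction c) auto

lemma exec_letters:
  assumes "exec c st st'" "letters c \<subseteq> {..<W}" "\<And>v. snd st v < W"
  shows "snd st' v < W"
  using assms by (induction arbitrary: v) (auto split: if_splits)

definition del :: "nat \<Rightarrow> nat \<Rightarrow> nat \<Rightarrow> nat" where
  "del W j x = enc W (letter W x) (pebbles W x - {j})"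

definition ins :: "nat \<Rightarrow> nat \<Rightarrow> nat \<Rightarrow> nat" where
  "ins W j x = enc W (letter W x) (insert j (pebbles W x))"

text \<open>Code occupies the states from \<open>n\<close> to \<open>n' - 1\<close> and starts and
  ends with the head on cell 0. It has no rule for its exit state \<open>n'\<close>, so further code
  can be attached there.\<close>

definition implements :: "nat \<Rightarrow> nat \<Rightarrow> table \<Rightarrow> nat \<Rightarrow> com \<Rightarrow> nat \<Rightarrow> bool" where
  "implements W K \<delta> n c n' \<longleftrightarrow> n < n' \<and> dom \<delta> \<subseteq> {n..<n'} \<times> all_symbols W K \<and>
     (\<forall>s w s' w'. exec c (s, w) (s', w') \<longrightarrow> (\<forall>v. w v < W) \<longrightarrow>
        reach \<delta> (n, tape W K s w, 0) (n', tape W K s' w', 0))"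

lemma implements_dom:
  "implements W K \<delta> n c n' \<Longrightarrow> q < n \<or> n' \<le> q \<Longrightarrow> \<delta> (q, x) = None"
proof (rule ccontr)
  assume "implements W K \<delta> n c n'" and q: "q < n \<or> n' \<le> q" and "\<delta> (q, x) \<noteq> None"
  then have "dom \<delta> \<subseteq> {n..<n'} \<times> all_symbols W K" "(q, x) \<in> dom \<delta>"
    by (simp_all add: implements_def domIff)
  then have "(q, x) \<in> {n..<n'} \<times> all_symbols W K" by (rule subsetD)
  with q show False by simp
qed

lemma implementsI:
  assumes "n < n'" "dom \<delta> \<subseteq> {n..<n'} \<times> all_symbols W K"
    and "\<And>s w s' w'. exec c (s, w) (s', w') \<Longrightarrow> (\<forall>v. w v < W) \<Longrightarrow>
        reach \<delta> (n, tape W K s w, 0) (n', tape W K s' w', 0)"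
  shows "implements W K \<delta> n c n'"
  unfolding implements_def using assms by blast

definition gadget :: "nat \<Rightarrow> nat \<Rightarrow> (nat \<Rightarrow> (nat \<times> nat \<times> move) option) \<Rightarrow> bool" where
  "gadget W K f \<longleftrightarrow> (\<forall>x. x \<notin> all_symbols W K \<longrightarrow> f x = None)"

lemma gadget_simps [simp]:
  "gadget W K (gseek W K q j f)" "gadget W K (gret W K q q')" "gadget W K (gact W K g)"
  by (auto simp: gadget_def gseek_def gret_def gact_def)

definition tbl :: "nat \<Rightarrow> (nat \<Rightarrow> (nat \<times> nat \<times> move) option) list \<Rightarrow> table" where
  "tbl n fs = (\<lambda>(q, x). if n \<le> q \<and> q < n + length fs then (fs ! (q - n)) x else None)"

lemma tbl_apply: "tbl n fs (q, x) = (if n \<le> q \<and> q < n + length fs then (fs ! (q - n)) x else None)"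
  by (simp add: tbl_def)

lemma dom_tbl:
  assumes "\<And>f. f \<in> set fs \<Longrightarrow> gadget W K f"
  shows "dom (tbl n fs) \<subseteq> {n..<n + length fs} \<times> all_symbols W K"
proof
  fix z assume z: "z \<in> dom (tbl n fs)"
  obtain q x where qx: "z = (q, x)" by (cases z)
  with z have q: "n \<le> q" "q < n + length fs" "(fs ! (q - n)) x \<noteq> None"
    by (auto simp: tbl_def split: if_splits)
  then have "fs ! (q - n) \<in> set fs" by simp
  with assms have "gadget W K (fs ! (q - n))" by blast
  with q qx show "z \<in> {n..<n + length fs} \<times> all_symbols W K"
    unfolding gadget_def by auto
qed

lemma pebs_at_upd:
  "Suc r \<le> K \<Longrightarrow> pebs_at K (s(r := v)) u =
     (if u = v then insert (Suc r) (pebs_at K s u) else pebs_at K s u - {Suc r})"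
proof -
  have "peb (s(r := v)) j = (if j = Suc r then v else peb s j)" for j
    by (cases j) auto
  then show "Suc r \<le> K \<Longrightarrow> ?thesis" by (auto simp: pebs_at_def)
qed

lemma tape_nonneg: "tape W K s w (int u) = enc W (w u) (pebs_at K s u)"
  by (simp add: tape_def)

lemma tape_neg: "z < 0 \<Longrightarrow> tape W K s w z = (if z = -1 then mark W K else 0)"
  by (simp add: tape_def)

lemma tape_move_pebble:
  assumes r: "Suc r \<le> K" and w: "\<forall>v. w v < W" and v: "v \<noteq> s r"
  shows "(tape W K s w)(int (s r) := del W (Suc r) (tape W K s w (int (s r))),
           int v := ins W (Suc r) (tape W K s w (int v))) = tape W K (s(r := v)) w"
proof (rule ext)
  fix z
  show "((tape W K s w)(int (s r) := del W (Suc r) (tape W K s w (int (s r))),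
           int v := ins W (Suc r) (tape W K s w (int v)))) z = tape W K (s(r := v)) w z"
  proof (cases "z < 0")
    case True
    then have "z \<noteq> int (s r)" "z \<noteq> int v" by linarith+
    with True show ?thesis by (simp only: fun_upd_apply if_False tape_neg)
  next
    case False
    then obtain u where u: "z = int u" by (metis nonneg_int_cases not_less)
    have "Suc r \<notin> pebs_at K s u" if "u \<noteq> s r"
      using that by (auto simp: pebs_at_def)
    then have rest: "pebs_at K s u - {Suc r} = pebs_at K s u" if "u \<noteq> s r"
      using that by blast
    have enc: "letter W (enc W (w u) (pebs_at K s u)) = w u"
      "pebbles W (enc W (w u) (pebs_at K s u)) = pebs_at K s u" for u
      using w by simp_all
    consider "u = v" | "u = s r" "u \<noteq> v" | "u \<noteq> s r" "u \<noteq> v" by blast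
    then show ?thesis
    proof cases
      case 1
      then show ?thesis unfolding u 1 fun_upd_same tape_nonneg ins_def enc pebs_at_upd[OF r] by simp
    next
      case 2
      then have "int u \<noteq> int v" by simp
      with 2 show ?thesis
        unfolding u fun_upd_other[OF \<open>int u \<noteq> int v\<close>] 2(1)[symmetric] fun_upd_same tape_nonneg del_def enc pebs_at_upd[OF r]
        by simp
    next
      case 3
      then have "int u \<noteq> int v" "int u \<noteq> int (s r)" by simp_all
      with 3 show ?thesis
        unfolding u fun_upd_other[OF \<open>int u \<noteq> int v\<close>] fun_upd_other[OF \<open>int u \<noteq> int (s r)\<close>] tape_nonneg pebs_at_upd[OF r]
        unfolding rest[OF 3(1)] by simp
    qed
  qed
qed

lemma tape_Put:
  assumes w: "\<forall>v. w v < W"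
  shows "(tape W K s w)(int u := enc W a (pebbles W (tape W K s w (int u)))) = tape W K s (w(u := a))"
proof (rule ext)
  fix z
  show "((tape W K s w)(int u := enc W a (pebbles W (tape W K s w (int u))))) z = tape W K s (w(u := a)) z"
  proof (cases "z < 0")
    case True
    then have "z \<noteq> int u" by linarith
    with True show ?thesis by (simp only: fun_upd_apply if_False tape_neg)
  next
    case False
    then obtain v where v: "z = int v" by (metis nonneg_int_cases not_less)
    show ?thesis
      using w by (cases "v = u") (simp_all add: v tape_nonneg)
  qed
qed

lemma pebbles_tape:
  "w v < W \<Longrightarrow> j \<in> pebbles W (tape W K s w (int v)) \<longleftrightarrow> j \<le> K \<and> peb s j = v"
  by (auto simp: tape_def pebs_at_def)

lemma tape_cell:
  assumes "\<forall>v. w v < W"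
  obtains x where "tape W K s w (int v) = x" "x \<in> symbols W K" "letter W x = w v"
    "\<And>j. j \<in> pebbles W x \<longleftrightarrow> j \<le> K \<and> peb s j = v"
proof (rule that[OF refl])
  have w: "w v < W" using assms by blast
  show "tape W K s w (int v) \<in> symbols W K" using w by (rule tape_in_symbols)
  show "letter W (tape W K s w (int v)) = w v" using w by (simp add: tape_nonneg)
  show "j \<in> pebbles W (tape W K s w (int v)) \<longleftrightarrow> j \<le> K \<and> peb s j = v" for j
    using w by (rule pebbles_tape)
qed

lemma letter_tape: "w v < W \<Longrightarrow> letter W (tape W K s w (int v)) = w v"
  by (auto simp: tape_def)

lemma reach_ret_tape:
  assumes "\<And>x. \<delta> (q, x) = gret W K q q' x" "\<forall>v. w v < W" "h \<ge> -1"
  shows "reach \<delta> (q, tape W K s w, h) (q', tape W K s w, 0)"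
proof (rule reach_ret[OF assms(1) _ _ assms(3)])
  show "tape W K s w (- 1) = mark W K" by (simp add: tape_def)
  show "tape W K s w (int v) \<in> symbols W K" for v by (rule tape_in_symbols) (use assms(2) in blast)
qed

inductive_cases exec_IncE: "exec (Inc r) (s, w) (s', w')"
inductive_cases exec_DecE: "exec (Dec r) (s, w) (s', w')"
inductive_cases exec_PutE: "exec (Put r a) (s, w) (s', w')"
inductive_cases exec_IfE: "exec (IfEq r a c) (s, w) (s', w')"
inductive_cases exec_SeqE: "exec (Seq c c') (s, w) (s', w')"
inductive_cases exec_WhileE: "exec (While r c) (s, w) (s', w')"

text \<open>The common core of \<open>Inc\<close> and \<open>Dec\<close>: the pebble is lifted, the
  head moves by one cell, the pebble is dropped, and the head returns. If it was dropped on cell 0,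
  the return starts on the mark.\<close>

lemma reach_move_pebble:
  assumes r: "Suc r \<le> K" and w: "\<forall>v. w v < W"
    and step1: "\<delta> (q, tape W K s w (int (s r))) = Some (q1, del W (Suc r) (tape W K s w (int (s r))), d)"
    and step2: "\<And>x. x \<in> symbols W K \<Longrightarrow> \<delta> (q1, x) = Some (q2, ins W (Suc r) x, MoveL)"
    and ret: "\<And>x. \<delta> (q2, x) = gret W K q2 q' x"
    and d: "shift d (int (s r)) = int v" "v \<noteq> s r"
  shows "reach \<delta> (q, tape W K s w, int (s r)) (q', tape W K (s(r := v)) w, 0)"
proof -
  let ?t = "tape W K s w"
  let ?t1 = "?t(int (s r) := del W (Suc r) (?t (int (s r))))"
  have t1: "?t1 (int v) = ?t (int v)" using d(2) by simp
  have eq: "?t1(int v := ins W (Suc r) (?t (int v))) = tape W K (s(r := v)) w"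
    by (rule tape_move_pebble[where s = s and w = w and r = r and v = v, OF r w d(2)])
  have "tape W K s w (int v) \<in> symbols W K" by (rule tape_in_symbols[where w = w and v = v, OF w[rule_format]])
  then have \<delta>1: "\<delta> (q1, ?t1 (int v)) = Some (q2, ins W (Suc r) (?t (int v)), MoveL)"
    unfolding t1 by (rule step2)
  have "reach \<delta> (q1, ?t1, int v) (q', tape W K (s(r := v)) w, 0)"
  proof (rule reach_step[where t = ?t1 and h = "int v" and \<delta> = \<delta>, OF \<delta>1])
    show "reach \<delta> (q2, ?t1(int v := ins W (Suc r) (?t (int v))), shift MoveL (int v))
      (q', tape W K (s(r := v)) w, 0)"
      unfolding eq by (rule reach_ret_tape[where W = W, OF ret w]) simp
  qed
  then show ?thesis
    unfolding d(1)[symmetric] by (rule reach_step[where t = ?t and h = "int (s r)" and \<delta> = \<delta>, OF step1])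
qed

lemma implements_Inc:
  assumes r: "Suc r \<le> K"
  shows "\<exists>\<delta> n'. implements W K \<delta> n (Inc r) n'"
proof -
  let ?j = "Suc r"
  define fs where "fs = [gseek W K n ?j (\<lambda>x. (n + 1, del W ?j x, MoveR)),
     gact W K (\<lambda>x. (n + 2, ins W ?j x, MoveL)), gret W K (n + 2) (n + 3)]"
  define \<delta> where "\<delta> = tbl n fs"
  have \<delta>: "\<delta> (n, x) = gseek W K n ?j (\<lambda>x. (n + 1, del W ?j x, MoveR)) x"
     "\<delta> (n + 1, x) = gact W K (\<lambda>x. (n + 2, ins W ?j x, MoveL)) x"
     "\<delta> (n + 2, x) = gret W K (n + 2) (n + 3) x" for x
    by (simp_all add: \<delta>_def tbl_def fs_def)
  have "implements W K \<delta> n (Inc r) (n + 3)"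
  proof (rule implementsI)
    show "dom \<delta> \<subseteq> {n..<n + 3} \<times> all_symbols W K"
      unfolding \<delta>_def by (rule order_trans[OF dom_tbl[of fs W K n]]) (auto simp: fs_def)
    fix s w s' w' assume ex: "exec (Inc r) (s, w) (s', w')" and w: "\<forall>v. w v < W"
    have s': "s' = s(r := Suc (s r))" "w' = w" using ex by (auto elim: exec_IncE)
    have r1: "reach \<delta> (n, tape W K s w, 0) (n, tape W K s w, int (peb s ?j))"
      by (rule reach_seek[OF \<delta>(1) w r])
    have r2: "reach \<delta> (n, tape W K s w, int (peb s ?j)) (n + 3, tape W K s' w', 0)"
      unfolding s' peb.simps
    proof (rule reach_move_pebble[where w = w and s = s and r = r, OF r w _ _ \<delta>(3)])
      show "\<delta> (n, tape W K s w (int (s r))) = Some (n + 1, del W ?j (tape W K s w (int (s r))), MoveR)"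
        by (rule tape_cell[of w W K s "s r", OF w]) (use r in \<open>simp add: \<delta> gseek_def\<close>)
      show "\<delta> (n + 1, x) = Some (n + 2, ins W ?j x, MoveL)" if "x \<in> symbols W K" for x
        unfolding \<delta> gact_def using that by simp
      show "shift MoveR (int (s r)) = int (Suc (s r))" by simp
      show "Suc (s r) \<noteq> s r" by simp
    qed
    show "reach \<delta> (n, tape W K s w, 0) (n + 3, tape W K s' w', 0)"
      by (rule rtranclp_trans[OF r1 r2])
  qed simp
  then show ?thesis by blast
qed

lemma implements_Dec:
  assumes r: "Suc r \<le> K"
  shows "\<exists>\<delta> n'. implements W K \<delta> n (Dec r) n'"
proof -
  let ?j = "Suc r"
  \<comment> \<open>Pebble 0 in the same cell means that the register is 0; the pebble then stays,
    in accordance with \<open>0 - 1 = 0\<close>.\<close>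
  define f where "f x = (if 0 \<in> pebbles W x then (n + 2, x, MoveL) else (n + 1, del W ?j x, MoveL))" for x
  define fs where "fs = [gseek W K n ?j f,
     gact W K (\<lambda>x. (n + 2, ins W ?j x, MoveL)), gret W K (n + 2) (n + 3)]"
  define \<delta> where "\<delta> = tbl n fs"
  have \<delta>: "\<delta> (n, x) = gseek W K n ?j f x"
     "\<delta> (n + 1, x) = gact W K (\<lambda>x. (n + 2, ins W ?j x, MoveL)) x"
     "\<delta> (n + 2, x) = gret W K (n + 2) (n + 3) x" for x
    by (simp_all add: \<delta>_def tbl_def fs_def)
  have "implements W K \<delta> n (Dec r) (n + 3)"
  proof (rule implementsI)
    show "dom \<delta> \<subseteq> {n..<n + 3} \<times> all_symbols W K"
      unfolding \<delta>_def by (rule order_trans[OF dom_tbl[of fs W K n]]) (auto simp: fs_def)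
    fix s w s' w' assume ex: "exec (Dec r) (s, w) (s', w')" and w: "\<forall>v. w v < W"
    have s': "s' = s(r := s r - 1)" "w' = w" using ex by (auto elim: exec_DecE)
    have r1: "reach \<delta> (n, tape W K s w, 0) (n, tape W K s w, int (peb s ?j))"
      by (rule reach_seek[OF \<delta>(1) w r])
    have r2: "reach \<delta> (n, tape W K s w, int (peb s ?j)) (n + 3, tape W K s' w', 0)"
    proof (cases "s r = 0")
      case True
      then have eq: "s' = s" using s' by auto
      show ?thesis unfolding eq s'(2) peb.simps
      proof (rule reach_step[where t = "tape W K s w" and h = "int (s r)"])
        show "\<delta> (n, tape W K s w (int (s r))) = Some (n + 2, tape W K s w (int (s r)), MoveL)"
          by (rule tape_cell[of w W K s "s r", OF w]) (use r True in \<open>simp add: \<delta> gseek_def f_def\<close>)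
        show "reach \<delta> (n + 2, (tape W K s w)(int (s r) := tape W K s w (int (s r))), shift MoveL (int (s r)))
          (n + 3, tape W K s w, 0)"
          unfolding fun_upd_triv by (rule reach_ret_tape[OF \<delta>(3) w]) simp
      qed
    next
      case False
      show ?thesis
      unfolding s' peb.simps
      proof (rule reach_move_pebble[where w = w and s = s and r = r, OF r w _ _ \<delta>(3)])
        show "\<delta> (n, tape W K s w (int (s r))) = Some (n + 1, del W ?j (tape W K s w (int (s r))), MoveL)"
          by (rule tape_cell[of w W K s "s r", OF w]) (use r False in \<open>simp add: \<delta> gseek_def f_def\<close>)
        show "\<delta> (n + 1, x) = Some (n + 2, ins W ?j x, MoveL)" if "x \<in> symbols W K" for x
          unfolding \<delta> gact_def using that by simp
        show "shift MoveL (int (s r)) = int (s r - 1)" using False by (simp add: of_nat_diff)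
        show "s r - 1 \<noteq> s r" using False by simp
      qed
    qed
    show "reach \<delta> (n, tape W K s w, 0) (n + 3, tape W K s' w', 0)"
      by (rule rtranclp_trans[OF r1 r2])
  qed simp
  then show ?thesis by blast
qed

lemma implements_Put:
  assumes r: "Suc r \<le> K" and a: "a < W"
  shows "\<exists>\<delta> n'. implements W K \<delta> n (Put r a) n'"
proof -
  let ?j = "Suc r"
  define fs where "fs = [gseek W K n ?j (\<lambda>x. (n + 1, enc W a (pebbles W x), MoveL)), gret W K (n + 1) (n + 2)]"
  define \<delta> where "\<delta> = tbl n fs"
  have \<delta>: "\<delta> (n, x) = gseek W K n ?j (\<lambda>x. (n + 1, enc W a (pebbles W x), MoveL)) x"
     "\<delta> (n + 1, x) = gret W K (n + 1) (n + 2) x" for x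
    by (simp_all add: \<delta>_def tbl_def fs_def)
  have "implements W K \<delta> n (Put r a) (n + 2)"
  proof (rule implementsI)
    show "dom \<delta> \<subseteq> {n..<n + 2} \<times> all_symbols W K"
      unfolding \<delta>_def by (rule order_trans[OF dom_tbl[of fs W K n]]) (auto simp: fs_def)
    fix s w s' w' assume ex: "exec (Put r a) (s, w) (s', w')" and w: "\<forall>v. w v < W"
    have s': "s' = s" "w' = w(s r := a)" using ex by (auto elim: exec_PutE)
    have r1: "reach \<delta> (n, tape W K s w, 0) (n, tape W K s w, int (peb s ?j))"
      by (rule reach_seek[OF \<delta>(1) w r])
    have r2: "reach \<delta> (n, tape W K s w, int (peb s ?j)) (n + 2, tape W K s' w', 0)"
      unfolding s' peb.simps
    proof (rule reach_step[where t = "tape W K s w" and h = "int (s r)"])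
      show "\<delta> (n, tape W K s w (int (s r))) = Some (n + 1, enc W a (pebbles W (tape W K s w (int (s r)))), MoveL)"
        by (rule tape_cell[of w W K s "s r", OF w]) (use r in \<open>simp add: \<delta> gseek_def\<close>)
      show "reach \<delta> (n + 1, (tape W K s w)(int (s r) := enc W a (pebbles W (tape W K s w (int (s r))))),
          shift MoveL (int (s r))) (n + 2, tape W K s (w(s r := a)), 0)"
        unfolding tape_Put[OF w] by (rule reach_ret_tape[OF \<delta>(2)]) (use w a in auto)
    qed
    show "reach \<delta> (n, tape W K s w, 0) (n + 2, tape W K s' w', 0)"
      by (rule rtranclp_trans[OF r1 r2])
  qed simp
  then show ?thesis by blast
qed

lemma map_add_left: "g y = None \<Longrightarrow> (f ++ g) y = f y"
  by (simp add: map_add_def)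

text \<open>The state ranges are disjoint, so each table is a submap of the sum and its runs persist
  there. The condition on \<open>letters c1\<close> keeps the intermediate word within the
  alphabet.\<close>

lemma implements_Seq:
  assumes 1: "implements W K \<delta>1 n c1 m" and 2: "implements W K \<delta>2 m c2 n'"
    and let1: "letters c1 \<subseteq> {..<W}"
  shows "implements W K (\<delta>1 ++ \<delta>2) n (Seq c1 c2) n'"
proof (rule implementsI)
  show "n < n'" using 1 2 by (auto simp: implements_def)
  have "dom \<delta>1 \<subseteq> {n..<m} \<times> all_symbols W K" "dom \<delta>2 \<subseteq> {m..<n'} \<times> all_symbols W K"
    "n < m" "m < n'"
    using 1 2 by (auto simp: implements_def)
  then show "dom (\<delta>1 ++ \<delta>2) \<subseteq> {n..<n'} \<times> all_symbols W K"
    unfolding dom_map_add by fastforce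
  have "dom \<delta>1 \<inter> dom \<delta>2 = {}"
    using \<open>dom \<delta>1 \<subseteq> _\<close> \<open>dom \<delta>2 \<subseteq> _\<close> by fastforce
  then have le: "\<delta>1 \<subseteq>\<^sub>m \<delta>1 ++ \<delta>2" "\<delta>2 \<subseteq>\<^sub>m \<delta>1 ++ \<delta>2"
    using map_add_comm[of \<delta>1 \<delta>2] map_le_map_add[of \<delta>1 \<delta>2] map_le_map_add[of \<delta>2 \<delta>1] by auto
  fix s w s' w' assume ex: "exec (Seq c1 c2) (s, w) (s', w')" and w: "\<forall>v. w v < W"
  then obtain s1 w1 where c: "exec c1 (s, w) (s1, w1)" "exec c2 (s1, w1) (s', w')"
    by (auto elim: exec_SeqE)
  have w1: "\<forall>v. w1 v < W" using exec_letters[OF c(1) let1] w by auto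
  have r1: "reach (\<delta>1 ++ \<delta>2) (n, tape W K s w, 0) (m, tape W K s1 w1, 0)"
    by (rule reach_mono[OF le(1)]) (use 1 c w in \<open>auto simp: implements_def\<close>)
  have r2: "reach (\<delta>1 ++ \<delta>2) (m, tape W K s1 w1, 0) (n', tape W K s' w', 0)"
    by (rule reach_mono[OF le(2)]) (use 2 c w1 in \<open>auto simp: implements_def\<close>)
  show "reach (\<delta>1 ++ \<delta>2) (n, tape W K s w, 0) (n', tape W K s' w', 0)"
    by (rule rtranclp_trans[OF r1 r2])
qed

lemma implements_IfEq:
  assumes r: "Suc r \<le> K" and c: "implements W K \<delta>c (n + 3) c m"
  shows "\<exists>\<delta> n'. implements W K \<delta> n (IfEq r a c) n'"
proof -
  let ?j = "Suc r"
  define f where "f x = (if letter W x = a then (n + 1, x, MoveL) else (n + 2, x, MoveL))" for x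
  \<comment> \<open>One return state leads to the body at \<open>n + 3\<close>, the other directly
    to the exit \<open>m\<close> of the body.\<close>
  define fs where "fs = [gseek W K n ?j f, gret W K (n + 1) (n + 3), gret W K (n + 2) m]"
  define \<delta> where "\<delta> = tbl n fs ++ \<delta>c"
  have m: "n + 3 < m" using c by (simp add: implements_def)
  have \<delta>: "\<delta> (n, x) = gseek W K n ?j f x"
     "\<delta> (n + 1, x) = gret W K (n + 1) (n + 3) x"
     "\<delta> (n + 2, x) = gret W K (n + 2) m x" for x
    unfolding \<delta>_def using implements_dom[OF c]
    by (subst map_add_left; simp add: tbl_def fs_def)+
  have "implements W K \<delta> n (IfEq r a c) m"
  proof (rule implementsI)
    have "dom (tbl n fs) \<subseteq> {n..<n + 3} \<times> all_symbols W K"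
      by (rule order_trans[OF dom_tbl[of fs W K n]]) (auto simp: fs_def)
    moreover have "dom \<delta>c \<subseteq> {n + 3..<m} \<times> all_symbols W K"
      using c by (simp add: implements_def)
    ultimately show "dom \<delta> \<subseteq> {n..<m} \<times> all_symbols W K"
      unfolding \<delta>_def dom_map_add using m by fastforce
    fix s w s' w' assume ex: "exec (IfEq r a c) (s, w) (s', w')" and w: "\<forall>v. w v < W"
    have r1: "reach \<delta> (n, tape W K s w, 0) (n, tape W K s w, int (peb s ?j))"
      by (rule reach_seek[OF \<delta>(1) w r])
    have r2: "reach \<delta> (n, tape W K s w, int (peb s ?j)) (m, tape W K s' w', 0)"
      unfolding peb.simps
    proof (cases "w (s r) = a")
      case True
      then have exc: "exec c (s, w) (s', w')" using ex by (auto elim: exec_IfE)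
      have r1: "reach \<delta> (n, tape W K s w, int (s r)) (n + 3, tape W K s w, 0)"
      proof (rule reach_step[where t = "tape W K s w" and h = "int (s r)"])
        show "\<delta> (n, tape W K s w (int (s r))) = Some (n + 1, tape W K s w (int (s r)), MoveL)"
          by (rule tape_cell[of w W K s "s r", OF w]) (use r True in \<open>simp add: \<delta> gseek_def f_def\<close>)
        show "reach \<delta> (n + 1, (tape W K s w)(int (s r) := tape W K s w (int (s r))), shift MoveL (int (s r)))
          (n + 3, tape W K s w, 0)"
          unfolding fun_upd_triv by (rule reach_ret_tape[OF \<delta>(2) w]) simp
      qed
      have r2: "reach \<delta> (n + 3, tape W K s w, 0) (m, tape W K s' w', 0)"
        by (rule reach_mono[of \<delta>c]) (use c w exc in \<open>auto simp: implements_def \<delta>_def map_le_map_add\<close>)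
      show "reach \<delta> (n, tape W K s w, int (s r)) (m, tape W K s' w', 0)"
        by (rule rtranclp_trans[OF r1 r2])
    next
      case False
      then have eq: "s' = s" "w' = w" using ex by (auto elim: exec_IfE)
      show "reach \<delta> (n, tape W K s w, int (s r)) (m, tape W K s' w', 0)"
        unfolding eq
      proof (rule reach_step[where t = "tape W K s w" and h = "int (s r)"])
        show "\<delta> (n, tape W K s w (int (s r))) = Some (n + 2, tape W K s w (int (s r)), MoveL)"
          by (rule tape_cell[of w W K s "s r", OF w]) (use r False in \<open>simp add: \<delta> gseek_def f_def\<close>)
        show "reach \<delta> (n + 2, (tape W K s w)(int (s r) := tape W K s w (int (s r))), shift MoveL (int (s r)))
          (m, tape W K s w, 0)"
          unfolding fun_upd_triv by (rule reach_ret_tape[OF \<delta>(3) w]) simp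
      qed
    qed
    show "reach \<delta> (n, tape W K s w, 0) (m, tape W K s' w', 0)"
      by (rule rtranclp_trans[OF r1 r2])
  qed (use m in simp)
  then show ?thesis by blast
qed

lemma exec_While_induct [consumes 1, case_names stop step]:
  assumes "exec (While r c) (s, w) (s', w')"
    and "\<And>s w. s r = 0 \<Longrightarrow> P s w s w"
    and "\<And>s w s1 w1 s' w'. s r \<noteq> 0 \<Longrightarrow> exec c (s, w) (s1, w1) \<Longrightarrow> exec (While r c) (s1, w1) (s', w') \<Longrightarrow>
       P s1 w1 s' w' \<Longrightarrow> P s w s' w'"
  shows "P s w s' w'"
  using assms(1)
proof (induction "While r c" "(s, w)" "(s', w')" arbitrary: s w rule: exec.induct)
  case (WhileT s w st)
  then show ?case by (metis assms(3) surj_pair)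
qed (use assms(2) in auto)

lemma implements_While:
  assumes r: "Suc r \<le> K" and c: "implements W K \<delta>c (n + 3) c m" and let': "letters c \<subseteq> {..<W}"
  shows "\<exists>\<delta> n'. implements W K \<delta> n (While r c) n'"
proof -
  let ?j = "Suc r"
  \<comment> \<open>The register is 0 exactly if its pebble lies on cell 0. The search is for pebble
    0, so the test takes place on that cell.\<close>
  define f where "f x = (if ?j \<in> pebbles W x then (n + 2, x, MoveL) else (n + 1, x, MoveL))" for x
  define fs where "fs = [gseek W K n 0 f, gret W K (n + 1) (n + 3), gret W K (n + 2) (m + 1)]"
  \<comment> \<open>The exit state \<open>m\<close> of the body is turned into the jump back to the
    test, so the loop as a whole is left through \<open>m + 1\<close>.\<close>
  define \<delta> where "\<delta> = (tbl n fs ++ tbl m [gret W K m n]) ++ \<delta>c"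
  have m: "n + 3 < m" using c by (simp add: implements_def)
  have \<delta>: "\<delta> (n, x) = gseek W K n 0 f x"
     "\<delta> (n + 1, x) = gret W K (n + 1) (n + 3) x"
     "\<delta> (n + 2, x) = gret W K (n + 2) (m + 1) x"
     "\<delta> (m, x) = gret W K m n x" for x
    unfolding \<delta>_def using implements_dom[OF c] m
    by (subst map_add_left; simp add: tbl_apply fs_def map_add_def split: option.split)+
  have "implements W K \<delta> n (While r c) (m + 1)"
  proof (rule implementsI)
    have "dom (tbl n fs) \<subseteq> {n..<n + 3} \<times> all_symbols W K"
      by (rule order_trans[OF dom_tbl[of fs W K n]]) (auto simp: fs_def)
    moreover have "dom (tbl m [gret W K m n]) \<subseteq> {m..<m + 1} \<times> all_symbols W K"
      by (rule order_trans[OF dom_tbl[of _ W K m]]) auto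
    moreover have "dom \<delta>c \<subseteq> {n + 3..<m} \<times> all_symbols W K"
      using c by (simp add: implements_def)
    ultimately show "dom \<delta> \<subseteq> {n..<m + 1} \<times> all_symbols W K"
      unfolding \<delta>_def dom_map_add using m by fastforce
    fix s w s' w' assume ex: "exec (While r c) (s, w) (s', w')" and w: "\<forall>v. w v < W"
    have tape0: "tape W K s w 0 \<in> symbols W K" "0 \<in> pebbles W (tape W K s w 0)"
      "Suc r \<in> pebbles W (tape W K s w 0) \<longleftrightarrow> s r = 0" if "\<forall>v. w v < W" for s w
      using that r tape_in_symbols[of w 0 W K s] pebbles_tape[of w 0 W _ K s] by auto
    from ex w show "reach \<delta> (n, tape W K s w, 0) (m + 1, tape W K s' w', 0)"
    proof (induction rule: exec_While_induct)
      case (stop s w)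
      show ?case
      proof (rule reach_step[where t = "tape W K s w" and h = 0])
        show "\<delta> (n, tape W K s w 0) = Some (n + 2, tape W K s w 0, MoveL)"
          unfolding \<delta> gseek_def f_def using stop tape0[of w s] by simp
        show "reach \<delta> (n + 2, (tape W K s w)(0 := tape W K s w 0), shift MoveL 0) (m + 1, tape W K s w, 0)"
          unfolding fun_upd_triv by (rule reach_ret_tape[OF \<delta>(3) stop(2)]) simp
      qed
    next
      case (step s w s1 w1 s' w')
      have w1: "\<forall>v. w1 v < W" using exec_letters[OF step(2) let'] step.prems by auto
      have r1: "reach \<delta> (n, tape W K s w, 0) (n + 3, tape W K s w, 0)"
      proof (rule reach_step[where t = "tape W K s w" and h = 0])
        show "\<delta> (n, tape W K s w 0) = Some (n + 1, tape W K s w 0, MoveL)"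
          unfolding \<delta> gseek_def f_def using step.hyps step.prems tape0[of w s] by simp
        show "reach \<delta> (n + 1, (tape W K s w)(0 := tape W K s w 0), shift MoveL 0) (n + 3, tape W K s w, 0)"
          unfolding fun_upd_triv by (rule reach_ret_tape[OF \<delta>(2) step.prems]) simp
      qed
      have r2: "reach \<delta> (n + 3, tape W K s w, 0) (m, tape W K s1 w1, 0)"
        by (rule reach_mono[of \<delta>c]) (use c step in \<open>auto simp: implements_def \<delta>_def map_le_map_add\<close>)
      have r3: "reach \<delta> (m, tape W K s1 w1, 0) (n, tape W K s1 w1, 0)"
        by (rule reach_ret_tape[OF \<delta>(4) w1]) simp
      have r4: "reach \<delta> (n, tape W K s1 w1, 0) (m + 1, tape W K s' w', 0)"
        by (rule step.IH[OF w1])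
      show ?case
        by (rule rtranclp_trans[OF rtranclp_trans[OF rtranclp_trans[OF r1 r2] r3] r4])
    qed
  qed (use m in simp)
  then show ?thesis by blast
qed

theorem compile:
  assumes "Suc ` regs c \<subseteq> {..K}" "letters c \<subseteq> {..<W}"
  shows "\<exists>\<delta> n'. implements W K \<delta> n c n'"
  using assms
proof (induction c arbitrary: n)
  case (Seq c1 c2)
  have "Suc ` regs c1 \<subseteq> {..K}" "Suc ` regs c2 \<subseteq> {..K}" "letters c1 \<subseteq> {..<W}" "letters c2 \<subseteq> {..<W}"
    using Seq.prems by (auto simp: image_Un)
  then obtain \<delta>1 m where 1: "implements W K \<delta>1 n c1 m"
    using Seq.IH(1)[of n] by blast
  obtain \<delta>2 n' where "implements W K \<delta>2 m c2 n'"
    using Seq.IH(2)[of m] \<open>Suc ` regs c2 \<subseteq> {..K}\<close> \<open>letters c2 \<subseteq> {..<W}\<close> by blast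
  with 1 Seq.prems show ?case by (auto intro: implements_Seq)
next
  case (IfEq r a c)
  then have "Suc ` regs c \<subseteq> {..K}" "letters c \<subseteq> {..<W}" by auto
  then obtain \<delta>c m where "implements W K \<delta>c (n + 3) c m"
    using IfEq.IH[of "n + 3"] by blast
  with IfEq.prems show ?case by (auto intro: implements_IfEq)
next
  case (While r c)
  then have "Suc ` regs c \<subseteq> {..K}" "letters c \<subseteq> {..<W}" by auto
  then obtain \<delta>c m where "implements W K \<delta>c (n + 3) c m"
    using While.IH[of "n + 3"] by blast
  with While.prems show ?case by (auto intro: implements_While)
qed (auto intro: implements_Inc implements_Dec implements_Put)

section \<open>Programs with binary input and word output\<close>

text \<open>The initial 1 acts as a leading digit and keeps leading zeros significant: strings
  correspond to positive numbers, and a number \<open>v\<close> costs at most \<open>log v\<close>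
  bits.\<close>

definition bval :: "bool list \<Rightarrow> nat" where
  "bval p = foldl (\<lambda>v b. 2 * v + of_bool b) 1 p"

lemma bval_surj:
  assumes "v \<ge> 1"
  shows "\<exists>p. bval p = v \<and> 2 ^ length p \<le> v"
  using assms
proof (induction v rule: less_induct)
  case (less v)
  show ?case
  proof (cases "v = 1")
    case True
    then show ?thesis by (intro exI[of _ "[]"]) (simp add: bval_def)
  next
    case False
    with less.prems have "v div 2 < v" "v div 2 \<ge> 1" by auto
    then obtain p where p: "bval p = v div 2" "2 ^ length p \<le> v div 2"
      using less.IH by blast
    have "bval (p @ [odd v]) = v"
      using p(1) by (simp add: bval_def)
    moreover have "2 ^ length (p @ [odd v]) \<le> v"
      using p(2) by simp
    ultimately show ?thesis by blast
  qed
qed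

lemma rec_assign:
  assumes "rec l f" "length as = l" "\<forall>a\<in>set as. a < d" "x < d"
  shows "\<exists>c. \<forall>s w. \<exists>s'. exec c (s, w) (s', w) \<and> s' x = f (map s as) \<and> (\<forall>i<d. i \<noteq> x \<longrightarrow> s' i = s i)"
proof -
  obtain c where c: "\<And>s w. \<exists>s'. exec c (s, w) (s', w) \<and> s' d = f (map s as) \<and> (\<forall>i<d. s' i = s i)"
    using recD[OF assms(1-3)] by blast
  have "\<exists>s'. exec (Seq c (copy d x (Suc d))) (s, w) (s', w) \<and> s' x = f (map s as)
      \<and> (\<forall>i<d. i \<noteq> x \<longrightarrow> s' i = s i)" for s w
  proof -
    obtain s1 where s1: "exec c (s, w) (s1, w)" "s1 d = f (map s as)" "\<forall>i<d. s1 i = s i"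
      using c by blast
    have "exec (copy d x (Suc d)) (s1, w) (s1(x := s1 d, Suc d := 0), w)"
      using assms(4) by (intro exec_copy) auto
    with s1 assms(4) show ?thesis
      by (intro exI[of _ "s1(x := s1 d, Suc d := 0)"]) (auto intro: exec.Seq)
  qed
  then show ?thesis by blast
qed

text \<open>Register 0 is the reading position, register 1 a flag, register 2 the value read so far.
  The body lowers the flag, and only a letter raises it again, so it remains 0 on the blank. The
  position advances last, so both tests see the same cell.\<close>

lemma ex_read_body:
  obtains body where
    "\<And>s w b. w (s 0) = Suc (of_bool b) \<Longrightarrow> s 1 = Suc 0 \<Longrightarrow>
       \<exists>s'. exec body (s, w) (s', w) \<and> s' 0 = Suc (s 0) \<and> s' 1 = Suc 0 \<and> s' 2 = 2 * s 2 + of_bool b"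
    "\<And>s w. w (s 0) = 0 \<Longrightarrow> s 1 = Suc 0 \<Longrightarrow> \<exists>s'. exec body (s, w) (s', w) \<and> s' 1 = 0 \<and> s' 2 = s 2"
proof -
  have "\<exists>c. \<forall>s w. \<exists>s'. exec c (s, w) (s', w) \<and> s' 2 = 2 * s 2 + of_bool b \<and> (\<forall>i<3. i \<noteq> 2 \<longrightarrow> s' i = s i)" for b
    using rec_assign[of 1 "\<lambda>e. 2 * (e ! 0) + of_bool b" "[2]" 3 2]
      rec_add[OF rec_mult[OF rec_const rec_var] rec_const, of 0 1 2 "of_bool b"] by simp
  then obtain c where c: "\<And>b s w. \<exists>s'. exec (c b) (s, w) (s', w) \<and> s' 2 = 2 * s 2 + of_bool b
      \<and> (\<forall>i<3. i \<noteq> 2 \<longrightarrow> s' i = s i)"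
    using choice[of "\<lambda>b c. \<forall>s w. \<exists>s'. exec c (s, w) (s', w) \<and> s' 2 = 2 * s 2 + of_bool b
      \<and> (\<forall>i<3. i \<noteq> 2 \<longrightarrow> s' i = s i)"] by blast
  let ?if = "\<lambda>b. IfEq 0 (Suc (of_bool b)) (Seq (c b) (Inc 1))"
  let ?body = "Seq (Dec 1) (Seq (?if False) (Seq (?if True) (Inc 0)))"
  have if_True: "\<exists>s'. exec (?if b) (s, w) (s', w) \<and> s' 0 = s 0 \<and> s' 1 = Suc (s 1) \<and> s' 2 = 2 * s 2 + of_bool b"
    if w: "w (s 0) = Suc (of_bool b)" for s w b
  proof -
    obtain s' where "exec (c b) (s, w) (s', w)" "s' 2 = 2 * s 2 + of_bool b" "s' 0 = s 0" "s' 1 = s 1"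
      using c[of b s w] by auto
    with w show ?thesis
      by (intro exI[of _ "s'(1 := Suc (s' 1))"]) (auto intro!: exec.IfT exec.Seq exec_Inc)
  qed
  have if_False: "exec (?if b) (s, w) (s, w)" if w: "w (s 0) \<noteq> Suc (of_bool b)" for s w b
    using w by (rule exec.IfF)
  show ?thesis
  proof (rule that[of ?body])
    fix s w :: "nat \<Rightarrow> nat" and b
    assume w: "w (s 0) = Suc (of_bool b)" and s1: "s 1 = Suc 0"
    let ?s = "s(1 := s 1 - 1)"
    obtain s' where s': "exec (?if b) (?s, w) (s', w)" "s' 0 = s 0" "s' 1 = Suc (?s 1)" "s' 2 = 2 * s 2 + of_bool b"
      using if_True[of w ?s b] w by auto
    have "exec (Seq (?if False) (?if True)) (?s, w) (s', w)"
    proof (cases b)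
      case True
      then have "exec (?if False) (?s, w) (?s, w)" using w by (intro if_False) simp
      moreover have "exec (?if True) (?s, w) (s', w)" using s'(1) True by simp
      ultimately show ?thesis by (rule exec.Seq)
    next
      case False
      then have "exec (?if True) (s', w) (s', w)" using w s'(2) by (intro if_False) simp
      have "exec (?if False) (?s, w) (s', w)" using s'(1) False by simp
      then show ?thesis using \<open>exec (?if True) (s', w) (s', w)\<close> by (rule exec.Seq)
    qed
    then obtain st where "exec (?if False) (?s, w) st" "exec (?if True) st (s', w)"
      by (cases rule: exec.cases) auto
    then have "exec ?body (s, w) (s'(0 := Suc (s' 0)), w)"
      by (intro exec.Seq[OF exec.Dec] exec.Seq[OF _ exec.Seq[OF _ exec.Inc]])
    with s' s1 show "\<exists>s'. exec ?body (s, w) (s', w) \<and> s' 0 = Suc (s 0) \<and> s' 1 = Suc 0 \<and> s' 2 = 2 * s 2 + of_bool b"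
      by (intro exI[of _ "s'(0 := Suc (s' 0))"]) auto
  next
    fix s w :: "nat \<Rightarrow> nat"
    assume w: "w (s 0) = 0" and s1: "s 1 = Suc 0"
    let ?s = "s(1 := s 1 - 1)"
    have "exec (?if b) (?s, w) (?s, w)" for b using w by (intro if_False) simp
    then have "exec ?body (s, w) (?s(0 := Suc (?s 0)), w)"
      by (intro exec.Seq[OF exec.Dec] exec.Seq[OF _ exec.Seq[OF _ exec.Inc]])
    with s1 show "\<exists>s'. exec ?body (s, w) (s', w) \<and> s' 1 = 0 \<and> s' 2 = s 2"
      by (intro exI[of _ "?s(0 := Suc (?s 0))"]) auto
  qed
qed

lemma ex_read:
  obtains c where
    "\<And>s w qs. s 1 = Suc 0 \<Longrightarrow> (\<And>j. j < length qs \<Longrightarrow> w (s 0 + j) = Suc (of_bool (qs ! j))) \<Longrightarrow>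
       w (s 0 + length qs) = 0 \<Longrightarrow>
       \<exists>s'. exec c (s, w) (s', w) \<and> s' 2 = foldl (\<lambda>v b. 2 * v + of_bool b) (s 2) qs"
proof -
  obtain body where body:
    "\<And>s w b. w (s 0) = Suc (of_bool b) \<Longrightarrow> s 1 = Suc 0 \<Longrightarrow>
       \<exists>s'. exec body (s, w) (s', w) \<and> s' 0 = Suc (s 0) \<and> s' 1 = Suc 0 \<and> s' 2 = 2 * s 2 + of_bool b"
    "\<And>s w. w (s 0) = 0 \<Longrightarrow> s 1 = Suc 0 \<Longrightarrow> \<exists>s'. exec body (s, w) (s', w) \<and> s' 1 = 0 \<and> s' 2 = s 2"
    by (rule ex_read_body) blast
  show ?thesis
  proof (rule that[of "While 1 body"])
    fix s w qs
    show "s 1 = Suc 0 \<Longrightarrow> (\<And>j. j < length qs \<Longrightarrow> w (s 0 + j) = Suc (of_bool (qs ! j))) \<Longrightarrow>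
       w (s 0 + length qs) = 0 \<Longrightarrow>
       \<exists>s'. exec (While 1 body) (s, w) (s', w) \<and> s' 2 = foldl (\<lambda>v b. 2 * v + of_bool b) (s 2) qs"
    proof (induction qs arbitrary: s)
      case Nil
      then obtain s' where s': "exec body (s, w) (s', w)" "s' 1 = 0" "s' 2 = s 2" using body(2)[of w s] by auto
      then have "exec (While 1 body) (s, w) (s', w)"
        using Nil(1) by (intro exec.WhileT[OF _ s'(1)] exec.WhileF) auto
      with s' show ?case by auto
    next
      case (Cons b qs)
      have "w (s 0) = Suc (of_bool b)" using Cons.prems(2)[of 0] by simp
      then obtain s1 where s1: "exec body (s, w) (s1, w)" "s1 0 = Suc (s 0)" "s1 1 = Suc 0" "s1 2 = 2 * s 2 + of_bool b"
        using body(1)[of w s b] Cons.prems(1) by auto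
      have "w (s1 0 + j) = Suc (of_bool (qs ! j))" if "j < length qs" for j
        using Cons.prems(2)[of "Suc j"] that s1(2) by simp
      moreover have "w (s1 0 + length qs) = 0"
        using Cons.prems(3) s1(2) by simp
      ultimately obtain s' where s': "exec (While 1 body) (s1, w) (s', w)"
        "s' 2 = foldl (\<lambda>v b. 2 * v + of_bool b) (s1 2) qs"
        using Cons.IH[of s1] s1(3) by auto
      then have "exec (While 1 body) (s, w) (s', w)"
        using Cons.prems(1) s1(1) by (intro exec.WhileT[OF _ s1(1)]) auto
      with s' s1 show ?case by auto
    qed
  qed
qed

text \<open>\<open>Put\<close> writes constant letters only; writing the content of a register takes
  a cascade over the letters below \<open>k\<close>.\<close>

lemma ex_emit:
  "\<exists>c. \<forall>s w. \<exists>s'. exec c (s, w) (s', if s 3 < k then w(s 0 := Suc (s 3)) else w) \<and> (\<forall>i<4. s' i = s i)"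
proof (induction k)
  case 0
  show ?case
  proof (intro exI[of _ "zero 4"] allI)
    fix s w :: "nat \<Rightarrow> nat"
    show "\<exists>s'. exec (zero 4) (s, w) (s', if s 3 < 0 then w(s 0 := Suc (s 3)) else w) \<and> (\<forall>i<4. s' i = s i)"
      by (rule exI[of _ "s(4 := 0)"]) (use exec_zero[of 4 s w] in simp)
  qed
next
  case (Suc k)
  then obtain c where c: "\<And>s w. \<exists>s'. exec c (s, w) (s', if s 3 < k then w(s 0 := Suc (s 3)) else w) \<and> (\<forall>i<4. s' i = s i)"
    by blast
  have "rec 1 (\<lambda>e. of_bool (e ! 0 = k))"
    by (intro rec_of_bool recp_eq rec_const rec_var) simp
  then obtain f where f: "\<And>s w. \<exists>s'. exec f (s, w) (s', w) \<and> s' 4 = of_bool (s 3 = k) \<and> (\<forall>i<4. s' i = s i)"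
    using recD[of 1 "\<lambda>e. of_bool (e ! 0 = k)" "[3]" 4] by auto
  \<comment> \<open>Register 4 is 0 or 1 and the body lowers it, so this loop is a
    conditional.\<close>
  let ?p = "While 4 (Seq (Put 0 (Suc k)) (Dec 4))"
  show ?case
  proof (intro exI[of _ "Seq c (Seq f ?p)"] allI)
    fix s w
    obtain s1 w1 where s1: "exec c (s, w) (s1, w1)" "w1 = (if s 3 < k then w(s 0 := Suc (s 3)) else w)" "\<forall>i<4. s1 i = s i"
      using c by blast
    obtain s2 where s2: "exec f (s1, w1) (s2, w1)" "s2 4 = of_bool (s1 3 = k)" "\<forall>i<4. s2 i = s1 i"
      using f by blast
    have eq: "s2 i = s i" if "i < 4" for i using that s1(3) s2(3) by simp
    have "exec ?p (s2, w1) (s2(4 := 0), if s 3 < Suc k then w(s 0 := Suc (s 3)) else w)"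
    proof (cases "s 3 = k")
      case True
      then have "s2 4 = Suc 0" using s2(2) s1(3) by simp
      have "exec ?p (s2, w1) (s2(4 := 0), w1(s2 0 := Suc k))"
      proof (rule exec.WhileT)
        show "exec (Seq (Put 0 (Suc k)) (Dec 4)) (s2, w1) (s2(4 := 0), w1(s2 0 := Suc k))"
          using \<open>s2 4 = Suc 0\<close> by (intro exec.Seq[OF exec.Put] exec_Dec) auto
      qed (use \<open>s2 4 = Suc 0\<close> in \<open>auto intro: exec.WhileF\<close>)
      with True s1(2) eq[of 0] show ?thesis by simp
    next
      case False
      then have "s2 4 = 0" using s2(2) s1(3) by simp
      then have "s2(4 := 0) = s2" "w1 = (if s 3 < Suc k then w(s 0 := Suc (s 3)) else w)"
        using s1(2) False by (auto simp: less_Suc_eq)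
      moreover have "exec ?p (s2, w1) (s2, w1)" using \<open>s2 4 = 0\<close> by (rule exec.WhileF)
      ultimately show ?thesis by simp
    qed
    with s1(1) s2(1) have "exec (Seq c (Seq f ?p)) (s, w) (s2(4 := 0), if s 3 < Suc k then w(s 0 := Suc (s 3)) else w)"
      by (blast intro: exec.Seq)
    with eq show "\<exists>s'. exec (Seq c (Seq f ?p)) (s, w) (s', if s 3 < Suc k then w(s 0 := Suc (s 3)) else w) \<and> (\<forall>i<4. s' i = s i)"
      by (intro exI[of _ "s2(4 := 0)"]) auto
  qed
qed

lemma ex_write:
  assumes "rec 2 (\<lambda>e. G (e ! 0) (e ! 1))"
  obtains c where
    "\<And>s w. (\<And>j. s 0 \<le> j \<Longrightarrow> j < s 0 + s 1 \<Longrightarrow> G (s 2) j < k) \<Longrightarrow>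
      \<exists>s' w'. exec c (s, w) (s', w') \<and> s' 0 = s 0 + s 1 \<and> (\<forall>j<s 0. w' j = w j) \<and>
        (\<forall>j. s 0 \<le> j \<longrightarrow> j < s 0 + s 1 \<longrightarrow> w' j = Suc (G (s 2) j))"
proof -
  obtain e where e: "\<And>s w. \<exists>s'. exec e (s, w) (s', if s 3 < k then w(s 0 := Suc (s 3)) else w) \<and> (\<forall>i<4. s' i = s i)"
    using ex_emit by blast
  obtain g where g: "\<And>s w. \<exists>s'. exec g (s, w) (s', w) \<and> s' 3 = G (s 2) (s 0) \<and> (\<forall>i<3. s' i = s i)"
    using recD[OF assms, of "[2, 0]" 3] by auto
  let ?body = "Seq g (Seq e (Seq (Inc 0) (Dec 1)))"
  have body: "\<exists>s'. exec ?body (s, w) (s', w(s 0 := Suc (G (s 2) (s 0)))) \<and> s' 0 = Suc (s 0) \<and> s' 1 = s 1 - 1 \<and> s' 2 = s 2"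
    if k: "G (s 2) (s 0) < k" for s w
  proof -
    obtain s1 where s1: "exec g (s, w) (s1, w)" "s1 3 = G (s 2) (s 0)" "\<forall>i<3. s1 i = s i"
      using g by blast
    have "(if s1 3 < k then w(s1 0 := Suc (s1 3)) else w) = w(s 0 := Suc (G (s 2) (s 0)))"
      using s1 k by simp
    then obtain s2 where s2: "exec e (s1, w) (s2, w(s 0 := Suc (G (s 2) (s 0))))" "\<forall>i<4. s2 i = s1 i"
      using e[of s1 w] by auto
    let ?s = "s2(0 := Suc (s2 0))"
    have "exec ?body (s, w) (?s(1 := ?s 1 - 1), w(s 0 := Suc (G (s 2) (s 0))))"
      by (rule exec.Seq[OF s1(1) exec.Seq[OF s2(1) exec.Seq[OF exec.Inc exec.Dec]]])
    with s1 s2 show ?thesis by (intro exI[of _ "?s(1 := ?s 1 - 1)"]) auto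
  qed
  show ?thesis
  proof (rule that[of "While 1 ?body"])
    fix s w
    show "(\<And>j. s 0 \<le> j \<Longrightarrow> j < s 0 + s 1 \<Longrightarrow> G (s 2) j < k) \<Longrightarrow>
      \<exists>s' w'. exec (While 1 ?body) (s, w) (s', w') \<and> s' 0 = s 0 + s 1 \<and> (\<forall>j<s 0. w' j = w j) \<and>
        (\<forall>j. s 0 \<le> j \<longrightarrow> j < s 0 + s 1 \<longrightarrow> w' j = Suc (G (s 2) j))"
    proof (induction "s 1" arbitrary: s w)
      case 0
      then show ?case by (intro exI[of _ s] exI[of _ w]) (auto intro: exec.WhileF)
    next
      case (Suc m)
      have "G (s 2) (s 0) < k" using Suc.prems[of "s 0"] Suc.hyps(2) by simp
      then obtain s1 where s1: "exec ?body (s, w) (s1, w(s 0 := Suc (G (s 2) (s 0))))" "s1 0 = Suc (s 0)"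
        "s1 1 = s 1 - 1" "s1 2 = s 2"
        using body by blast
      have m: "m = s1 1" using s1(3) Suc.hyps(2) by simp
      have "G (s1 2) j < k" if "s1 0 \<le> j" "j < s1 0 + s1 1" for j
        using that s1 Suc.hyps(2) Suc.prems[of j] by simp
      from Suc.hyps(1)[of s1 "w(s 0 := Suc (G (s 2) (s 0)))", OF m this] obtain s' w' where
        s': "exec (While 1 ?body) (s1, w(s 0 := Suc (G (s 2) (s 0)))) (s', w')" "s' 0 = s1 0 + s1 1"
        "\<forall>j<s1 0. w' j = (w(s 0 := Suc (G (s 2) (s 0)))) j"
        "\<forall>j. s1 0 \<le> j \<longrightarrow> j < s1 0 + s1 1 \<longrightarrow> w' j = Suc (G (s1 2) j)"
        by blast
      have "s 1 \<noteq> 0" using Suc.hyps(2) by simp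
      from exec.WhileT[OF this s1(1) s'(1)] have "exec (While 1 ?body) (s, w) (s', w')" .
      moreover have "w' j = Suc (G (s 2) j)" if j: "s 0 \<le> j" "j < s 0 + s 1" for j
      proof (cases "j = s 0")
        case True
        then show ?thesis using s'(3) s1(2) by simp
      next
        case False
        then show ?thesis using s'(4) s1 j m Suc.hyps(2) by simp
      qed
      ultimately show ?case
        using s' s1 m Suc.hyps(2) by (intro exI[of _ s'] exI[of _ w']) auto
    qed
  qed
qed

lemma ex_program:
  assumes "rec 1 (\<lambda>e. Nf (e ! 0))" "rec 2 (\<lambda>e. G (e ! 0) (e ! 1))"
  obtains c where
    "\<And>p w. (\<And>j. j < length p \<Longrightarrow> w j = Suc (of_bool (p ! j))) \<Longrightarrow> w (length p) = 0 \<Longrightarrow>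
      (\<And>j. j < Nf (bval p) \<Longrightarrow> G (bval p) j < k) \<Longrightarrow>
      \<exists>s' w'. exec c (\<lambda>_. 0, w) (s', w') \<and> w' (Nf (bval p)) = 0 \<and>
        (\<forall>j<Nf (bval p). w' j = Suc (G (bval p) j))"
proof -
  obtain c1 where c1:
    "\<And>s w qs. s 1 = Suc 0 \<Longrightarrow> (\<And>j. j < length qs \<Longrightarrow> w (s 0 + j) = Suc (of_bool (qs ! j))) \<Longrightarrow>
       w (s 0 + length qs) = 0 \<Longrightarrow>
       \<exists>s'. exec c1 (s, w) (s', w) \<and> s' 2 = foldl (\<lambda>v b. 2 * v + of_bool b) (s 2) qs"
    by (rule ex_read) blast
  obtain c2 where c2: "\<And>s w. \<exists>s'. exec c2 (s, w) (s', w) \<and> s' 1 = Nf (s 2) \<and> (\<forall>i<3. i \<noteq> 1 \<longrightarrow> s' i = s i)"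
    using rec_assign[OF assms(1), of "[2]" 3 1] by auto
  obtain c3 where c3:
    "\<And>s w. (\<And>j. s 0 \<le> j \<Longrightarrow> j < s 0 + s 1 \<Longrightarrow> G (s 2) j < k) \<Longrightarrow>
      \<exists>s' w'. exec c3 (s, w) (s', w') \<and> s' 0 = s 0 + s 1 \<and> (\<forall>j<s 0. w' j = w j) \<and>
        (\<forall>j. s 0 \<le> j \<longrightarrow> j < s 0 + s 1 \<longrightarrow> w' j = Suc (G (s 2) j))"
    by (rule ex_write[OF assms(2)]) blast
  \<comment> \<open>The increments raise the reading flag and supply the initial 1 of
    \<open>bval\<close>. After reading, register 1 becomes the counter of letters to be written. The
    last \<open>Put\<close> writes a blank behind the output, which may be shorter than the input
    that it overwrites.\<close>
  let ?c = "Seq (Inc 1) (Seq (Inc 2) (Seq c1 (Seq c2 (Seq (zero 0) (Seq c3 (Put 0 0))))))"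
  show ?thesis
  proof (rule that[of ?c])
    fix p w
    assume w: "\<And>j. j < length p \<Longrightarrow> w j = Suc (of_bool (p ! j))" "w (length p) = 0"
      and k: "\<And>j. j < Nf (bval p) \<Longrightarrow> G (bval p) j < k"
    let ?sa = "(\<lambda>_. 0) :: nat \<Rightarrow> nat"
    let ?sb = "?sa(1 := Suc (?sa 1))"
    let ?sc = "?sb(2 := Suc (?sb 2))"
    have "\<exists>s'. exec c1 (?sc, w) (s', w) \<and> s' 2 = foldl (\<lambda>v b. 2 * v + of_bool b) (?sc 2) p"
      by (rule c1) (use w in auto)
    then obtain s2 where s2: "exec c1 (?sc, w) (s2, w)" "s2 2 = bval p"
      by (auto simp: bval_def)
    obtain s3 where s3: "exec c2 (s2, w) (s3, w)" "s3 1 = Nf (s2 2)" "s3 2 = s2 2"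
      using c2[of s2 w] by auto
    let ?s4 = "s3(0 := 0)"
    have s4: "?s4 0 = 0" "?s4 1 = Nf (bval p)" "?s4 2 = bval p" using s2 s3 by simp_all
    have "\<exists>s' w'. exec c3 (?s4, w) (s', w') \<and> s' 0 = ?s4 0 + ?s4 1 \<and> (\<forall>j<?s4 0. w' j = w j) \<and>
        (\<forall>j. ?s4 0 \<le> j \<longrightarrow> j < ?s4 0 + ?s4 1 \<longrightarrow> w' j = Suc (G (?s4 2) j))"
      by (rule c3) (use k s4 in auto)
    then obtain s' w' where s': "exec c3 (?s4, w) (s', w')" "s' 0 = Nf (bval p)"
      "\<forall>j<Nf (bval p). w' j = Suc (G (bval p) j)"
      unfolding s4 by auto
    have i1: "exec (Inc 1) (?sa, w) (?sb, w)" by (rule exec_Inc) simp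
    have i2: "exec (Inc 2) (?sb, w) (?sc, w)" by (rule exec_Inc) simp
    have "exec ?c (?sa, w) (s', w'(s' 0 := 0))"
      by (rule exec.Seq[OF i1 exec.Seq[OF i2 exec.Seq[OF s2(1) exec.Seq[OF s3(1)
        exec.Seq[OF exec_zero exec.Seq[OF s'(1) exec.Put]]]]]])
    with s' show "\<exists>s' w'. exec ?c (?sa, w) (s', w') \<and> w' (Nf (bval p)) = 0 \<and>
        (\<forall>j<Nf (bval p). w' j = Suc (G (bval p) j))"
      by (intro exI[of _ s'] exI[of _ "w'(s' 0 := 0)"]) auto
  qed
qed

lemma enc_empty [simp]: "enc W a {} = a"
  by (simp add: enc_def)

lemma letter_in_symbols: "a < W \<Longrightarrow> a \<in> symbols W K"
  unfolding symbols_def by (intro CollectI exI[of _ a] exI[of _ "{}"]) simp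

lemma pebs_at_0: "pebs_at K (\<lambda>_. 0) v = (if v = 0 then {..K} else {})"
proof -
  have "peb (\<lambda>_. 0) j = 0" for j by (cases j) auto
  then show ?thesis by (auto simp: pebs_at_def)
qed

section \<open>Preparation of the input and extraction of the output\<close>

definition input_word :: "bool list \<Rightarrow> nat \<Rightarrow> nat" where
  "input_word p v = (if v < length p then Suc (of_bool (p ! v)) else 0)"

text \<open>Output letters must be bare symbols, so the pebbles are removed on the way to the right.
  The first cell with letter 0 is cleared as well and ends the output; pebbles beyond it do no
  harm.\<close>

definition gfin :: "nat \<Rightarrow> nat \<Rightarrow> nat \<Rightarrow> nat \<Rightarrow> (nat \<times> nat \<times> move) option" where
  "gfin W K q x = (if x \<in> symbols W K then Some (if letter W x = 0 then (q + 1, 0, MoveL) else (q, letter W x, MoveR)) else None)"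

text \<open>A bare letter is its own encoding, so the raw input needs two changes only: state 0 puts
  all pebbles on cell 0, since all registers are 0, and state 1 writes the mark. The compiled code
  starts in state 2, and \<open>m + 2\<close> has no rule.\<close>

definition wrap :: "nat \<Rightarrow> nat \<Rightarrow> table \<Rightarrow> nat \<Rightarrow> table" where
  "wrap W K \<delta> m = (\<lambda>(q, x).
     if q = 0 then (if x < W then Some (1, enc W x {..K}, MoveL) else None)
     else if q = 1 then (if x = 0 then Some (2, mark W K, MoveR) else None)
     else if q = m then gfin W K m x
     else if q = m + 1 then gret W K (m + 1) (m + 2) x
     else \<delta> (q, x))"

lemma wrap_finite:
  assumes "implements W K \<delta> 2 c m" "W > 0"
  shows "finite (dom (wrap W K \<delta> m))"
proof (rule finite_subset)
  have "dom \<delta> \<subseteq> {2..<m} \<times> all_symbols W K" "2 < m"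
    using assms by (auto simp: implements_def)
  show "dom (wrap W K \<delta> m) \<subseteq> {..m + 1} \<times> all_symbols W K"
  proof
    fix z assume z: "z \<in> dom (wrap W K \<delta> m)"
    obtain q x where qx: "z = (q, x)" by (cases z)
    show "z \<in> {..m + 1} \<times> all_symbols W K"
    proof (cases "q \<in> {0, 1, m, m + 1}")
      case True
      then show ?thesis
        using z \<open>2 < m\<close> letter_in_symbols[of x W K] letter_in_symbols[of 0 W K] \<open>W > 0\<close>
        by (auto simp: qx wrap_def gfin_def gret_def split: if_splits)
    next
      case False
      then have "(q, x) \<in> dom \<delta>" using z by (simp add: qx wrap_def domIff)
      with \<open>dom \<delta> \<subseteq> _\<close> qx show ?thesis by fastforce
    qed
  qed
  show "finite ({..m + 1} \<times> all_symbols W K)" by (simp add: finite_symbols)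
qed

lemma wrap_init:
  assumes "W > 2"
  shows "reach (wrap W K \<delta> m) (tm_init p) (2, tape W K (\<lambda>_. 0) (input_word p), 0)"
proof -
  let ?t = "\<lambda>i. if 0 \<le> i \<and> i < int (length p) then Suc (of_bool (p ! nat i)) else 0"
  let ?x = "?t 0"
  let ?t1 = "?t(0 := enc W ?x {..K})"
  have x: "?x < W" using assms by auto
  have 1: "wrap W K \<delta> m (0, ?t 0) = Some (1, enc W ?x {..K}, MoveL)"
    using x by (simp add: wrap_def)
  have 2: "wrap W K \<delta> m (1, ?t1 (-1)) = Some (2, mark W K, MoveR)"
    by (simp add: wrap_def)
  have eq: "?t1(-1 := mark W K) = tape W K (\<lambda>_. 0) (input_word p)"
  proof (rule ext)
    fix z
    show "(?t1(-1 := mark W K)) z = tape W K (\<lambda>_. 0) (input_word p) z"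
    proof (cases "z < 0")
      case True
      then show ?thesis by (auto simp: tape_neg)
    next
      case False
      then obtain u where u: "z = int u" by (metis nonneg_int_cases not_less)
      then show ?thesis
        using tape_nonneg[of W K "\<lambda>_. 0" "input_word p" u]
        by (cases "u = 0") (simp_all add: pebs_at_0 input_word_def)
    qed
  qed
  have "reach (wrap W K \<delta> m) (1, ?t1, -1) (2, ?t1(-1 := mark W K), 0)"
    by (rule r_into_rtranclp) (simp only: tstep.simps 2, simp)
  then show ?thesis
    unfolding eq tm_init_def
    by (rule converse_rtranclp_into_rtranclp[rotated]) (simp only: tstep.simps 1, simp)
qed

lemma wrap_final:
  assumes W: "W > 0" and w: "\<forall>v. w v < W" and m: "m > 2"
    and word: "\<forall>j<n. w j \<noteq> 0" "w n = 0"
    and t': "t' = (\<lambda>z. if 0 \<le> z \<and> z \<le> int n then w (nat z) else tape W K s w z)"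
  shows "reach (wrap W K \<delta> m) (m, tape W K s w, 0) (m + 2, t', 0)"
proof -
  let ?\<delta> = "wrap W K \<delta> m"
  let ?t = "\<lambda>k z. if 0 \<le> z \<and> z < int k then w (nat z) else tape W K s w z"
  have \<delta>: "?\<delta> (m, x) = gfin W K m x" "?\<delta> (m + 1, x) = gret W K (m + 1) (m + 2) x" for x
    using m by (simp_all add: wrap_def)
  have cell: "tape W K s w (int k) \<in> symbols W K" "letter W (tape W K s w (int k)) = w k" for k
    using w by (simp_all add: tape_in_symbols letter_tape)
  have "reach ?\<delta> (m, ?t 0, 0) (m, ?t k, int k)" if "k \<le> n" for k
    using that
  proof (induction k)
    case (Suc k)
    have "?\<delta> (m, ?t k (int k)) = Some (m, w k, MoveR)"
      using Suc.prems word(1) cell[of k] by (simp add: \<delta> gfin_def)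
    moreover have "(?t k)(int k := w k) = ?t (Suc k)"
      by (rule ext) auto
    ultimately have "tstep ?\<delta> (m, ?t k, int k) = Some (m, ?t (Suc k), int (Suc k))"
      by (simp add: add.commute)
    with Suc show ?case by (auto intro: rtranclp.rtrancl_into_rtrancl)
  qed simp
  from this[of n] have r1: "reach ?\<delta> (m, ?t 0, 0) (m, ?t n, int n)" by simp
  have t0: "?t 0 = tape W K s w" by (rule ext) simp
  have "?\<delta> (m, ?t n (int n)) = Some (m + 1, 0, MoveL)"
    using word(2) cell[of n] by (simp add: \<delta> gfin_def)
  moreover have "(?t n)(int n := 0) = t'"
    unfolding t' using word(2) by (intro ext) auto
  ultimately have r2: "reach ?\<delta> (m, ?t n, int n) (m + 1, t', int n - 1)"
    by (intro r_into_rtranclp) simp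
  have r3: "reach ?\<delta> (m + 1, t', int n - 1) (m + 2, t', 0)"
  proof (rule reach_ret[OF \<delta>(2)])
    show "t' (-1) = mark W K" by (simp add: t' tape_def)
    show "t' (int v) \<in> symbols W K" for v
      using cell(1)[of v] letter_in_symbols[of "w v" W K] w by (simp add: t')
  qed simp
  show ?thesis
    using rtranclp_trans[OF rtranclp_trans[OF r1 r2] r3] unfolding t0 .
qed

text \<open>The bound \<open>k\<close> is required separately for each input: it is known for codes
  of actual itineraries, while other strings may decode to anything.\<close>

theorem ex_machine:
  assumes "rec 1 (\<lambda>e. Nf (e ! 0))" "rec 2 (\<lambda>e. G (e ! 0) (e ! 1))"
  obtains M where
    "\<And>p. (\<And>j. j < Nf (bval p) \<Longrightarrow> G (bval p) j < k) \<Longrightarrow>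
      tm_computes k M p (map (G (bval p)) [0..<Nf (bval p)])"
proof -
  obtain c where c:
    "\<And>p w. (\<And>j. j < length p \<Longrightarrow> w j = Suc (of_bool (p ! j))) \<Longrightarrow> w (length p) = 0 \<Longrightarrow>
      (\<And>j. j < Nf (bval p) \<Longrightarrow> G (bval p) j < k) \<Longrightarrow>
      \<exists>s' w'. exec c (\<lambda>_. 0, w) (s', w') \<and> w' (Nf (bval p)) = 0 \<and>
        (\<forall>j<Nf (bval p). w' j = Suc (G (bval p) j))"
    by (rule ex_program[OF assms]) blast
  obtain K where K: "\<forall>r\<in>Suc ` regs c. r \<le> K"
    using finite_nat_set_iff_bounded_le finite_regs by blast
  obtain W where W: "\<forall>a\<in>{0, 1, 2} \<union> letters c. a < W"
    using finite_nat_set_iff_bounded[of "{0, 1, 2} \<union> letters c"] finite_letters by auto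
  obtain \<delta> m where \<delta>: "implements W K \<delta> 2 c m"
    using compile[of c K W 2] K W by blast
  have m: "m > 2" and W2: "W > 2" using \<delta> W by (auto simp: implements_def)
  obtain M where M: "map_of M = wrap W K \<delta> m"
    using finite_map_of_ex[OF wrap_finite[OF \<delta>]] W2 by auto
  have le: "\<delta> \<subseteq>\<^sub>m wrap W K \<delta> m"
    unfolding map_le_def
  proof
    fix z assume "z \<in> dom \<delta>"
    moreover have "dom \<delta> \<subseteq> {2..<m} \<times> all_symbols W K"
      using \<delta> by (simp add: implements_def)
    ultimately show "\<delta> z = wrap W K \<delta> m z"
      by (cases z) (auto simp: wrap_def)
  qed
  show ?thesis
  proof (rule that[of M])
    fix p
    assume k: "\<And>j. j < Nf (bval p) \<Longrightarrow> G (bval p) j < k"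
    let ?n = "Nf (bval p)"
    obtain s' w' where ex: "exec c (\<lambda>_. 0, input_word p) (s', w')" and w': "w' ?n = 0"
        "\<forall>j<?n. w' j = Suc (G (bval p) j)"
      using c[of p "input_word p"] k by (auto simp: input_word_def)
    have win: "\<forall>v. input_word p v < W" using W2 by (simp add: input_word_def)
    have w'W: "\<forall>v. w' v < W"
      using exec_letters[OF ex] W win by auto
    define t' where "t' = (\<lambda>z. if 0 \<le> z \<and> z \<le> int ?n then w' (nat z) else tape W K s' w' z)"
    have "reach (wrap W K \<delta> m) (2, tape W K (\<lambda>_. 0) (input_word p), 0) (m, tape W K s' w', 0)"
      by (rule reach_mono[OF le]) (use \<delta> ex win in \<open>auto simp: implements_def\<close>)
    moreover have "reach (wrap W K \<delta> m) (m, tape W K s' w', 0) (m + 2, t', 0)"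
      using W2 m w' by (intro wrap_final[OF _ w'W _ _ _ t'_def]) auto
    ultimately have "reach (wrap W K \<delta> m) (tm_init p) (m + 2, t', 0)"
      using wrap_init[OF W2, of K \<delta> m p] by (blast intro: rtranclp_trans)
    moreover have "wrap W K \<delta> m (m + 2, x) = None" for x
      using implements_dom[OF \<delta>, of "m + 2" x] by (simp add: wrap_def)
    moreover have "tm_output k (m + 2, t', 0) = map (G (bval p)) [0..<?n]"
    proof -
      have t'w: "t' (int j) = w' j" if "j \<le> ?n" for j
        using that by (simp add: t'_def)
      have "(LEAST n. t' (0 + int n) \<notin> {1..k}) = ?n"
      proof (rule Least_equality)
        show "t' (0 + int ?n) \<notin> {1..k}" using t'w[of ?n] w'(1) by simp
        fix y assume y: "t' (0 + int y) \<notin> {1..k}"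
        show "?n \<le> y"
        proof (rule ccontr)
          assume "\<not> ?n \<le> y"
          then show False using t'w[of y] w'(2) k[of y] y by simp
        qed
      qed
      then show ?thesis using t'w w'(2) by simp
    qed
    ultimately show "tm_computes k M p (map (G (bval p)) [0..<?n])"
      unfolding tm_computes_def tm_step_eq M by (intro exI[of _ "(m + 2, t', 0)"]) simp
  qed
qed

section \<open>Measure preserving piecewise isometries\<close>

lemma preserves_measure:
  assumes T: "preserves_lebesgue T" and B: "B \<in> sets lebesgue" "B \<subseteq> {0..1}"
  shows "T -` B \<inter> {0..1} \<in> lmeasurable"
    and "measure lebesgue (T -` B \<inter> {0..1}) = measure lebesgue B"
proof -
  let ?M = "lebesgue_on {0..1::real}"
  have BM: "B \<in> sets ?M" using B by (simp add: sets_restrict_space_iff)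
  have pre: "T -` B \<inter> {0..1} \<in> sets ?M"
    using measurable_sets[of T ?M ?M B] T BM by (simp add: preserves_lebesgue_def)
  then have leb: "T -` B \<inter> {0..1} \<in> sets lebesgue"
    by (simp add: sets_restrict_space_iff)
  then show "T -` B \<inter> {0..1} \<in> lmeasurable"
    by (rule bounded_set_imp_lmeasurable[rotated]) (rule bounded_subset[of "{0..1}"], auto)
  have "emeasure ?M (T -` B \<inter> {0..1}) = emeasure ?M B"
    using T BM by (simp add: preserves_lebesgue_def)
  then show "measure lebesgue (T -` B \<inter> {0..1}) = measure lebesgue B"
    using B(2) by (simp add: measure_def emeasure_restrict_space)
qed

text \<open>The form in which measure preservation excludes double covering: both sets fit
  disjointly into the preimage of \<open>B\<close>, which is no larger than
  \<open>B\<close>.\<close>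

lemma preimage_overlap:
  assumes T: "preserves_lebesgue T" and B: "B \<in> sets lebesgue" "B \<subseteq> {0..1}"
    and A: "A1 \<in> lmeasurable" "A2 \<in> lmeasurable" "A1 \<inter> A2 = {}" "A1 \<union> A2 \<subseteq> T -` B \<inter> {0..1}"
  shows "measure lebesgue A1 + measure lebesgue A2 \<le> measure lebesgue B"
proof -
  have "measure lebesgue A1 + measure lebesgue A2 = measure lebesgue (A1 \<union> A2)"
    using A by (simp add: measure_Un3)
  also have "\<dots> \<le> measure lebesgue (T -` B \<inter> {0..1})"
    using A preserves_measure(1)[OF T B] by (intro measure_mono_fmeasurable) auto
  finally show ?thesis by (simp only: preserves_measure(2)[OF T B])
qed

section \<open>Branches of a piecewise isometry\<close>

definition affine_on :: "(real \<Rightarrow> real) \<Rightarrow> real set \<Rightarrow> real \<Rightarrow> real \<Rightarrow> bool" where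
  "affine_on T A s c \<longleftrightarrow> (s = 1 \<or> s = -1) \<and> (\<forall>y\<in>A. T y = s * y + c)"

lemma affine_on_mono: "affine_on T A s c \<Longrightarrow> B \<subseteq> A \<Longrightarrow> affine_on T B s c"
  by (auto simp: affine_on_def)

lemma affine_on_unique:
  assumes "affine_on T A s c" "affine_on T A s' c'" "y \<in> A" "z \<in> A" "y \<noteq> z"
  shows "s = s' \<and> c = c'"
proof -
  have 1: "s * y + c = s' * y + c'" "s * z + c = s' * z + c'"
    using assms unfolding affine_on_def by metis+
  then have "(s - s') * (y - z) = 0" by (simp add: algebra_simps)
  then have "s = s'" using assms(5) by simp
  with 1 show ?thesis by simp
qed

text \<open>Two points determine slope and constant, so the local pair is well defined at each point
  and locally constant, hence constant on the connected set \<open>J\<close>.\<close>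

lemma affine_on_local:
  fixes J :: "real set"
  assumes J: "connected J" "open J" "J \<noteq> {}"
    and loc: "\<And>y. y \<in> J \<Longrightarrow> \<exists>e>0. \<exists>s c. affine_on T {y - e<..<y + e} s c"
  shows "\<exists>s c. affine_on T J s c"
proof -
  define P where "P y sc \<longleftrightarrow> (\<exists>e>0. affine_on T {y - e<..<y + e} (fst sc) (snd sc))" for y sc
  define f where "f y = (SOME sc. P y sc)" for y
  have ex: "P y (f y)" if "y \<in> J" for y
  proof -
    have "\<exists>sc. P y sc" using loc[OF that] by (auto simp: P_def)
    then show ?thesis unfolding f_def by (rule someI_ex)
  qed
  have uniq: "sc = sc'" if sc: "P y sc" "P y sc'" for y sc sc'
  proof -
    obtain e e' where e: "e > 0" "affine_on T {y - e<..<y + e} (fst sc) (snd sc)"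
      "e' > 0" "affine_on T {y - e'<..<y + e'} (fst sc') (snd sc')"
      using sc by (auto simp: P_def)
    let ?A = "{y - min e e'<..<y + min e e'}"
    have "affine_on T ?A (fst sc) (snd sc)" "affine_on T ?A (fst sc') (snd sc')"
      by (rule affine_on_mono[OF e(2)], auto) (rule affine_on_mono[OF e(4)], auto)
    then have "fst sc = fst sc' \<and> snd sc = snd sc'"
    proof (rule affine_on_unique)
      have m: "min e e' > 0" using e(1,3) by simp
      then show "y \<in> ?A" by simp
      show "y \<noteq> y + min e e' / 2" using m by linarith
      show "y + min e e' / 2 \<in> ?A"
        unfolding greaterThanLessThan_iff using m by (simp only: add_less_cancel_left) linarith
    qed
    then show ?thesis by (simp add: prod_eq_iff)
  qed
  obtain y0 where y0: "y0 \<in> J" using J(3) by blast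
  have const: "f y = f y0" if "y \<in> J" for y
  proof (rule connected_local_const[OF J(1) that y0])
    show "\<forall>a\<in>J. \<forall>\<^sub>F b in at a within J. f a = f b"
    proof
      fix a assume a: "a \<in> J"
      obtain e where e: "e > 0" "affine_on T {a - e<..<a + e} (fst (f a)) (snd (f a))"
        using ex[OF a] by (auto simp: P_def)
      have "f a = f b" if b: "b \<in> J" "dist b a < e" for b
      proof (rule uniq[of b])
        have "affine_on T {b - (e - dist b a)<..<b + (e - dist b a)} (fst (f a)) (snd (f a))"
          by (rule affine_on_mono[OF e(2)]) (auto simp: dist_real_def)
        then show "P b (f a)" using b(2) by (auto simp: P_def intro!: exI[of _ "e - dist b a"])
      qed (rule ex[OF b(1)])
      then show "\<forall>\<^sub>F b in at a within J. f a = f b"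
        unfolding eventually_at using e(1) by blast
    qed
  qed
  have "affine_on T J (fst (f y0)) (snd (f y0))"
    unfolding affine_on_def
  proof (intro conjI ballI)
    show "fst (f y0) = 1 \<or> fst (f y0) = - 1"
      using ex[OF y0] by (auto simp: P_def affine_on_def)
    fix y assume "y \<in> J"
    then show "T y = fst (f y0) * y + snd (f y0)"
      using ex[of y] const[of y] by (auto simp: P_def affine_on_def)
  qed
  then show ?thesis by blast
qed

lemma interval_interior_nbhd:
  fixes I :: "real set"
  assumes I: "is_interval I" "bdd_below I" "bdd_above I" "x \<in> I" "x \<noteq> Inf I" "x \<noteq> Sup I"
  shows "\<exists>e>0. {x - e<..<x + e} \<subseteq> I"
proof -
  have "Inf I < x" "x < Sup I"
    using cInf_lower[of x I] cSup_upper[of x I] I by auto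
  moreover have "I \<noteq> {}" using I(4) by blast
  ultimately obtain a b where ab: "a \<in> I" "a < x" "b \<in> I" "x < b"
    using cInf_lessD[of I x] less_cSupD[of I x] by blast
  have "y \<in> I" if "a \<le> y" "y \<le> b" for y
    using I(1) ab that unfolding is_interval_1 by blast
  then show ?thesis
    using ab by (intro exI[of _ "min (x - a) (b - x)"]) (auto simp: subset_iff)
qed

text \<open>The exceptional set consists of the infima and suprema of all pieces; this also disposes
  of one-point pieces and of the various kinds of ends.\<close>

lemma piecewise_isometry_locally_affine:
  assumes "piecewise_isometry T"
  obtains F where "finite F"
    "\<And>x. x \<in> {0..1} \<Longrightarrow> x \<notin> F \<Longrightarrow> \<exists>e>0. \<exists>s c. {x - e<..<x + e} \<subseteq> {0..1} \<and> affine_on T {x - e<..<x + e} s c"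
proof -
  obtain P where P: "finite P" "partition_on {0..1} P"
    "\<And>I. I \<in> P \<Longrightarrow> is_interval I"
    "\<And>I. I \<in> P \<Longrightarrow> \<exists>c. (\<forall>x\<in>I. T x = x + c) \<or> (\<forall>x\<in>I. T x = - x + c)"
    using assms unfolding piecewise_isometry_def by blast
  show ?thesis
  proof (rule that[of "Inf ` P \<union> Sup ` P"])
    show "finite (Inf ` P \<union> Sup ` P)" using P(1) by simp
    fix x :: real assume x: "x \<in> {0..1}" "x \<notin> Inf ` P \<union> Sup ` P"
    then obtain I where I: "I \<in> P" "x \<in> I"
      using partition_onD1[OF P(2)] by blast
    have sub: "I \<subseteq> {0..1}" using partition_onD1[OF P(2)] I by blast
    then have "bdd_below I" "bdd_above I" by (auto intro: bdd_below_mono bdd_above_mono)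
    then obtain e where e: "e > 0" "{x - e<..<x + e} \<subseteq> I"
      using interval_interior_nbhd[of I x] P(3)[OF I(1)] I x(2) by blast
    obtain c where "(\<forall>x\<in>I. T x = x + c) \<or> (\<forall>x\<in>I. T x = - x + c)"
      using P(4)[OF I(1)] by blast
    then have "affine_on T I 1 c \<or> affine_on T I (-1) c" by (simp add: affine_on_def)
    then obtain s where "affine_on T I s c" by blast
    with e sub show "\<exists>e>0. \<exists>s c. {x - e<..<x + e} \<subseteq> {0..1} \<and> affine_on T {x - e<..<x + e} s c"
      using affine_on_mono by (meson order_trans)
  qed
qed

lemma locally_affine_continuous:
  assumes "affine_on T {x - e<..<x + e} s c" "e > 0"
  shows "isCont T x"
proof -
  have "\<forall>\<^sub>F y in nhds x. T y = s * y + c"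
  proof (rule eventually_nhds_in_open[of "{x - e<..<x + e}", THEN eventually_mono])
    show "T y = s * y + c" if "y \<in> {x - e<..<x + e}" for y
      using assms(1) that unfolding affine_on_def by blast
  qed (use assms in auto)
  moreover have "isCont (\<lambda>y. s * y + c) x" by (intro continuous_intros)
  ultimately show ?thesis by (subst isCont_cong)
qed

lemma finite_discontinuities:
  assumes "piecewise_isometry T"
  shows "finite {y \<in> {0..1}. \<not> continuous (at y within {0..1}) T}"
proof -
  obtain F where F: "finite F"
    "\<And>x. x \<in> {0..1} \<Longrightarrow> x \<notin> F \<Longrightarrow> \<exists>e>0. \<exists>s c. {x - e<..<x + e} \<subseteq> {0..1} \<and> affine_on T {x - e<..<x + e} s c"
    using piecewise_isometry_locally_affine[OF assms] by blast
  have "{y \<in> {0..1}. \<not> continuous (at y within {0..1}) T} \<subseteq> F"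
    using F(2) locally_affine_continuous continuous_at_imp_continuous_at_within by blast
  then show ?thesis using F(1) finite_subset by blast
qed

text \<open>A finite exceptional set has no point other than possibly \<open>x\<close> near
  \<open>x\<close>, and each of the two sides is connected.\<close>

lemma one_sided_affine:
  assumes T: "piecewise_isometry T" and x: "0 < x" "x < 1"
  shows "\<exists>e>0. {x - e<..<x + e} \<subseteq> {0..1} \<and> (\<exists>s c. affine_on T {x - e<..<x} s c) \<and> (\<exists>s c. affine_on T {x<..<x + e} s c)"
proof -
  obtain F where F: "finite F"
    "\<And>x. x \<in> {0..1} \<Longrightarrow> x \<notin> F \<Longrightarrow> \<exists>e>0. \<exists>s c. {x - e<..<x + e} \<subseteq> {0..1} \<and> affine_on T {x - e<..<x + e} s c"
    using piecewise_isometry_locally_affine[OF T] by blast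
  obtain d where d: "d > 0" "\<And>y. y \<in> F \<Longrightarrow> y \<noteq> x \<Longrightarrow> d \<le> dist x y"
    using finite_set_avoid[OF F(1), of x] by blast
  define e where "e = min d (min x (1 - x))"
  have e: "e > 0" using d x by (simp add: e_def)
  have sub: "{x - e<..<x + e} \<subseteq> {0..1}" by (auto simp: e_def)
  have avoid: "y \<in> {0..1}" "y \<notin> F" if "y \<in> {x - e<..<x + e}" "y \<noteq> x" for y
  proof -
    show "y \<in> {0..1}" using sub that by blast
    show "y \<notin> F" using d(2)[of y] that by (auto simp: dist_real_def e_def)
  qed
  have "\<exists>s c. affine_on T J s c" if J: "connected J" "open J" "J \<noteq> {}" "J \<subseteq> {x - e<..<x + e} - {x}" for J
    by (rule affine_on_local[OF J(1-3)]) (use F(2) avoid J(4) in blast)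
  moreover have "{x - e<..<x} \<subseteq> {x - e<..<x + e} - {x}" "{x<..<x + e} \<subseteq> {x - e<..<x + e} - {x}"
    using e by auto
  moreover have "{x - e<..<x} \<noteq> {}" "{x<..<x + e} \<noteq> {}" using e by auto
  ultimately have "\<exists>s c. affine_on T {x - e<..<x} s c" "\<exists>s c. affine_on T {x<..<x + e} s c"
    by (simp_all only: connected_Ioo open_greaterThanLessThan simp_thms)
  with e sub show ?thesis by blast
qed

text \<open>At a continuity point the two one-sided branches cannot have different slopes: the graph would
  fold there, and the fold would be covered twice.\<close>

lemma affine_at_continuity_point:
  assumes T: "piecewise_isometry T" "preserves_lebesgue T" and x: "0 < x" "x < 1"
    and cont: "continuous (at x within {0..1}) T"
  shows "\<exists>e>0. \<exists>s c. affine_on T {x - e<..<x + e} s c"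
proof -
  obtain e s1 c1 s2 c2 where e: "e > 0" "{x - e<..<x + e} \<subseteq> {0..1}"
    and 1: "affine_on T {x - e<..<x} s1 c1" and 2: "affine_on T {x<..<x + e} s2 c2"
    using one_sided_affine[OF T(1) x] by blast
  have "isCont T x"
  proof -
    have "at x within {0..1} = at x" using x by (intro at_within_interior) auto
    with cont show ?thesis by simp
  qed
  then have lim: "(T \<longlongrightarrow> T x) (at_left x)" "(T \<longlongrightarrow> T x) (at_right x)"
    unfolding isCont_def by (auto intro: tendsto_within_subset)
  have "((\<lambda>y. s1 * y + c1) \<longlongrightarrow> T x) (at_left x)"
  proof (rule Lim_transform_eventually[OF lim(1)])
    have "\<forall>\<^sub>F y in at_left x. y \<in> {x - e<..<x}" using e(1) by (intro eventually_at_left_real) simp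
    then show "\<forall>\<^sub>F y in at_left x. T y = s1 * y + c1"
      by eventually_elim (use 1 in \<open>auto simp: affine_on_def\<close>)
  qed
  moreover have "((\<lambda>y. s1 * y + c1) \<longlongrightarrow> s1 * x + c1) (at_left x)"
    by (intro tendsto_intros)
  ultimately have Tx1: "T x = s1 * x + c1"
    using tendsto_unique trivial_limit_at_left_real by blast
  have "((\<lambda>y. s2 * y + c2) \<longlongrightarrow> T x) (at_right x)"
  proof (rule Lim_transform_eventually[OF lim(2)])
    have "\<forall>\<^sub>F y in at_right x. y \<in> {x<..<x + e}" using e(1) by (intro eventually_at_right_real) simp
    then show "\<forall>\<^sub>F y in at_right x. T y = s2 * y + c2"
      by eventually_elim (use 2 in \<open>auto simp: affine_on_def\<close>)
  qed
  moreover have "((\<lambda>y. s2 * y + c2) \<longlongrightarrow> s2 * x + c2) (at_right x)"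
    by (intro tendsto_intros)
  ultimately have Tx2: "T x = s2 * x + c2"
    using tendsto_unique trivial_limit_at_right_real by blast
  have "s1 = s2"
  proof (rule ccontr)
    assume ne: "s1 \<noteq> s2"
    \<comment> \<open>For \<open>s1 = 1\<close> the graph has a peak at \<open>x\<close> and both
      sides land just below \<open>T x\<close>; otherwise it has a valley and they land just above.
      Sets of total length \<open>2 * e\<close> thus end up in one of length
      \<open>e\<close>.\<close>
    define B where "B = (if s1 = 1 then {T x - e<..<T x} else {T x<..<T x + e})"
    have s: "s1 = 1 \<and> s2 = -1 \<or> s1 = -1 \<and> s2 = 1"
      using ne 1 2 by (auto simp: affine_on_def)
    have T1: "T y = s1 * y + c1" if "y \<in> {x - e<..<x}" for y
      using that 1 unfolding affine_on_def by blast
    have T2: "T y = s2 * y + c2" if "y \<in> {x<..<x + e}" for y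
      using that 2 unfolding affine_on_def by blast
    have "B \<subseteq> {0..1}"
    proof
      fix b assume b: "b \<in> B"
      \<comment> \<open>The left branch alone already covers \<open>B\<close>, and this is the point
        that it sends to \<open>b\<close>; hence \<open>B\<close> lies in the unit interval.\<close>
      let ?y = "x - \<bar>T x - b\<bar>"
      have y: "?y \<in> {x - e<..<x}" using b by (auto simp: B_def split: if_splits)
      have "T ?y = b"
        using T1[OF y] Tx1 s b by (auto simp: B_def split: if_splits)
      moreover have "T ?y \<in> {0..1}"
      proof -
        have "?y \<in> {x - e<..<x + e}" using y e(1) by auto
        then have "?y \<in> {0..1}" using e(2) by blast
        then show ?thesis using T(1) unfolding piecewise_isometry_def by blast
      qed
      ultimately show "b \<in> {0..1}" by simp
    qed
    moreover have "B \<in> sets lebesgue" by (simp add: B_def)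
    moreover have "{x - e<..<x} \<union> {x<..<x + e} \<subseteq> T -` B \<inter> {0..1}"
    proof -
      have "T y \<in> B" if "y \<in> {x<..<x + e}" for y
        using that T2[OF that] s Tx2 by (auto simp: B_def)
      moreover have "T y \<in> B" if "y \<in> {x - e<..<x}" for y
        using that T1[OF that] s Tx1 by (auto simp: B_def)
      moreover have "{x - e<..<x} \<union> {x<..<x + e} \<subseteq> {x - e<..<x + e}" using e(1) by auto
      ultimately show ?thesis using e(2) by blast
    qed
    ultimately have "measure lebesgue {x - e<..<x} + measure lebesgue {x<..<x + e} \<le> measure lebesgue B"
      using e(1) by (intro preimage_overlap[OF T(2)]) auto
    then show False using e(1) by (auto simp: B_def split: if_splits)
  qed
  then have "c1 = c2" using Tx1 Tx2 by simp
  have "affine_on T {x - e<..<x + e} s1 c1"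
    unfolding affine_on_def
  proof (intro conjI ballI)
    show "s1 = 1 \<or> s1 = -1" using 1 by (simp add: affine_on_def)
    fix y assume "y \<in> {x - e<..<x + e}"
    then consider "y \<in> {x - e<..<x}" | "y = x" | "y \<in> {x<..<x + e}" by force
    then show "T y = s1 * y + c1"
      using 1 2 Tx1 \<open>s1 = s2\<close> \<open>c1 = c2\<close> unfolding affine_on_def by cases blast+
  qed
  with e(1) show ?thesis by blast
qed

lemma affine_between_discontinuities:
  assumes T: "piecewise_isometry T" "preserves_lebesgue T" and uv: "0 \<le> u" "u < v" "v \<le> 1"
    and cont: "\<And>x. x \<in> {u<..<v} \<Longrightarrow> continuous (at x within {0..1}) T"
  shows "\<exists>s c. affine_on T {u<..<v} s c"
proof (rule affine_on_local)
  fix y assume "y \<in> {u<..<v}"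
  then show "\<exists>e>0. \<exists>s c. affine_on T {y - e<..<y + e} s c"
    using affine_at_continuity_point[OF T, of y] cont[of y] uv by auto
qed (use uv in \<open>auto simp: connected_Ioo\<close>)

section \<open>Gaps between break points and their images\<close>

definition gaps :: "real set \<Rightarrow> (real \<times> real) set" where
  "gaps E = {(u, v). u \<in> E \<and> v \<in> E \<and> u < v \<and> {u<..<v} \<inter> E = {}}"

lemma finite_gaps: "finite E \<Longrightarrow> finite (gaps E)"
  by (rule finite_subset[of _ "E \<times> E"]) (auto simp: gaps_def)

lemma gaps_cover:
  assumes "finite E" "0 \<in> E" "1 \<in> E" "x \<in> {0..1}" "x \<notin> E"
  shows "\<exists>u v. (u, v) \<in> gaps E \<and> u < x \<and> x < v"
proof -
  let ?L = "{z \<in> E. z < x}" and ?R = "{z \<in> E. x < z}"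
  have "0 < x" "x < 1" using assms by (auto simp: order_less_le)
  then have L: "finite ?L" "?L \<noteq> {}" and R: "finite ?R" "?R \<noteq> {}"
    using assms(1-3) by auto
  have u: "Max ?L \<in> ?L" and v: "Min ?R \<in> ?R" using Max_in[OF L] Min_in[OF R] by blast+
  have "{Max ?L<..<Min ?R} \<inter> E = {}"
  proof (rule ccontr)
    assume "\<not> ?thesis"
    then obtain z where z: "z \<in> E" "Max ?L < z" "z < Min ?R" by auto
    then consider "z < x" | "x < z" using assms(5) by (metis linorder_cases)
    then show False
    proof cases
      case 1
      then have "z \<le> Max ?L" using z(1) L(1) by (intro Max_ge) auto
      with z show False by simp
    next
      case 2
      then have "Min ?R \<le> z" using z(1) R(1) by (intro Min_le) auto
      with z show False by simp
    qed
  qed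
  with u v show ?thesis
    by (intro exI[of _ "Max ?L"] exI[of _ "Min ?R"]) (auto simp: gaps_def)
qed

lemma gaps_ordered:
  assumes "(u, v) \<in> gaps E" "(u', v') \<in> gaps E" "(u, v) \<noteq> (u', v')"
  shows "v \<le> u' \<or> v' \<le> u"
proof (rule ccontr)
  assume "\<not> ?thesis"
  then have lt: "u' < v" "u < v'" by auto
  have E: "u \<in> E" "v \<in> E" "u' \<in> E" "v' \<in> E" "{u<..<v} \<inter> E = {}" "{u'<..<v'} \<inter> E = {}"
    using assms by (auto simp: gaps_def)
  then have "u' \<notin> {u<..<v}" "u \<notin> {u'<..<v'}" "v \<notin> {u'<..<v'}" "v' \<notin> {u<..<v}" by blast+
  with lt have "u = u'" "v = v'" using assms(1,2) by (auto simp: gaps_def)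
  with assms(3) show False by simp
qed

lemma gaps_unit:
  assumes "(u, v) \<in> gaps E" "E \<subseteq> {0..1}"
  shows "0 \<le> u" "u < v" "v \<le> 1" "{u<..<v} \<subseteq> {0..1}"
proof -
  have "u \<in> {0..1}" "v \<in> {0..1}" "u < v" using assms by (auto simp: gaps_def)
  then show "0 \<le> u" "u < v" "v \<le> 1" "{u<..<v} \<subseteq> {0..1}" by auto
qed

definition left_end :: "real \<Rightarrow> real \<Rightarrow> real \<Rightarrow> real \<Rightarrow> real" where
  "left_end u v s c = (if s = 1 then u + c else c - v)"

lemma affine_image:
  assumes "affine_on T {u<..<v} s c" "y \<in> {u<..<v}"
  shows "left_end u v s c < T y" "T y < left_end u v s c + (v - u)"
  using assms by (auto simp: affine_on_def left_end_def)

lemma affine_preimage: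
  assumes T: "affine_on T {u<..<v} s c"
    and b: "left_end u v s c \<le> b1" "b1 \<le> b2" "b2 \<le> left_end u v s c + (v - u)"
  shows "\<exists>A. A \<in> lmeasurable \<and> A \<subseteq> {u<..<v} \<and> A \<subseteq> T -` {b1<..<b2} \<and> measure lebesgue A = b2 - b1"
proof (cases "s = 1")
  case True
  then show ?thesis using assms
    by (intro exI[of _ "{b1 - c<..<b2 - c}"]) (auto simp: affine_on_def left_end_def)
next
  case False
  then show ?thesis using assms
    by (intro exI[of _ "{c - b2<..<c - b1}"]) (auto simp: affine_on_def left_end_def)
qed

text \<open>Only the open image is known to lie in the unit interval; the bounds at its ends follow
  by density.\<close>

lemma left_end_unit:
  assumes T: "T \<in> {0..1} \<rightarrow> {0..1}" "affine_on T {u<..<v} s c" and uv: "0 \<le> u" "u < v" "v \<le> 1"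
  shows "0 \<le> left_end u v s c" "left_end u v s c + (v - u) \<le> 1"
proof -
  let ?a = "left_end u v s c"
  have T01: "T y \<in> {0..1}" if "y \<in> {u<..<v}" for y using T(1) uv that by auto
  have img: "\<exists>y\<in>{u<..<v}. T y = b" if "?a < b" "b < ?a + (v - u)" for b
  proof (cases "s = 1")
    case True
    then show ?thesis using that T(2)
      by (intro bexI[of _ "b - c"]) (auto simp: affine_on_def left_end_def)
  next
    case False
    then show ?thesis using that T(2)
      by (intro bexI[of _ "c - b"]) (auto simp: affine_on_def left_end_def)
  qed
  show "0 \<le> ?a"
  proof (rule dense_ge_bounded[of _ "?a + (v - u)"])
    fix b assume "?a < b" "b < ?a + (v - u)"
    from img[OF this] T01 show "0 \<le> b" by auto
  qed (use uv in simp)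
  show "?a + (v - u) \<le> 1"
  proof (rule dense_le_bounded[of ?a])
    fix b assume "?a < b" "b < ?a + (v - u)"
    from img[OF this] T01 show "b \<le> 1" by auto
  qed (use uv in simp)
qed

text \<open>Were the images to overlap in an interval, both gaps would contain a preimage of its
  full length, so it would be covered twice.\<close>

lemma images_ordered:
  assumes T: "preserves_lebesgue T" "T \<in> {0..1} \<rightarrow> {0..1}" and E: "E \<subseteq> {0..1}"
    and g: "(u, v) \<in> gaps E" "(u', v') \<in> gaps E" "(u, v) \<noteq> (u', v')"
    and aff: "affine_on T {u<..<v} s c" "affine_on T {u'<..<v'} s' c'"
  shows "left_end u v s c + (v - u) \<le> left_end u' v' s' c' \<or> left_end u' v' s' c' + (v' - u') \<le> left_end u v s c"
proof (rule ccontr)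
  let ?a = "left_end u v s c" and ?a' = "left_end u' v' s' c'"
  let ?b1 = "max ?a ?a'" and ?b2 = "min (?a + (v - u)) (?a' + (v' - u'))"
  assume "\<not> ?thesis"
  then have lt: "?b1 < ?b2" using gaps_unit[OF g(1) E] gaps_unit[OF g(2) E] by auto
  obtain A where A: "A \<in> lmeasurable" "A \<subseteq> {u<..<v}" "A \<subseteq> T -` {?b1<..<?b2}" "measure lebesgue A = ?b2 - ?b1"
    using affine_preimage[OF aff(1), of ?b1 ?b2] lt by auto
  obtain A' where A': "A' \<in> lmeasurable" "A' \<subseteq> {u'<..<v'}" "A' \<subseteq> T -` {?b1<..<?b2}" "measure lebesgue A' = ?b2 - ?b1"
    using affine_preimage[OF aff(2), of ?b1 ?b2] lt by auto
  have disj: "A \<inter> A' = {}"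
    using gaps_ordered[OF g] A(2) A'(2) by fastforce
  have "{?b1<..<?b2} \<subseteq> {0..1}"
    using left_end_unit[OF T(2) aff(1) gaps_unit(1-3)[OF g(1) E]] by auto
  then have "measure lebesgue A + measure lebesgue A' \<le> measure lebesgue {?b1<..<?b2}"
    using A A' disj gaps_unit(4)[OF g(1) E] gaps_unit(4)[OF g(2) E]
    by (intro preimage_overlap[OF T(1)]) auto
  moreover have "measure lebesgue {x<..<y} = y - x" if "x < y" for x y :: real
    using that by simp
  note this[OF lt]
  ultimately show False using A(4) A'(4) lt by linarith
qed

text \<open>The branch images tile the unit interval, so the left end of one of them is the total length of
  the pieces whose images lie to the left of it. In this way the translation constants are determined
  by the end points of the pieces alone, although \<open>T\<close> may take unrelated values at these points.\<close>

lemma left_end_eq: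
  assumes T: "preserves_lebesgue T" "T \<in> {0..1} \<rightarrow> {0..1}" and E: "finite E" "0 \<in> E" "1 \<in> E" "E \<subseteq> {0..1}"
    and aff: "\<And>u v. (u, v) \<in> gaps E \<Longrightarrow> affine_on T {u<..<v} (s (u, v)) (c (u, v))"
    and g: "(u, v) \<in> gaps E"
  shows "\<exists>S \<subseteq> gaps E. left_end u v (s (u, v)) (c (u, v)) = (\<Sum>(u', v')\<in>S. v' - u')"
proof -
  let ?l = "\<lambda>(u, v). left_end u v (s (u, v)) (c (u, v))"
  let ?a = "?l (u, v)"
  define S where "S = {g \<in> gaps E. ?l g < ?a}"
  have finS: "finite S" using finite_gaps[OF E(1)] by (simp add: S_def)
  have a: "0 \<le> ?a" "?a \<le> 1"
    using left_end_unit[OF T(2) aff[OF g] gaps_unit(1-3)[OF g E(4)]] gaps_unit(2)[OF g E(4)] by auto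
  \<comment> \<open>By invariance \<open>?X\<close> has measure \<open>?a\<close>. It differs from
    the union \<open>?Y\<close> of the gaps in \<open>S\<close> by points of \<open>E\<close> only,
    so \<open>?a\<close> is the total length of these gaps.\<close>
  let ?X = "T -` {0..?a} \<inter> {0..1}" and ?Y = "\<Union>g\<in>S. {fst g<..<snd g}"
  have X: "?X \<in> lmeasurable" "measure lebesgue ?X = ?a"
    using preserves_measure[OF T(1), of "{0..?a}"] a by auto
  have Y: "?Y \<in> lmeasurable" using finS by (intro fmeasurable.finite_UN) auto
  have low: "T y \<le> ?a" if "(u', v') \<in> S" "y \<in> {u'<..<v'}" for u' v' y
  proof -
    have g': "(u', v') \<in> gaps E" "?l (u', v') < ?a" using that(1) by (auto simp: S_def)
    then have "(u', v') \<noteq> (u, v)" by auto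
    from images_ordered[OF T E(4) g'(1) g this aff[OF g'(1)] aff[OF g]]
    have "?l (u', v') + (v' - u') \<le> ?a"
      using g'(2) gaps_unit(2)[OF g E(4)] by auto
    with affine_image(2)[OF aff[OF g'(1)] that(2)] show ?thesis by simp
  qed
  have sub1: "?Y \<subseteq> ?X"
  proof
    fix y assume "y \<in> ?Y"
    then obtain u' v' where y: "(u', v') \<in> S" "y \<in> {u'<..<v'}" by auto
    then have "(u', v') \<in> gaps E" by (simp add: S_def)
    then have "y \<in> {0..1}" using gaps_unit(4)[OF _ E(4)] y(2) by blast
    with low[OF y] T(2) show "y \<in> ?X" by auto
  qed
  have sub2: "?X - ?Y \<subseteq> E"
  proof (rule subsetI, rule ccontr)
    fix y assume y: "y \<in> ?X - ?Y" "y \<notin> E"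
    then obtain u' v' where uv': "(u', v') \<in> gaps E" "u' < y" "y < v'"
      using gaps_cover[OF E(1-3), of y] by auto
    then have "(u', v') \<notin> S" using y(1) by auto
    then have "?a \<le> ?l (u', v')" using uv'(1) by (auto simp: S_def)
    moreover have "?l (u', v') < T y" using affine_image(1)[OF aff[OF uv'(1)], of y] uv' by simp
    ultimately show False using y(1) by auto
  qed
  have "negligible (?X - ?Y)"
    using negligible_subset[OF negligible_finite[OF E(1)] sub2] .
  then have "measure lebesgue ?X = measure lebesgue ?Y"
    using sub1 by (intro measure_negligible_symdiff[OF Y]) (simp add: Un_absorb1 Diff_eq_empty_iff[THEN iffD2])
  also have "\<dots> = (\<Sum>g\<in>S. measure lebesgue {fst g<..<snd g})"
  proof (rule measure_UNION'[OF finS])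
    show "pairwise (\<lambda>g g'. disjnt {fst g<..<snd g} {fst g'<..<snd g'}) S"
    proof (rule pairwiseI)
      fix g g' assume g: "g \<in> S" "g' \<in> S" "g \<noteq> g'"
      then have "snd g \<le> fst g' \<or> snd g' \<le> fst g"
        using gaps_ordered[of "fst g" "snd g" E "fst g'" "snd g'"] by (simp add: S_def)
      then show "disjnt {fst g<..<snd g} {fst g'<..<snd g'}" by (auto simp: disjnt_iff)
    qed
  qed simp
  also have "\<dots> = (\<Sum>(u', v')\<in>S. v' - u')"
    by (intro sum.cong) (auto simp: S_def gaps_def)
  finally show ?thesis using X(2) by (intro exI[of _ S]) (auto simp: S_def)
qed

section \<open>Approximation of the break points and branches\<close>

text \<open>The error may be any constant number of units of size \<open>1 / 2 ^ N\<close>, so sums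
  need no change of precision. The approximations are natural numbers, which confines the notion to
  nonnegative reals; other constants are written as differences.\<close>

definition approximable :: "real \<Rightarrow> bool" where
  "approximable z \<longleftrightarrow> (\<exists>g. rec 1 (\<lambda>e. g (e ! 0)) \<and> (\<exists>C. \<forall>N. \<bar>real (g N) - 2 ^ N * z\<bar> \<le> C))"

lemma approximable_0: "approximable 0"
  unfolding approximable_def
  by (intro exI[of _ "\<lambda>_. 0"] conjI rec_const) auto

lemma approximable_1: "approximable 1"
  unfolding approximable_def
  by (intro exI[of _ "\<lambda>N. 2 ^ N"] conjI rec_power rec_const rec_var) auto

lemma approximable_add:
  assumes "approximable x" "approximable y"
  shows "approximable (x + y)"
proof -
  obtain f g C D where f: "rec 1 (\<lambda>e. f (e ! 0))" "\<And>N. \<bar>real (f N) - 2 ^ N * x\<bar> \<le> C"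
    and g: "rec 1 (\<lambda>e. g (e ! 0))" "\<And>N. \<bar>real (g N) - 2 ^ N * y\<bar> \<le> D"
    using assms unfolding approximable_def by blast
  have "\<bar>real (f N + g N) - 2 ^ N * (x + y)\<bar> \<le> C + D" for N
    using f(2)[of N] g(2)[of N] by (simp add: algebra_simps)
  with rec_add[OF f(1) g(1)] show ?thesis
    unfolding approximable_def by (intro exI[of _ "\<lambda>N. f N + g N"]) blast
qed

lemma approximable_sum:
  "finite S \<Longrightarrow> (\<And>i. i \<in> S \<Longrightarrow> approximable (f i)) \<Longrightarrow> approximable (\<Sum>i\<in>S. f i)"
  by (induction S rule: finite_induct) (auto intro: approximable_0 approximable_add)

lemma nat_div_bound: "\<bar>real (a div b) - real a / real b\<bar> \<le> 1" if "b > 0" for a b :: nat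
proof -
  have "a < b * (a div b + 1)" using dividend_less_times_div[OF that, of a] by simp
  then have "real a < real b * (real (a div b) + 1)"
    by (metis of_nat_1 of_nat_add of_nat_less_iff of_nat_mult)
  then have "real a / real b < real (a div b) + 1"
    using that by (simp add: pos_divide_less_eq mult.commute)
  moreover have "real b * real (a div b) \<le> real a"
    by (metis of_nat_le_iff of_nat_mult times_div_less_eq_dividend)
  then have "real (a div b) \<le> real a / real b"
    using that by (simp add: pos_le_divide_eq mult.commute)
  ultimately show ?thesis by (simp add: abs_le_iff)
qed

text \<open>The rational approximation and the rounded quotient each contribute at most one unit.
  \<open>rnum\<close> replaces a negative approximation by 0, which only brings it closer to
  \<open>z\<close>, as \<open>z\<close> is nonnegative.\<close>

lemma constructive_approximable:
  assumes "constructive z" "z \<ge> 0"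
  shows "approximable z"
proof -
  obtain A where A: "computable_seq rat_code A" "\<And>n. \<bar>of_rat (A n) - z\<bar> < 1 / 2 ^ n"
    using assms(1) by (auto simp: constructive_def)
  let ?g = "\<lambda>N. (2 ^ N * rnum (A N)) div rden (A N)"
  have "rec 1 (\<lambda>e. ?g (e ! 0))"
    by (intro rec_div rec_mult rec_power rec_const rec_var rec_computable_rat[OF A(1)]) simp
  moreover have "\<bar>real (?g N) - 2 ^ N * z\<bar> \<le> 2" for N
  proof -
    obtain a b where ab: "quotient_of (A N) = (a, b)" by (cases "quotient_of (A N)")
    have b: "b > 0" using quotient_of_denom_pos[OF ab] .
    have "(of_rat (A N) :: real) = of_int a / of_int b"
      using quotient_of_div[OF ab] by (simp add: of_rat_divide)
    then have "real (rnum (A N)) / real (rden (A N)) = max (of_rat (A N)) 0"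
      using b by (auto simp: rnum_def rden_def ab max_def divide_le_0_iff zero_le_divide_iff)
    moreover have "\<bar>max r 0 - z\<bar> \<le> \<bar>r - z\<bar>" for r
      using assms(2) by (simp add: max_def)
    ultimately have "\<bar>real (rnum (A N)) / real (rden (A N)) - z\<bar> \<le> 1 / 2 ^ N"
      using A(2)[of N] by (metis less_eq_real_def order_trans)
    then have "2 ^ N * \<bar>real (rnum (A N)) / real (rden (A N)) - z\<bar> \<le> 2 ^ N * (1 / 2 ^ N)"
      by (intro mult_left_mono) auto
    then have "\<bar>2 ^ N * (real (rnum (A N)) / real (rden (A N)) - z)\<bar> \<le> 1"
      by (simp add: abs_mult)
    moreover have "\<bar>real (?g N) - 2 ^ N * real (rnum (A N)) / real (rden (A N))\<bar> \<le> 1"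
      using nat_div_bound[of "rden (A N)" "2 ^ N * rnum (A N)"] b by (simp add: rden_def ab)
    ultimately show ?thesis by (simp add: algebra_simps)
  qed
  ultimately show ?thesis unfolding approximable_def by (intro exI[of _ ?g]) blast
qed

text \<open>An empty interval may have end points anywhere, even negative ones; therefore
  approximability is asserted only for ends in the unit interval.\<close>

lemma constructive_interval_ends:
  assumes "constructive_interval J" "J \<subseteq> {0..1}"
  obtains a b where "J \<subseteq> {a..b}" "{a<..<b} \<subseteq> J" "a \<in> {0..1} \<Longrightarrow> approximable a" "b \<in> {0..1} \<Longrightarrow> approximable b"
proof -
  obtain a b where ab: "constructive a" "constructive b"
    "J = {a..b} \<or> J = {a<..b} \<or> J = {a..<b} \<or> J = {a<..<b}"
    using assms(1) by (auto simp: constructive_interval_def)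
  show ?thesis
    by (rule that[of a b]) (use ab constructive_approximable in auto)
qed

text \<open>\<open>E\<close> collects 0, 1, the discontinuities of \<open>T\<close> and the ends of
  the intervals that make up \<alpha>. Ends of pieces at which \<open>T\<close> is continuous are
  left out; they need not be constructive, and the branches extend across them.\<close>

lemma breakpoints:
  assumes T: "constructive_piecewise_isometry T" and \<alpha>: "constructive_partition \<alpha>"
  obtains E where "finite E" "0 \<in> E" "1 \<in> E" "E \<subseteq> {0..1}" "\<And>z. z \<in> E \<Longrightarrow> approximable z"
    "\<And>u v. (u, v) \<in> gaps E \<Longrightarrow> \<exists>s c. affine_on T {u<..<v} s c"
    "\<And>u v. (u, v) \<in> gaps E \<Longrightarrow> \<exists>i<length \<alpha>. {u<..<v} \<subseteq> \<alpha> ! i"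
proof -
  have "\<forall>S\<in>set \<alpha>. \<exists>F. finite F \<and> S = \<Union>F \<and> (\<forall>J\<in>F. constructive_interval J)"
    using \<alpha> by (simp add: constructive_partition_def)
  then obtain F where F: "\<And>S. S \<in> set \<alpha> \<Longrightarrow> finite (F S)" "\<And>S. S \<in> set \<alpha> \<Longrightarrow> S = \<Union>(F S)"
    "\<And>S J. S \<in> set \<alpha> \<Longrightarrow> J \<in> F S \<Longrightarrow> constructive_interval J"
    by metis
  have part: "\<Union>(set \<alpha>) = {0..1}" using \<alpha> by (simp add: constructive_partition_def partition_on_def)
  define \<J> where "\<J> = (\<Union>S\<in>set \<alpha>. F S)"
  have "\<forall>J\<in>\<J>. \<exists>ab. J \<subseteq> {fst ab..snd ab} \<and> {fst ab<..<snd ab} \<subseteq> J \<and>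
      (fst ab \<in> {0..1} \<longrightarrow> approximable (fst ab)) \<and> (snd ab \<in> {0..1} \<longrightarrow> approximable (snd ab))"
  proof
    fix J assume "J \<in> \<J>"
    then obtain S where S: "S \<in> set \<alpha>" "J \<in> F S" by (auto simp: \<J>_def)
    then have "J \<subseteq> {0..1}" using part F(2) by blast
    from constructive_interval_ends[OF F(3)[OF S] this] show "\<exists>ab. J \<subseteq> {fst ab..snd ab} \<and> {fst ab<..<snd ab} \<subseteq> J \<and>
      (fst ab \<in> {0..1} \<longrightarrow> approximable (fst ab)) \<and> (snd ab \<in> {0..1} \<longrightarrow> approximable (snd ab))"
      by (metis fst_conv snd_conv)
  qed
  then obtain ab where ab: "\<And>J. J \<in> \<J> \<Longrightarrow> J \<subseteq> {fst (ab J)..snd (ab J)}"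
    "\<And>J. J \<in> \<J> \<Longrightarrow> {fst (ab J)<..<snd (ab J)} \<subseteq> J"
    "\<And>J. J \<in> \<J> \<Longrightarrow> fst (ab J) \<in> {0..1} \<Longrightarrow> approximable (fst (ab J))"
    "\<And>J. J \<in> \<J> \<Longrightarrow> snd (ab J) \<in> {0..1} \<Longrightarrow> approximable (snd (ab J))"
    by metis
  define D where "D = {y \<in> {0..1}. \<not> continuous (at y within {0..1}) T}"
  define E where "E = {0, 1} \<union> D \<union> (((fst \<circ> ab) ` \<J> \<union> (snd \<circ> ab) ` \<J>) \<inter> {0..1})"
  have pi: "piecewise_isometry T" "preserves_lebesgue T" "\<And>y. y \<in> D \<Longrightarrow> constructive y"
    using T by (auto simp: constructive_piecewise_isometry_def D_def)
  have finJ: "finite \<J>" using F(1) by (simp add: \<J>_def)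
  show ?thesis
  proof (rule that[of E])
    show "finite E" using finite_discontinuities[OF pi(1)] finJ by (simp add: E_def D_def)
    show "0 \<in> E" "1 \<in> E" by (simp_all add: E_def)
    show E01: "E \<subseteq> {0..1}" by (auto simp: E_def D_def)
    show "approximable z" if "z \<in> E" for z
    proof -
      have "z = 0 \<or> z = 1 \<or> z \<in> D \<or> (\<exists>J\<in>\<J>. (z = fst (ab J) \<or> z = snd (ab J)) \<and> z \<in> {0..1})"
        using that by (auto simp: E_def)
      then consider "z = 0" | "z = 1" | "z \<in> D" | J where "J \<in> \<J>" "z = fst (ab J) \<or> z = snd (ab J)" "z \<in> {0..1}"
        by metis
      then show ?thesis
      proof cases
        case 3
        then have "constructive z" "z \<ge> 0" using pi(3) by (auto simp: D_def)
        then show ?thesis by (rule constructive_approximable)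
      qed (use approximable_0 approximable_1 ab(3,4) in auto)
    qed
    fix u v assume g: "(u, v) \<in> gaps E"
    note uv = gaps_unit[OF g E01]
    have noE: "x \<notin> E" if "x \<in> {u<..<v}" for x using g that by (auto simp: gaps_def)
    show "\<exists>s c. affine_on T {u<..<v} s c"
    proof (rule affine_between_discontinuities[OF pi(1,2) uv(1-3)])
      fix x assume x: "x \<in> {u<..<v}"
      then have "x \<in> {0..1}" using uv(4) by blast
      then show "continuous (at x within {0..1}) T"
        using noE[OF x] by (auto simp: E_def D_def)
    qed
    show "\<exists>i<length \<alpha>. {u<..<v} \<subseteq> \<alpha> ! i"
    proof -
      \<comment> \<open>The midpoint selects one of the intervals \<open>J\<close>; no end of
        \<open>J\<close> lies within the gap, so \<open>J\<close> contains the whole gap.\<close>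
      let ?m = "(u + v) / 2"
      have m: "?m \<in> {u<..<v}" using uv(2) by simp
      then have "?m \<in> \<Union>(set \<alpha>)" using uv(4) part by blast
      then obtain S where S: "S \<in> set \<alpha>" "?m \<in> S" by blast
      then have "?m \<in> \<Union>(F S)" using F(2) by blast
      then obtain J where J: "J \<in> F S" "?m \<in> J" by blast
      then have JJ: "J \<in> \<J>" using S by (auto simp: \<J>_def)
      let ?a = "fst (ab J)" and ?b = "snd (ab J)"
      have in_ab: "?a \<le> ?m" "?m \<le> ?b" using ab(1)[OF JJ] J(2) by auto
      have "?a \<in> {0..1} \<Longrightarrow> ?a \<in> E" "?b \<in> {0..1} \<Longrightarrow> ?b \<in> E"
        using JJ by (auto simp: E_def)
      then have "?a \<notin> {u<..<v}" "?b \<notin> {u<..<v}"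
        using noE uv(4) by blast+
      then have "?a \<le> u" "v \<le> ?b" using in_ab m by auto
      then have "{u<..<v} \<subseteq> J" using ab(2)[OF JJ] by auto
      then have "{u<..<v} \<subseteq> S" using F(2)[OF S(1)] J(1) by blast
      moreover obtain i where "i < length \<alpha>" "\<alpha> ! i = S" using S(1) by (metis in_set_conv_nth)
      ultimately show ?thesis by blast
    qed
  qed
qed

text \<open>A left end of an image is a sum of right ends of gaps minus a sum of left ends.
  Collecting positive and negative terms in \<open>p\<close> and \<open>q\<close> needs only closure
  under addition.\<close>

lemma approximable_branch:
  assumes T: "preserves_lebesgue T" "T \<in> {0..1} \<rightarrow> {0..1}" and E: "finite E" "0 \<in> E" "1 \<in> E" "E \<subseteq> {0..1}"
    and app: "\<And>z. z \<in> E \<Longrightarrow> approximable z"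
    and aff: "\<And>u v. (u, v) \<in> gaps E \<Longrightarrow> affine_on T {u<..<v} (s (u, v)) (c (u, v))"
    and g: "(u, v) \<in> gaps E"
  shows "\<exists>p q. approximable p \<and> approximable q \<and> c (u, v) = p - q"
proof -
  obtain S where S: "S \<subseteq> gaps E" "left_end u v (s (u, v)) (c (u, v)) = (\<Sum>(u', v')\<in>S. v' - u')"
    using left_end_eq[OF T E aff g] by blast
  have fin: "finite S" using S(1) finite_gaps[OF E(1)] finite_subset by blast
  let ?v = "\<Sum>g\<in>S. snd g" and ?u = "\<Sum>g\<in>S. fst g"
  have "fst g \<in> E" "snd g \<in> E" if "g \<in> S" for g
    using S(1) that by (auto simp: gaps_def)
  then have "approximable ?v" "approximable ?u"
    by (blast intro: approximable_sum[OF fin] app)+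
  moreover have "approximable u" "approximable v" using g app by (auto simp: gaps_def)
  moreover have l: "left_end u v (s (u, v)) (c (u, v)) = ?v - ?u"
    unfolding S(2) by (simp add: sum_subtractf case_prod_unfold)
  ultimately show ?thesis
  proof (cases "s (u, v) = 1")
    case True
    then have "c (u, v) = ?v - (?u + u)" using l by (simp add: left_end_def)
    with \<open>approximable ?v\<close> \<open>approximable ?u\<close> \<open>approximable u\<close> show ?thesis
      using approximable_add by blast
  next
    case False
    then have "c (u, v) = (?v + v) - ?u" using l by (simp add: left_end_def)
    with \<open>approximable ?v\<close> \<open>approximable ?u\<close> \<open>approximable v\<close> show ?thesis
      using approximable_add by blast
  qed
qed

section \<open>Coding of itineraries\<close>

definition pick :: "('a \<Rightarrow> bool) \<Rightarrow> ('a \<Rightarrow> nat) \<Rightarrow> 'a list \<Rightarrow> nat" where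
  "pick P F xs = (case find P xs of None \<Rightarrow> 0 | Some x \<Rightarrow> F x)"

text \<open>The list is unrolled into nested conditionals, so its entries may be objects, such as
  pairs of reals, that no program can handle.\<close>

lemma rec_pick:
  assumes "\<And>x. x \<in> set xs \<Longrightarrow> recp l (P x)" "\<And>x. x \<in> set xs \<Longrightarrow> rec l (F x)"
  shows "rec l (\<lambda>e. pick (\<lambda>x. P x e) (\<lambda>x. F x e) xs)"
  using assms
proof (induction xs)
  case Nil
  show ?case by (simp add: pick_def rec_const)
next
  case (Cons x xs)
  then have "rec l (\<lambda>e. if P x e then F x e else pick (\<lambda>x. P x e) (\<lambda>x. F x e) xs)"
    by (intro rec_if) auto
  then show ?case by (rule rec_cong) (simp add: pick_def)
qed

lemma pick_unique:
  "a \<in> set xs \<Longrightarrow> (\<And>y. y \<in> set xs \<Longrightarrow> P y \<longleftrightarrow> y = a) \<Longrightarrow> pick P F xs = F a"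
  by (induction xs) (auto simp: pick_def)

section \<open>Dyadic levels and the code of a point\<close>

definition level :: "nat \<Rightarrow> nat" where
  "level n = (LEAST l. n \<le> 2 ^ l)"

text \<open>The reciprocal of half the clearance at \<open>level n\<close>: the grid of multiples of
  \<open>1 / den n\<close> approximates \<open>x\<close> to within this distance.\<close>

definition den :: "nat \<Rightarrow> nat" where
  "den n = 2 * 2 ^ level n * (level n + 1) ^ 2"

definition clearance :: "nat \<Rightarrow> real" where
  "clearance l = 1 / (2 ^ l * (real l + 1) ^ 2)"

text \<open>A point \<open>x\<close> is described up to time \<open>n\<close> by the \<open>a\<close> with \<open>a / den n \<approx> x\<close>, and the pair \<open>(n, a)\<close>,
  where \<open>a \<le> den n\<close>, by the number \<open>n * (den n + 1) + a\<close>. The latter has about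
  \<open>2 log n + 2 log (log n)\<close> bits.\<close>

definition dec_len :: "nat \<Rightarrow> nat" where
  "dec_len v = (LEAST n. v < (n + 1) * (den (n + 1) + 1))"

definition dec_num :: "nat \<Rightarrow> nat" where
  "dec_num v = v - dec_len v * (den (dec_len v) + 1)"

lemma level_ge: "n \<le> 2 ^ level n"
  unfolding level_def by (rule LeastI[of _ n]) (simp add: less_exp less_imp_le)

lemma level_le: "n \<le> 2 ^ l \<Longrightarrow> level n \<le> l"
  unfolding level_def by (rule Least_le)

lemma level_mono: "m \<le> n \<Longrightarrow> level m \<le> level n"
  using level_ge[of n] by (intro level_le) simp

lemma level_upper:
  assumes "n \<ge> 2"
  shows "2 ^ level n \<le> 2 * n"
proof (cases "level n")
  case (Suc l)
  have "\<not> n \<le> 2 ^ l" using level_le[of n l] Suc by auto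
  with Suc show ?thesis by simp
qed (use assms in simp)

lemma den_pos: "den n > 0"
  by (simp add: den_def)

lemma den_mono: "m \<le> n \<Longrightarrow> den m \<le> den n"
  unfolding den_def using level_mono[of m n] by (intro mult_mono power_mono power_increasing) auto

lemma real_den: "real (den n) = 2 / clearance (level n)"
  by (simp add: den_def clearance_def)

text \<open>The codes of length \<open>n\<close> form a block of \<open>den n + 1\<close> numbers
  from \<open>n * (den n + 1)\<close> on. Since \<open>den\<close> is monotone, the next block
  starts after its end, so the length is determined by the code.\<close>

lemma dec_code:
  assumes "a \<le> den n"
  shows "dec_len (n * (den n + 1) + a) = n" and "dec_num (n * (den n + 1) + a) = a"
proof -
  show "dec_len (n * (den n + 1) + a) = n"
    unfolding dec_len_def
  proof (rule Least_equality)
    have "n * (den n + 1) + a < (n + 1) * (den n + 1)" using assms by simp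
    also have "\<dots> \<le> (n + 1) * (den (n + 1) + 1)" using den_mono[of n "n + 1"] by (intro mult_le_mono2) simp
    finally show "n * (den n + 1) + a < (n + 1) * (den (n + 1) + 1)" .
    fix y assume y: "n * (den n + 1) + a < (y + 1) * (den (y + 1) + 1)"
    show "n \<le> y"
    proof (rule ccontr)
      assume "\<not> n \<le> y"
      then have "(y + 1) * (den (y + 1) + 1) \<le> n * (den n + 1)"
        using den_mono[of "y + 1" n] by (intro mult_mono) auto
      with y show False by simp
    qed
  qed
  then show "dec_num (n * (den n + 1) + a) = a" by (simp add: dec_num_def)
qed

lemma rec_level: "rec l f \<Longrightarrow> rec l (\<lambda>e. level (f e))"
  unfolding level_def
proof (rule rec_Least)
  assume f: "rec l f"
  show "recp (Suc l) (\<lambda>e. f (tl e) \<le> 2 ^ hd e)"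
    by (intro rec_intros rec_const rec_tl[OF f])
  show "\<exists>v. f e \<le> 2 ^ v" for e by (rule exI[of _ "f e"]) (simp add: less_imp_le)
qed

lemma rec_den: "rec l f \<Longrightarrow> rec l (\<lambda>e. den (f e))"
  unfolding den_def by (intro rec_intros rec_const rec_level)

lemma rec_dec_len: "rec l f \<Longrightarrow> rec l (\<lambda>e. dec_len (f e))"
  unfolding dec_len_def
proof (rule rec_Least)
  assume f: "rec l f"
  show "recp (Suc l) (\<lambda>e. f (tl e) < (hd e + 1) * (den (hd e + 1) + 1))"
    by (intro rec_intros rec_const rec_den rec_tl[OF f])
  show "\<exists>v. f e < (v + 1) * (den (v + 1) + 1)" for e by (rule exI[of _ "f e"]) simp
qed

lemma rec_dec_num: "rec l f \<Longrightarrow> rec l (\<lambda>e. dec_num (f e))"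
  unfolding dec_num_def by (intro rec_intros rec_const rec_den rec_dec_len)

section \<open>Integer simulation of the orbit\<close>

locale orbit_coding =
  fixes T :: "real \<Rightarrow> real" and \<alpha> :: "real set list" and E :: "real set"
    and s c :: "real \<times> real \<Rightarrow> real" and \<iota> :: "real \<times> real \<Rightarrow> nat"
    and app :: "real \<Rightarrow> nat \<Rightarrow> nat" and p q :: "real \<times> real \<Rightarrow> nat \<Rightarrow> nat"
    and gs :: "(real \<times> real) list" and K :: real
  assumes T: "T \<in> {0..1} \<rightarrow> {0..1}"
    and \<alpha>: "distinct \<alpha>" "partition_on {0..1} (set \<alpha>)"
    and E: "finite E" "0 \<in> E" "1 \<in> E" "E \<subseteq> {0..1}"
    and gs: "set gs = gaps E"
    and aff: "g \<in> gaps E \<Longrightarrow> affine_on T {fst g<..<snd g} (s g) (c g)"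
    and \<iota>: "g \<in> gaps E \<Longrightarrow> \<iota> g < length \<alpha>" "g \<in> gaps E \<Longrightarrow> {fst g<..<snd g} \<subseteq> \<alpha> ! \<iota> g"
    and app: "z \<in> E \<Longrightarrow> rec 1 (\<lambda>e. app z (e ! 0))" "z \<in> E \<Longrightarrow> \<bar>real (app z N) - 2 ^ N * z\<bar> \<le> K"
    and pq: "g \<in> gaps E \<Longrightarrow> rec 1 (\<lambda>e. p g (e ! 0))" "g \<in> gaps E \<Longrightarrow> rec 1 (\<lambda>e. q g (e ! 0))"
      "g \<in> gaps E \<Longrightarrow> \<bar>real (p g N) - real (q g N) - 2 ^ N * c g\<bar> \<le> K"
begin

definition inside :: "nat \<Rightarrow> nat \<Rightarrow> real \<times> real \<Rightarrow> bool" where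
  "inside N X g \<longleftrightarrow> app (fst g) N < X \<and> X < app (snd g) N"

text \<open>The translation constant may be negative and is represented by \<open>p g - q g\<close>.
  Everything to be added is added before the single subtraction, so truncation can affect only the
  final result.\<close>

definition branch :: "nat \<Rightarrow> nat \<Rightarrow> real \<times> real \<Rightarrow> nat" where
  "branch N X g = (if s g = 1 then X + p g N - q g N else p g N - (X + q g N))"

definition step :: "nat \<Rightarrow> nat \<Rightarrow> nat" where
  "step N X = pick (inside N X) (branch N X) gs"

definition symbol :: "nat \<Rightarrow> nat \<Rightarrow> nat" where
  "symbol N X = pick (inside N X) \<iota> gs"

text \<open>With \<open>l\<close> the level, the rounding errors add up to about
  \<open>2 ^ l * K\<close> units, while at this precision the clearance amounts to
  \<open>4 ^ l / (l + 1)\<^sup>2\<close> units. At precision \<open>2 * l\<close> it would be only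
  \<open>2 ^ l / (l + 1)\<^sup>2\<close> units, which is too little.\<close>

definition prec :: "nat \<Rightarrow> nat" where
  "prec v = 3 * level (dec_len v)"

definition out :: "nat \<Rightarrow> nat \<Rightarrow> nat" where
  "out v j = symbol (prec v) ((step (prec v) ^^ j) (dec_num v * 2 ^ prec v div den (dec_len v)))"

lemma rec_inside:
  assumes "rec l f" "rec l h" "g \<in> set gs"
  shows "recp l (\<lambda>e. inside (f e) (h e) g)"
proof -
  have "fst g \<in> E" "snd g \<in> E" using assms(3) gs by (auto simp: gaps_def)
  from rec_comp1[OF app(1)[OF this(1)] assms(1)] rec_comp1[OF app(1)[OF this(2)] assms(1)]
  show ?thesis unfolding inside_def by (intro recp_conj recp_less assms)
qed

lemma rec_branch:
  assumes "rec l f" "rec l h" "g \<in> set gs"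
  shows "rec l (\<lambda>e. branch (f e) (h e) g)"
proof -
  have "g \<in> gaps E" using assms(3) gs by simp
  from rec_comp1[OF pq(1)[OF this] assms(1)] rec_comp1[OF pq(2)[OF this] assms(1)]
  show ?thesis unfolding branch_def by (cases "s g = 1") (simp_all add: rec_add rec_diff assms)
qed

lemma rec_step: "rec l f \<Longrightarrow> rec l h \<Longrightarrow> rec l (\<lambda>e. step (f e) (h e))"
  unfolding step_def by (intro rec_pick rec_inside rec_branch)

lemma rec_symbol: "rec l f \<Longrightarrow> rec l h \<Longrightarrow> rec l (\<lambda>e. symbol (f e) (h e))"
  unfolding symbol_def by (intro rec_pick rec_inside rec_const)

lemma rec_prec: "rec l f \<Longrightarrow> rec l (\<lambda>e. prec (f e))"
  unfolding prec_def by (intro rec_intros rec_const rec_level rec_dec_len)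

lemma rec_out: "rec l f \<Longrightarrow> rec l h \<Longrightarrow> rec l (\<lambda>e. out (f e) (h e))"
  unfolding out_def
  by (intro rec_symbol rec_prec rec_iter[where F = "\<lambda>e. step (prec (f e))"] rec_step rec_hd
      rec_div rec_mult rec_power rec_const rec_dec_num rec_den rec_dec_len)
    (assumption | erule rec_tl)+

text \<open>The distance of \<open>x\<close> from \<open>E\<close> exceeds the error of
  \<open>X\<close> plus the error of the approximate break points. Every integer comparison then has
  the same outcome as the comparison of the reals, and only the gap around \<open>x\<close> passes
  the test.\<close>

lemma pick_inside:
  assumes g: "(u, v) \<in> gaps E" "u < x" "x < v"
    and sep: "\<And>z. z \<in> E \<Longrightarrow> err + K < 2 ^ N * \<bar>x - z\<bar>" and X: "\<bar>real X - 2 ^ N * x\<bar> \<le> err"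
  shows "pick (inside N X) F gs = F (u, v)"
proof (rule pick_unique)
  have less: "app z N < X" if "z \<in> E" "z < x" for z
    using app(2)[OF that(1), of N] sep[OF that(1)] X that(2) by (simp add: algebra_simps abs_le_iff)
  have greater: "X < app z N" if "z \<in> E" "x < z" for z
    using app(2)[OF that(1), of N] sep[OF that(1)] X that(2) by (simp add: algebra_simps abs_le_iff)
  show "(u, v) \<in> set gs" using g(1) gs by simp
  fix y assume y: "y \<in> set gs"
  then have yE: "fst y \<in> E" "snd y \<in> E" using gs by (auto simp: gaps_def)
  show "inside N X y \<longleftrightarrow> y = (u, v)"
  proof
    assume "y = (u, v)"
    then show "inside N X y" using yE g less greater by (simp add: inside_def)
  next
    assume ins: "inside N X y"
    show "y = (u, v)"
    proof (rule ccontr)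
      assume "y \<noteq> (u, v)"
      then have "snd y \<le> u \<or> v \<le> fst y"
        using gaps_ordered[of "fst y" "snd y" E u v] y gs g(1) by auto
      then have "snd y < x \<or> x < fst y" using g by auto
      then show False using less greater yE ins by (auto simp: inside_def dest: less_asym)
    qed
  qed
qed

lemma step_bound:
  assumes g: "(u, v) \<in> gaps E" "u < x" "x < v"
    and sep: "\<And>z. z \<in> E \<Longrightarrow> err + K < 2 ^ N * \<bar>x - z\<bar>" and X: "\<bar>real X - 2 ^ N * x\<bar> \<le> err"
  shows "\<bar>real (step N X) - 2 ^ N * T x\<bar> \<le> err + K"
proof -
  let ?g = "(u, v)"
  have eq: "step N X = branch N X ?g"
    unfolding step_def by (rule pick_inside[OF g sep X])
  have Tx: "T x = s ?g * x + c ?g" "s ?g = 1 \<or> s ?g = -1"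
    using aff[OF g(1)] g(2,3) by (auto simp: affine_on_def)
  have "x \<in> {0..1}" using gaps_unit(4)[OF g(1) E(4)] g(2,3) by auto
  then have "T x \<in> {0..1}" using T by blast
  then have "T x \<ge> 0" by simp
  then have pos: "0 \<le> 2 ^ N * T x" by simp
  \<comment> \<open>The target \<open>2 ^ N * T x\<close> is nonnegative, so replacing a negative
    difference by 0 does not increase the error.\<close>
  have trunc: "\<bar>real (a - b) - t\<bar> \<le> \<bar>real a - real b - t\<bar>" if "t \<ge> 0" for a b :: nat and t
    using that by (cases "b \<le> a") (auto simp: of_nat_diff)
  note pq' = pq(3)[OF g(1), of N]
  show ?thesis
  proof (cases "s ?g = 1")
    case True
    have "\<bar>real (X + p ?g N - q ?g N) - 2 ^ N * T x\<bar> \<le> \<bar>real (X + p ?g N) - real (q ?g N) - 2 ^ N * T x\<bar>"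
      by (rule trunc[OF pos])
    also have "\<dots> = \<bar>(real X - 2 ^ N * x) + (real (p ?g N) - real (q ?g N) - 2 ^ N * c ?g)\<bar>"
      using Tx(1) True by (simp add: algebra_simps)
    also have "\<dots> \<le> err + K" using X pq' by linarith
    finally show ?thesis by (simp add: eq branch_def True)
  next
    case False
    then have s: "s ?g = -1" using Tx(2) by simp
    have "\<bar>real (p ?g N - (X + q ?g N)) - 2 ^ N * T x\<bar> \<le> \<bar>real (p ?g N) - real (X + q ?g N) - 2 ^ N * T x\<bar>"
      by (rule trunc[OF pos])
    also have "\<dots> = \<bar>(real (p ?g N) - real (q ?g N) - 2 ^ N * c ?g) - (real X - 2 ^ N * x)\<bar>"
      unfolding Tx(1) s by (simp add: algebra_simps)
    also have "\<dots> \<le> err + K" using X pq' by linarith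
    finally show ?thesis by (simp add: eq branch_def s)
  qed
qed

lemma orbit_unit: "x \<in> {0..1} \<Longrightarrow> (T ^^ j) x \<in> {0..1}"
  using T by (induction j) auto

lemma K_nonneg: "K \<ge> 0"
  using app(2)[OF E(2), of 0] by linarith

lemma orbit_gap:
  assumes x: "x \<in> {0..1}" and sep: "\<And>z. z \<in> E \<Longrightarrow> err < 2 ^ N * \<bar>(T ^^ j) x - z\<bar>" and err: "err \<ge> 0"
  obtains u v where "(u, v) \<in> gaps E" "u < (T ^^ j) x" "(T ^^ j) x < v"
proof -
  have "(T ^^ j) x \<notin> E" using sep[of "(T ^^ j) x"] err by auto
  from gaps_cover[OF E(1-3) orbit_unit[OF x] this] show ?thesis using that by blast
qed

text \<open>Slopes have modulus 1, so each step adds at most \<open>K\<close> to the error. The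
  separation covers the error accumulated so far together with that of the break points in the next
  comparison.\<close>

lemma orbit_bound:
  assumes x: "x \<in> {0..1}" and sep: "\<And>j z. j < n \<Longrightarrow> z \<in> E \<Longrightarrow> err + real (n + 1) * K < 2 ^ N * \<bar>(T ^^ j) x - z\<bar>"
    and X: "\<bar>real X - 2 ^ N * x\<bar> \<le> err" and j: "j \<le> n"
  shows "\<bar>real ((step N ^^ j) X) - 2 ^ N * (T ^^ j) x\<bar> \<le> err + real j * K"
  using j
proof (induction j)
  case (Suc j)
  have "err \<ge> 0" using X by linarith
  have "real j * K \<le> real n * K" using Suc.prems K_nonneg by (intro mult_right_mono) auto
  then have sep': "err + real j * K + K < 2 ^ N * \<bar>(T ^^ j) x - z\<bar>" if "z \<in> E" for z
    using sep[of j z] that Suc.prems by (simp add: algebra_simps)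
  have "0 \<le> err + real j * K + K" using \<open>err \<ge> 0\<close> K_nonneg by simp
  from orbit_gap[OF x sep' this] obtain u v where g: "(u, v) \<in> gaps E" "u < (T ^^ j) x" "(T ^^ j) x < v" .
  have "\<bar>real ((step N ^^ j) X) - 2 ^ N * (T ^^ j) x\<bar> \<le> err + real j * K" using Suc by simp
  from step_bound[OF g sep' this]
  have "\<bar>real (step N ((step N ^^ j) X)) - 2 ^ N * T ((T ^^ j) x)\<bar> \<le> err + real j * K + K" .
  then show ?case by (simp add: algebra_simps)
qed (use X in simp)

lemma orbit_symbol:
  assumes x: "x \<in> {0..1}" and sep: "\<And>j z. j < n \<Longrightarrow> z \<in> E \<Longrightarrow> err + real (n + 1) * K < 2 ^ N * \<bar>(T ^^ j) x - z\<bar>"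
    and X: "\<bar>real X - 2 ^ N * x\<bar> \<le> err" and j: "j < n"
  shows "symbol N ((step N ^^ j) X) = (THE i. i < length \<alpha> \<and> (T ^^ j) x \<in> \<alpha> ! i)"
    and "symbol N ((step N ^^ j) X) < length \<alpha>"
proof -
  let ?y = "(T ^^ j) x"
  have "err \<ge> 0" using X by linarith
  have "real j * K \<le> real n * K" using j K_nonneg by (intro mult_right_mono) auto
  then have sep': "err + real j * K + K < 2 ^ N * \<bar>?y - z\<bar>" if "z \<in> E" for z
    using sep[of j z] that j by (simp add: algebra_simps)
  have "0 \<le> err + real j * K + K" using \<open>err \<ge> 0\<close> K_nonneg by simp
  from orbit_gap[OF x sep' this] obtain u v where g: "(u, v) \<in> gaps E" "u < ?y" "?y < v" .
  have b: "\<bar>real ((step N ^^ j) X) - 2 ^ N * ?y\<bar> \<le> err + real j * K"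
    using j by (intro orbit_bound[OF x sep X]) auto
  have sym: "symbol N ((step N ^^ j) X) = \<iota> (u, v)"
    unfolding symbol_def by (rule pick_inside[OF g sep' b])
  note i = \<iota>(1)[OF g(1)]
  show "symbol N ((step N ^^ j) X) < length \<alpha>" unfolding sym by (rule i)
  have mem: "?y \<in> \<alpha> ! \<iota> (u, v)" using \<iota>(2)[OF g(1)] g(2,3) by auto
  show "symbol N ((step N ^^ j) X) = (THE i. i < length \<alpha> \<and> ?y \<in> \<alpha> ! i)"
    unfolding sym
  proof (rule the_equality[symmetric])
    show "\<iota> (u, v) < length \<alpha> \<and> ?y \<in> \<alpha> ! \<iota> (u, v)" using i mem ..
    fix i' assume i': "i' < length \<alpha> \<and> ?y \<in> \<alpha> ! i'"
    have "\<alpha> ! i' = \<alpha> ! \<iota> (u, v)"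
    proof (rule ccontr)
      assume "\<alpha> ! i' \<noteq> \<alpha> ! \<iota> (u, v)"
      from disjointD[OF partition_onD2[OF \<alpha>(2)] nth_mem nth_mem[OF i] this] i'
      have "\<alpha> ! i' \<inter> \<alpha> ! \<iota> (u, v) = {}" by blast
      with i' mem show False by blast
    qed
    then show "i' = \<iota> (u, v)" using nth_eq_iff_index_eq[OF \<alpha>(1)] i' i by blast
  qed
qed

text \<open>In units of the working precision the clearance is twice
  \<open>2 ^ N / real (den n)\<close>, where \<open>N\<close> is the precision. One half pays for
  replacing \<open>x\<close> by a grid point; by \<open>good\<close> the other half pays for all
  rounding, including the initial unit from the integer division.\<close>

lemma itinerary_code:
  assumes x: "x \<in> {0..1}" and n: "n \<ge> 1"
    and good: "1 + (2 ^ level n + 1) * K \<le> 4 ^ level n / (2 * (real (level n) + 1) ^ 2)"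
    and sep: "\<And>j z. j < 2 ^ level n \<Longrightarrow> z \<in> E \<Longrightarrow> clearance (level n) < \<bar>(T ^^ j) x - z\<bar>"
  shows "\<exists>v\<ge>1. v < (n + 1) * (den n + 1) \<and> map (out v) [0..<dec_len v] = itinerary T \<alpha> x n \<and>
    (\<forall>j<dec_len v. out v j < length \<alpha>)"
proof -
  let ?l = "level n"
  let ?N = "3 * ?l"
  \<comment> \<open>At \<open>x = 1\<close> this is \<open>den n\<close> itself, so there are
    \<open>den n + 1\<close> possible values, the factor used in the code.\<close>
  define a where "a = nat \<lfloor>x * real (den n)\<rfloor>"
  define v where "v = n * (den n + 1) + a"
  have den: "real (den n) > 0" using den_pos by simp
  have xd: "0 \<le> x * real (den n)" "x * real (den n) \<le> real (den n)"
    using x by (auto intro: mult_left_le_one_le)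
  have a: "real a \<le> x * real (den n)" "x * real (den n) < real a + 1"
    using xd(1) by (simp_all add: a_def of_nat_nat)
  then have a_le: "a \<le> den n" using xd(2) by linarith
  note dec = dec_code[OF a_le, folded v_def]
  have prec: "prec v = ?N" by (simp add: prec_def dec)
  let ?X = "a * 2 ^ ?N div den n"
  let ?err = "2 ^ ?N / real (den n) + 1"
  have X: "\<bar>real ?X - 2 ^ ?N * x\<bar> \<le> ?err"
  proof -
    have 1: "\<bar>real ?X - real (a * 2 ^ ?N) / real (den n)\<bar> \<le> 1"
      by (rule nat_div_bound[OF den_pos])
    have "\<bar>real a / real (den n) - x\<bar> \<le> 1 / real (den n)"
    proof -
      have "real a / real (den n) - x = (real a - x * real (den n)) / real (den n)"
        using den by (simp add: field_simps)
      then show ?thesis using a den by (simp add: abs_divide divide_right_mono)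
    qed
    then have "2 ^ ?N * \<bar>real a / real (den n) - x\<bar> \<le> 2 ^ ?N * (1 / real (den n))"
      by (intro mult_left_mono) auto
    moreover have "real (a * 2 ^ ?N) / real (den n) - 2 ^ ?N * x = 2 ^ ?N * (real a / real (den n) - x)"
      by (simp add: algebra_simps)
    ultimately have "\<bar>real (a * 2 ^ ?N) / real (den n) - 2 ^ ?N * x\<bar> \<le> 2 ^ ?N / real (den n)"
      by (simp add: abs_mult)
    with 1 show ?thesis by linarith
  qed
  have ratio: "2 ^ ?N / real (den n) = 4 ^ ?l / (2 * (real ?l + 1) ^ 2)"
  proof -
    have "(2::real) ^ ?N = 2 ^ ?l * 4 ^ ?l" by (simp add: power_mult power_mult_distrib[symmetric])
    then show ?thesis by (simp add: den_def)
  qed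
  have sepN: "?err + real (n + 1) * K < 2 ^ ?N * \<bar>(T ^^ j) x - z\<bar>" if "j < n" "z \<in> E" for j z
  proof -
    have "j < 2 ^ ?l" using that(1) level_ge[of n] by simp
    from sep[OF this that(2)] have "2 ^ ?N * clearance ?l < 2 ^ ?N * \<bar>(T ^^ j) x - z\<bar>"
      by (intro mult_strict_left_mono) auto
    moreover have "2 ^ ?N * clearance ?l = 2 * (2 ^ ?N / real (den n))"
      by (simp add: real_den)
    moreover have "real (n + 1) * K \<le> (2 ^ ?l + 1) * K"
    proof (intro mult_right_mono K_nonneg)
      show "real (n + 1) \<le> 2 ^ ?l + 1"
        using level_ge[of n] by (metis add_le_cancel_right of_nat_1 of_nat_add of_nat_le_iff of_nat_numeral of_nat_power)
    qed
    ultimately show ?thesis using good ratio by linarith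
  qed
  note orb = orbit_symbol[where err = ?err and N = ?N and X = ?X, OF x sepN X]
  have out: "out v j = symbol ?N ((step ?N ^^ j) ?X)" for j
    by (simp add: out_def prec dec)
  have "map (out v) [0..<dec_len v] = itinerary T \<alpha> x n"
    using orb(1) by (simp add: out dec(1) itinerary_def)
  moreover have "\<forall>j<dec_len v. out v j < length \<alpha>"
    using orb(2) by (simp add: out dec(1))
  moreover have "v \<ge> 1" using n by (simp add: v_def)
  moreover have "v < (n + 1) * (den n + 1)" using a_le by (simp add: v_def)
  ultimately show ?thesis by blast
qed

end

section \<open>Almost every orbit keeps clear of the break points\<close>

lemma preserves_funpow:
  assumes T: "preserves_lebesgue T"
  shows "T ^^ j \<in> measurable (lebesgue_on {0..1}) (lebesgue_on {0..1})"
    and "B \<in> sets (lebesgue_on {0..1}) \<Longrightarrow>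
      emeasure (lebesgue_on {0..1}) ((T ^^ j) -` B \<inter> {0..1}) = emeasure (lebesgue_on {0..1}) B"
proof -
  let ?M = "lebesgue_on {0..1::real}"
  have Tm: "T \<in> measurable ?M ?M" using T by (simp add: preserves_lebesgue_def)
  have meas: "T ^^ j \<in> measurable ?M ?M" for j
  proof (induction j)
    case (Suc j)
    from measurable_comp[OF this Tm] show ?case by (simp only: funpow.simps)
  qed (simp add: id_def)
  then show "T ^^ j \<in> measurable ?M ?M" .
  show "emeasure ?M ((T ^^ j) -` B \<inter> {0..1}) = emeasure ?M B" if B: "B \<in> sets ?M"
  proof (induction j)
    case 0
    have "B \<subseteq> {0..1}" using sets.sets_into_space[OF B] by simp
    then show ?case by (simp add: Int_absorb2)
  next
    case (Suc j)
    have "T ` {0..1} \<subseteq> {0..1}" using measurable_space[OF Tm] by auto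
    then have eq: "(T ^^ Suc j) -` B \<inter> {0..1} = T -` ((T ^^ j) -` B \<inter> {0..1}) \<inter> {0..1}"
      unfolding funpow_Suc_right by auto
    have "(T ^^ j) -` B \<inter> {0..1} \<in> sets ?M"
      using measurable_sets[OF meas[of j] B] by simp
    then have "emeasure ?M (T -` ((T ^^ j) -` B \<inter> {0..1}) \<inter> {0..1}) = emeasure ?M ((T ^^ j) -` B \<inter> {0..1})"
      using T unfolding preserves_lebesgue_def by blast
    then show ?case unfolding eq Suc.IH .
  qed
qed

text \<open>By invariance each preimage of a neighbourhood has measure at most
  \<open>2 * clearance l\<close>, whatever \<open>j\<close> is. There are
  \<open>2 ^ l * card E\<close> of them at level \<open>l\<close>; the power of 2 cancels, and what
  remains is a constant times \<open>1 / (l + 1)\<^sup>2\<close>.\<close>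

lemma AE_orbit_avoids:
  assumes T: "preserves_lebesgue T" and E: "finite E"
  shows "AE x in lebesgue_on {0..1}. \<forall>\<^sub>F l in sequentially. \<forall>j<2 ^ l. \<forall>z\<in>E. clearance l < \<bar>(T ^^ j) x - z\<bar>"
proof -
  let ?M = "lebesgue_on {0..1::real}"
  interpret finite_measure ?M by (rule finite_measure_lebesgue_on) simp
  define B where "B l z = {z - clearance l..z + clearance l} \<inter> {0..1}" for l and z :: real
  define A where "A l = (\<Union>(j, z)\<in>{..<2 ^ l} \<times> E. (T ^^ j) -` B l z \<inter> {0..1})" for l
  have clearance: "clearance l > 0" for l by (simp add: clearance_def)
  have B: "B l z \<in> sets ?M" for l z
    by (simp add: B_def sets_restrict_space_iff)
  have pre: "(T ^^ j) -` B l z \<inter> {0..1} \<in> sets ?M" for j l z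
    using measurable_sets[OF preserves_funpow(1)[OF T] B] by simp
  then have A: "A l \<in> sets ?M" for l
    unfolding A_def using E by (intro sets.finite_UN) auto
  have "measure ?M ((T ^^ j) -` B l z \<inter> {0..1}) \<le> 2 * clearance l" for j l z
  proof -
    have "measure ?M ((T ^^ j) -` B l z \<inter> {0..1}) = measure ?M (B l z)"
      using preserves_funpow(2)[OF T B] by (simp add: measure_def)
    also have "\<dots> = measure lebesgue (B l z)"
      by (intro measure_restrict_space) (auto simp: B_def)
    also have "\<dots> \<le> measure lebesgue {z - clearance l..z + clearance l}"
      by (intro measure_mono_fmeasurable) (auto simp: B_def)
    also have "\<dots> = 2 * clearance l" using clearance[of l] by simp
    finally show ?thesis .
  qed
  then have "measure ?M (A l) \<le> (\<Sum>(j, z)\<in>{..<(2::nat) ^ l} \<times> E. 2 * clearance l)" for l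
    unfolding A_def using pre E
    by (intro order_trans[OF finite_measure_subadditive_finite] sum_mono) auto
  moreover have "(\<Sum>(j, z)\<in>{..<(2::nat) ^ l} \<times> E. 2 * clearance l) = 2 * real (card E) * inverse (real (Suc l) ^ 2)" for l
    by (simp add: clearance_def card_cartesian_product field_simps)
  ultimately have le: "measure ?M (A l) \<le> 2 * real (card E) * inverse (real (Suc l) ^ 2)" for l
    by metis
  have "summable (\<lambda>l. 2 * real (card E) * inverse (real (Suc l) ^ 2))"
    using inverse_power_summable[of 2, where 'a = real]
    by (intro summable_mult, subst summable_Suc_iff[of "\<lambda>n. inverse (real n ^ 2)"]) simp
  then have "summable (\<lambda>l. measure ?M (A l))"
    by (rule summable_comparison_test') (use le in auto)
  then have "AE x in ?M. \<forall>\<^sub>F l in sequentially. x \<in> space ?M - A l"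
    using A by (intro borel_cantelli_AE1) (auto simp: emeasure_eq_measure)
  then show ?thesis
  proof (rule AE_mp, intro AE_I2 impI)
    fix x assume x: "x \<in> space ?M" and ev: "\<forall>\<^sub>F l in sequentially. x \<in> space ?M - A l"
    from ev show "\<forall>\<^sub>F l in sequentially. \<forall>j<2 ^ l. \<forall>z\<in>E. clearance l < \<bar>(T ^^ j) x - z\<bar>"
    proof eventually_elim
      case (elim l)
      show ?case
      proof (intro allI impI ballI, rule ccontr)
        fix j :: nat and z assume jz: "j < 2 ^ l" "z \<in> E" "\<not> clearance l < \<bar>(T ^^ j) x - z\<bar>"
        have "(T ^^ j) x \<in> {0..1}"
          using measurable_space[OF preserves_funpow(1)[OF T] x] by simp
        then have "(T ^^ j) x \<in> B l z" using jz(3) by (auto simp: B_def abs_le_iff not_less)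
        then have "x \<in> A l" using jz(1,2) x by (auto simp: A_def)
        with elim show False by simp
      qed
    qed
  qed
qed

lemma ex_orbit_coding:
  assumes T: "constructive_piecewise_isometry T" and \<alpha>: "constructive_partition \<alpha>"
  obtains E s c \<iota> app p q gs K where "orbit_coding T \<alpha> E s c \<iota> app p q gs K"
proof -
  obtain E where E: "finite E" "0 \<in> E" "1 \<in> E" "E \<subseteq> {0..1}" and approx: "\<And>z. z \<in> E \<Longrightarrow> approximable z"
    and aff: "\<And>u v. (u, v) \<in> gaps E \<Longrightarrow> \<exists>s c. affine_on T {u<..<v} s c"
    and idx: "\<And>u v. (u, v) \<in> gaps E \<Longrightarrow> \<exists>i<length \<alpha>. {u<..<v} \<subseteq> \<alpha> ! i"
    using breakpoints[OF T \<alpha>] by metis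
  have T': "preserves_lebesgue T" "T \<in> {0..1} \<rightarrow> {0..1}"
    using T by (auto simp: constructive_piecewise_isometry_def piecewise_isometry_def)
  obtain gs where gs: "set gs = gaps E" using finite_list[OF finite_gaps[OF E(1)]] by blast
  have "\<forall>g. \<exists>sc. g \<in> gaps E \<longrightarrow> affine_on T {fst g<..<snd g} (fst sc) (snd sc)"
    using aff by (metis fst_conv snd_conv prod.collapse)
  then obtain sc where sc: "\<And>g. g \<in> gaps E \<Longrightarrow> affine_on T {fst g<..<snd g} (fst (sc g)) (snd (sc g))"
    by metis
  have "\<forall>g. \<exists>i. g \<in> gaps E \<longrightarrow> i < length \<alpha> \<and> {fst g<..<snd g} \<subseteq> \<alpha> ! i"
    using idx by (metis prod.collapse)
  then obtain \<iota> where \<iota>: "\<And>g. g \<in> gaps E \<Longrightarrow> \<iota> g < length \<alpha> \<and> {fst g<..<snd g} \<subseteq> \<alpha> ! \<iota> g"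
    by metis
  have "\<forall>z. \<exists>f C. z \<in> E \<longrightarrow> rec 1 (\<lambda>e. f (e ! 0)) \<and> (\<forall>N. \<bar>real (f N) - 2 ^ N * z\<bar> \<le> C)"
    using approx unfolding approximable_def by blast
  then obtain app C where app: "\<And>z. z \<in> E \<Longrightarrow> rec 1 (\<lambda>e. app z (e ! 0))"
    "\<And>z N. z \<in> E \<Longrightarrow> \<bar>real (app z N) - 2 ^ N * z\<bar> \<le> C z"
    by metis
  have "\<exists>p q D. rec 1 (\<lambda>e. p (e ! 0)) \<and> rec 1 (\<lambda>e. q (e ! 0)) \<and>
      (\<forall>N. \<bar>real (p N) - real (q N) - 2 ^ N * snd (sc g)\<bar> \<le> D)" if g: "g \<in> gaps E" for g
  proof -
    obtain a b where ab: "approximable a" "approximable b" "snd (sc g) = a - b"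
      using approximable_branch[OF T' E approx, of "\<lambda>g. fst (sc g)" "\<lambda>g. snd (sc g)" "fst g" "snd g"] sc g
      by (metis fst_conv snd_conv prod.collapse)
    obtain p q C D where "rec 1 (\<lambda>e. p (e ! 0))" "\<And>N. \<bar>real (p N) - 2 ^ N * a\<bar> \<le> C"
      "rec 1 (\<lambda>e. q (e ! 0))" "\<And>N. \<bar>real (q N) - 2 ^ N * b\<bar> \<le> D"
      using ab(1,2) unfolding approximable_def by blast
    note pq = this
    have "\<bar>real (p N) - real (q N) - 2 ^ N * snd (sc g)\<bar> \<le> C + D" for N
      using pq(2)[of N] pq(4)[of N] unfolding ab(3) right_diff_distrib by linarith
    with pq(1,3) show ?thesis by blast
  qed
  then have "\<forall>g. \<exists>p q D. g \<in> gaps E \<longrightarrow> rec 1 (\<lambda>e. p (e ! 0)) \<and> rec 1 (\<lambda>e. q (e ! 0)) \<and>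
      (\<forall>N. \<bar>real (p N) - real (q N) - 2 ^ N * snd (sc g)\<bar> \<le> D)" by blast
  then obtain p q D where pq: "\<And>g. g \<in> gaps E \<Longrightarrow> rec 1 (\<lambda>e. p g (e ! 0))"
    "\<And>g. g \<in> gaps E \<Longrightarrow> rec 1 (\<lambda>e. q g (e ! 0))"
    "\<And>g N. g \<in> gaps E \<Longrightarrow> \<bar>real (p g N) - real (q g N) - 2 ^ N * snd (sc g)\<bar> \<le> D g"
    by metis
  \<comment> \<open>Finitely many approximations are involved, so one error bound serves all of
    them; the set is nonempty because \<open>E\<close> is.\<close>
  define K where "K = Max (C ` E \<union> D ` gaps E)"
  have fin: "finite (C ` E \<union> D ` gaps E)" using E(1) finite_gaps by blast
  have K: "z \<in> E \<Longrightarrow> C z \<le> K" "g \<in> gaps E \<Longrightarrow> D g \<le> K" for z g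
    unfolding K_def using fin by (auto intro: Max_ge)
  have "orbit_coding T \<alpha> E (fst \<circ> sc) (snd \<circ> sc) \<iota> app p q gs K"
  proof
    show "T \<in> {0..1} \<rightarrow> {0..1}" by (rule T')
    show "distinct \<alpha>" "partition_on {0..1} (set \<alpha>)" using \<alpha> by (simp_all add: constructive_partition_def)
    show "\<bar>real (app z N) - 2 ^ N * z\<bar> \<le> K" if "z \<in> E" for z N
      using app(2)[OF that] K(1)[OF that] by (rule order_trans)
    show "\<bar>real (p g N) - real (q g N) - 2 ^ N * (snd \<circ> sc) g\<bar> \<le> K" if "g \<in> gaps E" for g N
      using order_trans[OF pq(3)[OF that] K(2)[OF that]] by simp
  qed (use E gs sc \<iota> app(1) pq(1,2) in auto)
  then show ?thesis by (rule that)
qed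

section \<open>From programs to the upper limit\<close>

lemma AIC_le: "tm_computes k U p s \<Longrightarrow> AIC k U s \<le> enat (length p)"
  unfolding AIC_def by (rule Inf_lower) blast

text \<open>Carries what holds for all large levels over to all large lengths.\<close>

lemma level_at_top: "filterlim level at_top sequentially"
  unfolding filterlim_at_top
proof
  fix l
  show "\<forall>\<^sub>F n in sequentially. l \<le> level n"
  proof (rule eventually_sequentiallyI)
    fix n :: nat assume n: "2 ^ l \<le> n"
    have "(2::nat) ^ l \<le> 2 ^ level n" using order_trans[OF n level_ge[of n]] .
    then show "l \<le> level n" by simp
  qed
qed

theorem theorem12:
  fixes T :: "real \<Rightarrow> real" and \<alpha> :: "real set list"
    and M :: "nat \<Rightarrow> tm" and U :: tm and k :: nat
  assumes "computable_tm_enumeration M"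
    and "universal_tm k M U"
    and "constructive_piecewise_isometry T"
    and "constructive_partition \<alpha>"
    and "length \<alpha> \<le> k"
  shows "AE x in lebesgue_on {0..1}.
           limsup (\<lambda>n. ereal_of_enat (orbit_AIC k U T \<alpha> x n) / ereal (log 2 (real n))) \<le> 2"
proof -
  obtain E s c \<iota> app p q gs K where "orbit_coding T \<alpha> E s c \<iota> app p q gs K"
    using ex_orbit_coding[OF assms(3,4)] .
  then interpret orbit_coding T \<alpha> E s c \<iota> app p q gs K .
  have T': "preserves_lebesgue T"
    using assms(3) by (simp add: constructive_piecewise_isometry_def)
  have "rec 1 (\<lambda>e. dec_len (e ! 0))" "rec 2 (\<lambda>e. out (e ! 0) (e ! 1))"
    by (intro rec_dec_len rec_out rec_var; simp)+
  then obtain N where N: "\<And>p. (\<And>j. j < dec_len (bval p) \<Longrightarrow> out (bval p) j < k) \<Longrightarrow>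
      tm_computes k N p (map (out (bval p)) [0..<dec_len (bval p)])"
    by (rule ex_machine) blast
  \<comment> \<open>The decoder has a fixed index in the enumeration, so running it on the universal
    machine costs the constant prefix length \<open>h\<close>.\<close>
  have "N \<in> M ` {1..}" using assms(1) by (simp add: computable_tm_enumeration_def)
  then obtain m where m: "m \<ge> 1" "M m = N" by auto
  define h where "h = length (hat (bin_string m))"
  \<comment> \<open>The accumulated rounding error grows like \<open>2 ^ l\<close>, its allowance
    like \<open>4 ^ l / (2 * (l + 1)\<^sup>2)\<close>.\<close>
  have good: "\<forall>\<^sub>F l in sequentially. 1 + (2 ^ l + 1) * K \<le> 4 ^ l / (2 * (real l + 1) ^ 2)"
    by real_asymp
  show ?thesis
  proof (rule AE_mp[OF AE_orbit_avoids[OF T' E(1)]], intro AE_I2 impI)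
    fix x assume "x \<in> space (lebesgue_on {0..1::real})"
      and sep: "\<forall>\<^sub>F l in sequentially. \<forall>j<2 ^ l. \<forall>z\<in>E. clearance l < \<bar>(T ^^ j) x - z\<bar>"
    then have x: "x \<in> {0..1}" by simp
    \<comment> \<open>Prefix plus logarithm of the bound \<open>(n + 1) * (den n + 1)\<close> for
      the code. In the bound for \<open>den n\<close> the power \<open>2 ^ level n\<close> is at
      most \<open>2 * n\<close>, and \<open>level n + 1\<close> is at most
      \<open>log 2 n + 2\<close>.\<close>
    let ?f = "\<lambda>n. (real h + log 2 ((real n + 1) * (4 * real n * (log 2 (real n) + 2) ^ 2 + 1))) / log 2 (real n)"
    have "\<forall>\<^sub>F l in sequentially. 1 + (2 ^ l + 1) * K \<le> 4 ^ l / (2 * (real l + 1) ^ 2) \<and>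
        (\<forall>j<2 ^ l. \<forall>z\<in>E. clearance l < \<bar>(T ^^ j) x - z\<bar>)"
      using good sep by eventually_elim blast
    then have "\<forall>\<^sub>F n in sequentially. 1 + (2 ^ level n + 1) * K \<le> 4 ^ level n / (2 * (real (level n) + 1) ^ 2) \<and>
        (\<forall>j<2 ^ level n. \<forall>z\<in>E. clearance (level n) < \<bar>(T ^^ j) x - z\<bar>)"
      using level_at_top unfolding filterlim_iff by blast
    then have "\<forall>\<^sub>F n in sequentially. ereal_of_enat (orbit_AIC k U T \<alpha> x n) / ereal (log 2 (real n)) \<le> ereal (?f n)"
      \<comment> \<open>From 2 on the divisor \<open>log 2 n\<close> is positive.\<close>
      using eventually_ge_at_top[of 2]
    proof eventually_elim
      case (elim n)
      obtain v where v: "v \<ge> 1" "v < (n + 1) * (den n + 1)" "map (out v) [0..<dec_len v] = itinerary T \<alpha> x n"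
        "\<forall>j<dec_len v. out v j < length \<alpha>"
        using itinerary_code[OF x, of n] elim by auto
      obtain b where b: "bval b = v" "2 ^ length b \<le> v" using bval_surj[OF v(1)] by blast
      have "tm_computes k N b (itinerary T \<alpha> x n)"
        using N[of b] v(4) assms(5) unfolding b(1) v(3) by fastforce
      then have "tm_computes k U (hat (bin_string m) @ b) (itinerary T \<alpha> x n)"
        using assms(2) m by (simp add: universal_tm_def)
      then have "orbit_AIC k U T \<alpha> x n \<le> enat (h + length b)"
        unfolding orbit_AIC_def by (rule order_trans[OF AIC_le]) (simp add: h_def)
      then have "ereal_of_enat (orbit_AIC k U T \<alpha> x n) \<le> ereal_of_enat (enat (h + length b))"
        by (subst ereal_of_enat_le_iff)
      then have aic: "ereal_of_enat (orbit_AIC k U T \<alpha> x n) \<le> ereal (real (h + length b))" by simp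
      have "real (length b) \<le> log 2 ((real n + 1) * (4 * real n * (log 2 (real n) + 2) ^ 2 + 1))"
      proof -
        have level: "real (level n) \<le> log 2 (real n) + 1"
        proof -
          have "(2::real) ^ level n \<le> 2 * real n"
            using level_upper[of n] elim(2) by (metis of_nat_le_iff of_nat_mult of_nat_numeral of_nat_power)
          then have "log 2 (2 ^ level n) \<le> log 2 (2 * real n)" by (intro log_mono) auto
          then show ?thesis using elim(2) by (simp add: log_mult log_nat_power)
        qed
        have l0: "0 \<le> log 2 (real n)" using elim(2) by simp
        have "real (den n) = 2 * 2 ^ level n * (real (level n) + 1) ^ 2" by (simp add: den_def add.commute)
        also have "\<dots> \<le> 2 * (2 * real n) * (log 2 (real n) + 2) ^ 2"
        proof (intro mult_mono power_mono)
          show "(2::real) ^ level n \<le> 2 * real n"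
            using level_upper[of n] elim(2) by (metis of_nat_le_iff of_nat_mult of_nat_numeral of_nat_power)
        qed (use level in auto)
        finally have den: "real (den n) \<le> 4 * real n * (log 2 (real n) + 2) ^ 2" by simp
        have "(2::real) ^ length b \<le> real v" using b(2) by (metis of_nat_le_iff of_nat_numeral of_nat_power)
        also have "\<dots> \<le> real ((n + 1) * (den n + 1))" using v(2) by (simp only: of_nat_le_iff less_imp_le)
        also have "\<dots> \<le> (real n + 1) * (4 * real n * (log 2 (real n) + 2) ^ 2 + 1)"
          unfolding of_nat_mult using den by (intro mult_mono) auto
        finally have "log 2 (2 ^ length b) \<le> log 2 ((real n + 1) * (4 * real n * (log 2 (real n) + 2) ^ 2 + 1))"
          by (intro log_mono) auto
        then show ?thesis by (simp add: log_nat_power)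
      qed
      then have "real (h + length b) / log 2 (real n) \<le> ?f n"
        using elim(2) by (intro divide_right_mono) auto
      moreover have "ereal_of_enat (orbit_AIC k U T \<alpha> x n) / ereal (log 2 (real n)) \<le> ereal (real (h + length b)) / ereal (log 2 (real n))"
        using aic elim(2) by (intro ereal_divide_right_mono) auto
      moreover have "ereal (real (h + length b)) / ereal (log 2 (real n)) = ereal (real (h + length b) / log 2 (real n))"
      proof -
        have "log 2 (real n) > 0" using elim(2) by simp
        then show ?thesis by simp
      qed
      ultimately show ?case by (simp add: order_trans)
    qed
    then have "limsup (\<lambda>n. ereal_of_enat (orbit_AIC k U T \<alpha> x n) / ereal (log 2 (real n))) \<le> limsup (\<lambda>n. ereal (?f n))"
      by (rule Limsup_mono)
    also have "limsup (\<lambda>n. ereal (?f n)) = 2"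
    proof (rule lim_imp_Limsup)
      \<comment> \<open>The argument of the inner logarithm grows like \<open>4 * n\<^sup>2\<close>
        times a power of \<open>log 2 n\<close>, so \<open>n\<^sup>2\<close> alone determines the
        limit.\<close>
      have "?f \<longlonglongrightarrow> 2" by real_asymp
      then show "(\<lambda>n. ereal (?f n)) \<longlonglongrightarrow> 2" using tendsto_ereal by fastforce
    qed simp
    finally show "limsup (\<lambda>n. ereal_of_enat (orbit_AIC k U T \<alpha> x n) / ereal (log 2 (real n))) \<le> 2" .
  qed
qed

end
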